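(* Let $\mathcal I=\{I_n\}_{n\in\mathbb N}$ be an arbitrary filtration of a local ring $R$. Then $\ell(\mathcal I)\le\dim R$, in agreement with the classical bound $\ell(I)\le\dim R$ for ideals $I$ of $R$.
   Context: Local rings are Noetherian. A filtration $\mathcal I=\{I_n\}_{n\in\mathbb N}$ on a ring $R$ is a descending chain of ideals $R=I_0\supset I_1\supset I_2\supset\cdots$ with $I_iI_j\subset I_{i+j}$ for all $i,j\in\mathbb N$. Its Rees ring is $R[\mathcal I]=\sum_{n\ge 0}I_nt^n\subset R[t]$ (not assumed Noetherian). For $R$ local with maximal ideal $m_R$, the analytic spread of $\mathcal I$ is $\ell(\mathcal I)=\dim R[\mathcal I]/m_RR[\mathcal I]$ (Krull dimension). The analytic spread of an ideal $I$ is $\ell(I)=\dim R[It]/m_RR[It]$, where $R[It]=\bigoplus_{n\ge 0}I^nt^n$; it equals the analytic spread of the $I$-adic filtration $\{I^n\}$.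
   Formalization: When dim R = 0 the filtration is assumed to satisfy I_1 ≠ R (and the ideal I to be proper). Without this the bound fails: if dim R = 0 and I_1 = R, then every I_n = R and ℓ = dim k[t] = 1 > 0, where k = R/m_R. *)

theory Defs
  imports "HOL-Algebra.Algebra" "HOL-Library.Extended_Nat"
begin

text \<open>Local rings are Noetherian; \<open>m\<close> is the unique maximal ideal.\<close>

locale local_ring = cring R + noetherian_ring R for R (structure) +
  fixes m
  assumes maximal: "maximalideal m R"
    and maximal_unique: "maximalideal J R \<Longrightarrow> J = m"

text \<open>The supremum of the lengths of chains \<open>p\<^sub>0 \<subset> p\<^sub>1 \<subset> \<dots> \<subset> p\<^sub>n\<close> of prime ideals. In \<^typ>\<open>enat\<close> the
  supremum of the empty set is \<open>0\<close>, so the zero ring (which has no prime ideal) gets dimension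
  \<open>0\<close>.\<close>

definition krull_dim :: "('a, 'b) ring_scheme \<Rightarrow> enat" where
  "krull_dim R = Sup {enat n | n. \<exists>p :: nat \<Rightarrow> 'a set.
     (\<forall>i\<le>n. primeideal (p i) R) \<and> (\<forall>i<n. p i \<subset> p (Suc i))}"

text \<open>The inclusions in the chain \<open>R = I\<^sub>0 \<supseteq> I\<^sub>1 \<supseteq> I\<^sub>2 \<supseteq> \<dots>\<close> need not be strict; in particular
  \<open>I\<^sub>n = R\<close> for all \<open>n\<close> is a filtration.\<close>

locale ring_filtration = cring R for R (structure) +
  fixes I :: "nat \<Rightarrow> 'a set"
  assumes filt_ideal: "ideal (I n) R"
    and filt_0: "I 0 = carrier R"
    and filt_decr: "I (Suc n) \<subseteq> I n"
    and filt_mult: "I i \<cdot> I j \<subseteq> I (i + j)"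

definition rees_ring :: "('a, 'b) ring_scheme \<Rightarrow> (nat \<Rightarrow> 'a set) \<Rightarrow> ('a, nat \<Rightarrow> 'a) up_ring" where
  "rees_ring R I =
     (UP R)\<lparr>carrier := {f \<in> carrier (UP R). \<forall>n. up_ring.coeff (UP R) f n \<in> I n}\<rparr>"

text \<open>\<open>m\<close> is extended to the Rees ring along the inclusion of \<open>R\<close> as the constant polynomials.\<close>

definition analytic_spread ::
  "('a, 'b) ring_scheme \<Rightarrow> 'a set \<Rightarrow> (nat \<Rightarrow> 'a set) \<Rightarrow> enat" where
  "analytic_spread R m I =
     krull_dim (rees_ring R I Quot
       Idl\<^bsub>rees_ring R I\<^esub> ((\<lambda>a. up_ring.monom (UP R) a 0) ` m))"

primrec ideal_power :: "('a, 'b) ring_scheme \<Rightarrow> 'a set \<Rightarrow> nat \<Rightarrow> 'a set" where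
  "ideal_power R J 0 = carrier R"
| "ideal_power R J (Suc n) = ideal_power R J n \<cdot>\<^bsub>R\<^esub> J"

definition ideal_analytic_spread :: "('a, 'b) ring_scheme \<Rightarrow> 'a set \<Rightarrow> 'a set \<Rightarrow> enat" where
  "ideal_analytic_spread R m J = analytic_spread R m (ideal_power R J)"

lemma rees_ring_cring:
  fixes R (structure)
  assumes "ring_filtration R I"
  shows "cring (rees_ring R I)"
proof -
  interpret F: ring_filtration R I by fact
  interpret U: UP_cring R "UP R" by unfold_locales simp_all
  let ?S = "{f \<in> carrier (UP R). \<forall>n. up_ring.coeff (UP R) f n \<in> I n}"
  have add: "x \<oplus> y \<in> I n" if "x \<in> I n" "y \<in> I n" for x y n
    using that F.filt_ideal additive_subgroup.a_closed ideal.axioms(1) by metis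
  have zero: "\<zero> \<in> I n" for n
    using F.filt_ideal additive_subgroup.zero_closed ideal.axioms(1) by metis
  have neg: "\<ominus> x \<in> I n" if "x \<in> I n" for x n
    using that F.filt_ideal additive_subgroup.a_inv_closed ideal.axioms(1) by metis
  have car: "x \<in> carrier R" if "x \<in> I n" for x n
    using that F.filt_ideal additive_subgroup.a_Hcarr ideal.axioms(1) by metis
  have fin: "finsum R g A \<in> I n" if "finite A" "\<And>i. i \<in> A \<Longrightarrow> g i \<in> I n" for g n and A :: "nat set"
    using that
  proof (induction A rule: finite_induct)
    case empty
    then show ?case by (simp add: zero)
  next
    case (insert a A)
    have "finsum R g (insert a A) = g a \<oplus> finsum R g A"
      using insert by (intro F.finsum_insert) (auto intro: car)
    then show ?case using insert by (simp add: add)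
  qed
  have "subcring ?S (UP R)"
  proof (rule U.P.subcringI', rule U.P.subringI)
    show "\<one>\<^bsub>UP R\<^esub> \<in> ?S"
      using zero F.filt_0 by auto
    fix f assume f: "f \<in> ?S"
    then show "\<ominus>\<^bsub>UP R\<^esub> f \<in> ?S" using neg by auto
    fix g assume g: "g \<in> ?S"
    then show "f \<oplus>\<^bsub>UP R\<^esub> g \<in> ?S" using f add by auto
    have "up_ring.coeff (UP R) f i \<otimes> up_ring.coeff (UP R) g (n - i) \<in> I n" if "i \<le> n" for i n
      using F.filt_mult[of i "n - i"] f g that ideal_prod.prod[of _ "I i" _ "I (n - i)" R] by auto
    then show "f \<otimes>\<^bsub>UP R\<^esub> g \<in> ?S" using f g by (auto intro!: fin)
  qed auto
  then show ?thesis
    unfolding rees_ring_def using U.P.subcring_iff by auto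
qed

lemma (in cring) ideal_power_filtration:
  assumes J: "ideal J R"
  shows "ring_filtration R (ideal_power R J)"
proof -
  have id: "ideal (ideal_power R J n) R" for n
    by (induction n) (simp_all add: oneideal ideal_prod_is_ideal J)
  show ?thesis
  proof (intro ring_filtration.intro ring_filtration_axioms.intro)
    show "cring R" by (fact is_cring)
    show "ideal (ideal_power R J n) R" for n by (fact id)
    show "ideal_power R J 0 = carrier R" by simp
    show "ideal_power R J (Suc n) \<subseteq> ideal_power R J n" for n
      using ideal_prod_inter[OF id J] by auto
    show "ideal_power R J i \<cdot> ideal_power R J j \<subseteq> ideal_power R J (i + j)" for i j
    proof (induction j)
      case 0
      then show ?case using ideal_prod_one(1)[OF id] ideal_prod_commute[OF id oneideal] by simp
    next
      case (Suc j)
      have "ideal_power R J i \<cdot> ideal_power R J (Suc j)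
          = (ideal_power R J i \<cdot> ideal_power R J j) \<cdot> J"
        using ideal_prod_assoc[OF id id J] by simp
      also have "\<dots> \<subseteq> ideal_power R J (i + j) \<cdot> J"
      proof
        fix x assume "x \<in> (ideal_power R J i \<cdot> ideal_power R J j) \<cdot> J"
        then show "x \<in> ideal_power R J (i + j) \<cdot> J"
          by (induction rule: ideal_prod.induct) (use Suc.IH in \<open>auto intro: ideal_prod.intros\<close>)
      qed
      finally show ?case by simp
    qed
    qed
qed

end

theory Submission
  imports Defs
begin

text \<open>
  Let \<open>d = dim R\<close> be finite, let \<open>S \<subseteq> R[t]\<close> be the Rees ring, and let \<open>Q\<^sub>0 \<subset> \<dots> \<subset> Q\<^sub>n\<close> be primes of \<open>S\<close>
  that contain \<open>m\<close>. The claim is \<open>n \<le> d\<close>. The ring \<open>S\<close> may fail to be Noetherian, but only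
  finitely many of its elements matter: some \<open>a\<^sub>i \<in> Q\<^sub>i - Q\<^sub>i\<^sub>-\<^sub>1\<close> for each \<open>i\<close>. Modulo \<open>Q\<^sub>0\<close> these are
  algebraically independent over \<open>R/m\<close>, because in a relation one can cancel powers of \<open>a\<^sub>1\<close>,
  reduce modulo \<open>Q\<^sub>1\<close>, and continue with \<open>a\<^sub>2, \<dots>, a\<^sub>n\<close>.

  After passing to a domain, the argument is that of Cohen's dimension inequality. Let \<open>B\<close> be a
  Noetherian domain, \<open>M\<close> a prime of \<open>B\<close>, and \<open>P\<close> a prime of \<open>B[x]\<close> over \<open>M\<close> such that the residue of \<open>x\<close>
  is transcendental over \<open>B/M\<close>. The preimage of \<open>P\<close> in \<open>B[X]\<close> is \<open>M B[X]\<close>, which has the same height as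
  \<open>M\<close> by Krull's height theorem. So the height of \<open>P\<close> is at most that of \<open>M\<close>, and it is smaller if \<open>x\<close> is algebraic
  over \<open>B\<close>, because then the kernel of \<open>B[X] \<rightarrow> B[x]\<close> is a nonzero prime (\<open>height_adjoin\<close>). Adjoin
  \<open>a\<^sub>n, \<dots>, a\<^sub>1\<close> in this order, starting from the domain \<open>D = R/p\<close>. Any two elements of \<open>D[t]\<close> are
  algebraically dependent over \<open>D\<close>, so at most one of the \<open>n\<close> steps fails to lower the height; and the
  height that remains is at least one because the maximal ideal of \<open>D\<close> is nonzero. Altogether
  \<open>(n - 1) + 1 \<le> d\<close> (\<open>chain_length_bound\<close>).

  The prime \<open>p\<close> is the trace on \<open>R\<close> of a prime of \<open>R[t]\<close> that misses \<open>S - Q\<^sub>0\<close>, or a prime strictly below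
  \<open>m\<close> if this trace is \<open>m\<close> itself (\<open>rees_prime_contains_extension\<close>). No such \<open>p\<close> exists for \<open>d = 0\<close>; there the
  hypothesis \<open>I\<^sub>1 \<noteq> R\<close> makes everything of positive degree nilpotent, and all primes
  containing \<open>m\<close> coincide (\<open>rees_chain_dim_0\<close>). The bound for an ideal \<open>J\<close> is the bound for the \<open>J\<close>-adic
  filtration.

  The commutative algebra behind this is the principal ideal theorem
  (\<open>prime_between_containing\<close>), the height theorem and its converse (\<open>height_theorem\<close>,
  \<open>parameters_exist\<close>), and Hilbert's basis theorem (\<open>UP_noetherian\<close>). Localization is expressed by
  saturated ideals, and subrings of a fixed ring take the place of towers of extensions.
\<close>

section \<open>Ideals of commutative rings\<close>

lemma (in ring) ideal_closed:
  assumes "ideal I R"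
  shows "\<zero> \<in> I"
    and "I \<subseteq> carrier R"
    and "x \<in> I \<Longrightarrow> y \<in> I \<Longrightarrow> x \<oplus> y \<in> I"
    and "x \<in> I \<Longrightarrow> \<ominus> x \<in> I"
    and "x \<in> I \<Longrightarrow> y \<in> I \<Longrightarrow> x \<ominus> y \<in> I"
    and "r \<in> carrier R \<Longrightarrow> x \<in> I \<Longrightarrow> r \<otimes> x \<in> I"
    and "r \<in> carrier R \<Longrightarrow> x \<in> I \<Longrightarrow> x \<otimes> r \<in> I"
proof -
  interpret I: ideal I R by fact
  show "\<zero> \<in> I" by simp
  show "I \<subseteq> carrier R" by (rule I.a_subset)
  show "x \<in> I \<Longrightarrow> y \<in> I \<Longrightarrow> x \<oplus> y \<in> I" by simp
  show "x \<in> I \<Longrightarrow> \<ominus> x \<in> I" by simp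
  show "x \<in> I \<Longrightarrow> y \<in> I \<Longrightarrow> x \<ominus> y \<in> I" by (simp add: a_minus_def)
  show "r \<in> carrier R \<Longrightarrow> x \<in> I \<Longrightarrow> r \<otimes> x \<in> I" by (rule I.I_l_closed)
  show "r \<in> carrier R \<Longrightarrow> x \<in> I \<Longrightarrow> x \<otimes> r \<in> I" by (rule I.I_r_closed)
qed

lemma (in cring) idealI_closed:
  assumes sub: "I \<subseteq> carrier R"
    and zero: "\<zero> \<in> I"
    and add: "\<And>x y. x \<in> I \<Longrightarrow> y \<in> I \<Longrightarrow> x \<oplus> y \<in> I"
    and mult: "\<And>r x. r \<in> carrier R \<Longrightarrow> x \<in> I \<Longrightarrow> r \<otimes> x \<in> I"
  shows "ideal I R"
proof (rule idealI[OF ring_axioms])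
  show "subgroup I (add_monoid R)"
  proof (rule add.subgroupI)
    show "I \<subseteq> carrier R" by fact
    show "I \<noteq> {}" using zero by auto
    fix x assume x: "x \<in> I"
    then have "\<ominus> x = (\<ominus> \<one>) \<otimes> x" using sub by (simp add: l_minus subset_iff)
    then show "\<ominus> x \<in> I" using mult[OF _ x, of "\<ominus> \<one>"] by simp
  qed (use add in auto)
  fix a x assume a: "a \<in> I" and x: "x \<in> carrier R"
  then show "x \<otimes> a \<in> I" using mult by blast
  then show "a \<otimes> x \<in> I" using a x sub m_comm by (metis subsetD)
qed

text \<open>The ideal \<open>H + (z)\<close>, written elementwise so that membership unfolds to a witness.\<close>

definition adjoin :: "('a, 'b) ring_scheme \<Rightarrow> 'a set \<Rightarrow> 'a \<Rightarrow> 'a set" where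
  "adjoin R H z = {h \<oplus>\<^bsub>R\<^esub> r \<otimes>\<^bsub>R\<^esub> z | h r. h \<in> H \<and> r \<in> carrier R}"

lemma (in cring) mem_adjoin:
  "x \<in> adjoin R H z \<longleftrightarrow> (\<exists>h\<in>H. \<exists>r\<in>carrier R. x = h \<oplus> r \<otimes> z)"
  unfolding adjoin_def by auto

lemma (in cring) adjoin_ideal:
  assumes "ideal H R" "z \<in> carrier R"
  shows "ideal (adjoin R H z) R" and "H \<subseteq> adjoin R H z" and "z \<in> adjoin R H z"
proof -
  note H = ideal_closed[OF assms(1)]
  have "adjoin R H z = set_add R H (PIdl z)"
    unfolding adjoin_def set_add_def' cgenideal_def by auto
  then show "ideal (adjoin R H z) R" using assms add_ideals cgenideal_ideal by simp
  show "H \<subseteq> adjoin R H z"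
  proof
    fix h assume h: "h \<in> H"
    then have "h = h \<oplus> \<zero> \<otimes> z" using H(2) assms by auto
    then show "h \<in> adjoin R H z" using h mem_adjoin by blast
  qed
  have "z = \<zero> \<oplus> \<one> \<otimes> z" using assms by simp
  then show "z \<in> adjoin R H z" using H(1) mem_adjoin by blast
qed

lemma (in ring) primeideal_closed:
  assumes "primeideal P R"
  shows "ideal P R" and "\<one> \<notin> P"
    and "a \<in> carrier R \<Longrightarrow> b \<in> carrier R \<Longrightarrow> a \<otimes> b \<in> P \<Longrightarrow> a \<in> P \<or> b \<in> P"
proof -
  show id: "ideal P R" using assms primeideal.axioms(1) by blast
  show "\<one> \<notin> P" using ideal.one_imp_carrier[OF id] primeideal.I_notcarr[OF assms] by auto
  show "a \<in> carrier R \<Longrightarrow> b \<in> carrier R \<Longrightarrow> a \<otimes> b \<in> P \<Longrightarrow> a \<in> P \<or> b \<in> P"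
    using primeideal.I_prime[OF assms] by blast
qed

lemma (in cring) primeidealI_closed:
  assumes "ideal P R" "\<one> \<notin> P"
    and "\<And>a b. a \<in> carrier R \<Longrightarrow> b \<in> carrier R \<Longrightarrow> a \<otimes> b \<in> P \<Longrightarrow> a \<in> P \<or> b \<in> P"
  shows "primeideal P R"
  using assms one_closed by (intro primeidealI cring_axioms) auto

lemma (in cring) prime_complement_mult:
  assumes "primeideal P R" "s \<in> carrier R - P" "t \<in> carrier R - P"
  shows "s \<otimes> t \<in> carrier R - P"
  using assms primeideal_closed(3) by auto

lemma (in cring) prime_pow_mem:
  assumes "primeideal P R" "a \<in> carrier R" "a [^] (n::nat) \<in> P"
  shows "a \<in> P"
  using assms(3)
proof (induction n)
  case 0
  then show ?case using primeideal_closed(2)[OF assms(1)] by simp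
next
  case (Suc n)
  then show ?case using primeideal_closed(3)[OF assms(1), of "a [^] n" a] assms(2) by auto
qed

lemma (in cring) adjoin_least:
  assumes "ideal Y R" "H \<subseteq> Y" "z \<in> Y"
  shows "adjoin R H z \<subseteq> Y"
proof
  fix v assume "v \<in> adjoin R H z"
  then obtain h r where "h \<in> H" "r \<in> carrier R" "v = h \<oplus> r \<otimes> z" by (auto simp: mem_adjoin)
  then show "v \<in> Y" using ideal_closed(3,6)[OF assms(1)] assms(2,3) by blast
qed

section \<open>Noetherian commutative rings\<close>

locale noetherian_cring = cring R + noetherian_ring R for R (structure)
begin

lemma maximal_in_family:
  assumes "F \<noteq> {}" "\<And>J. J \<in> F \<Longrightarrow> ideal J R"
  shows "\<exists>M\<in>F. \<forall>J\<in>F. M \<subseteq> J \<longrightarrow> J = M"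
proof (rule subset_Zorn_nonempty[OF assms(1)])
  fix C assume C: "C \<noteq> {}" "subset.chain F C"
  then have "subset.chain {I. ideal I R} C" using assms(2) by (auto simp: subset.chain_def)
  then have "\<Union>C \<in> C" using ideal_chain_is_trivial C(1) by blast
  then show "\<Union>C \<in> F" using C(2) by (auto simp: subset.chain_def)
qed

lemma noetherian_induct:
  assumes "ideal I R"
    and step: "\<And>I. ideal I R \<Longrightarrow> (\<And>J. ideal J R \<Longrightarrow> I \<subset> J \<Longrightarrow> Q J) \<Longrightarrow> Q I"
  shows "Q I"
proof (rule ccontr)
  assume "\<not> Q I"
  then have "{J. ideal J R \<and> \<not> Q J} \<noteq> {}" using assms(1) by auto
  from maximal_in_family[OF this] obtain M where MF: "M \<in> {J. ideal J R \<and> \<not> Q J}"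
    and maxF: "\<forall>J\<in>{J. ideal J R \<and> \<not> Q J}. M \<subseteq> J \<longrightarrow> J = M" by blast
  then have M: "ideal M R" "\<not> Q M"
    and max: "\<And>J. ideal J R \<Longrightarrow> \<not> Q J \<Longrightarrow> M \<subseteq> J \<Longrightarrow> J = M" by simp_all
  have "Q M" by (rule step[OF M(1)]) (use max in blast)
  then show False using M by simp
qed

text \<open>An ideal that is maximal among those disjoint from a multiplicative set is prime: if
  neither \<open>a\<close> nor \<open>b\<close> lies in it, adjoining either of them produces an element of the set, and the
  product of these two elements shows that \<open>a b\<close> does not lie in it.\<close>

lemma prime_disjoint_from_monoid:
  assumes W: "ideal W R" and M: "M \<subseteq> carrier R" "\<one> \<in> M"
    "\<And>a b. a \<in> M \<Longrightarrow> b \<in> M \<Longrightarrow> a \<otimes> b \<in> M"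
    and disj: "M \<inter> W = {}"
  shows "\<exists>q. primeideal q R \<and> W \<subseteq> q \<and> M \<inter> q = {}"
proof -
  let ?F = "{q. ideal q R \<and> W \<subseteq> q \<and> M \<inter> q = {}}"
  have "?F \<noteq> {}" using W disj by auto
  from maximal_in_family[OF this] obtain q where qF: "q \<in> ?F"
    and maxF: "\<forall>J\<in>?F. q \<subseteq> J \<longrightarrow> J = q" by blast
  then have q: "ideal q R" "W \<subseteq> q" "M \<inter> q = {}"
    and max: "\<And>J. ideal J R \<Longrightarrow> W \<subseteq> J \<Longrightarrow> M \<inter> J = {} \<Longrightarrow> q \<subseteq> J \<Longrightarrow> J = q" by simp_all
  note qc = ideal_closed[OF q(1)]
  have meets: "\<exists>h\<in>q. \<exists>r\<in>carrier R. h \<oplus> r \<otimes> a \<in> M" if a: "a \<in> carrier R" "a \<notin> q" for a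
  proof (rule ccontr)
    assume "\<not> ?thesis"
    then have "M \<inter> (adjoin R q a) = {}" by (auto simp: mem_adjoin)
    then have "adjoin R q a = q"
      using max adjoin_ideal[OF q(1) a(1)] q(2) by blast
    then show False using adjoin_ideal(3)[OF q(1) a(1)] a(2) by simp
  qed
  have "primeideal q R"
  proof (rule primeidealI_closed[OF q(1)])
    show "\<one> \<notin> q" using q(3) M(2) by auto
    fix a b assume ab: "a \<in> carrier R" "b \<in> carrier R" "a \<otimes> b \<in> q"
    show "a \<in> q \<or> b \<in> q"
    proof (rule ccontr)
      assume "\<not> ?thesis"
      then obtain h r h' r' where h: "h \<in> q" "r \<in> carrier R" "h \<oplus> r \<otimes> a \<in> M"
        and h': "h' \<in> q" "r' \<in> carrier R" "h' \<oplus> r' \<otimes> b \<in> M" using meets ab by meson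
      have hc: "h \<in> carrier R" "h' \<in> carrier R" using h h' qc(2) by auto
      have "(h \<oplus> r \<otimes> a) \<otimes> (h' \<oplus> r' \<otimes> b)
          = h \<otimes> (h' \<oplus> r' \<otimes> b) \<oplus> ((r \<otimes> a) \<otimes> h' \<oplus> (r \<otimes> r') \<otimes> (a \<otimes> b))"
        using hc h h' ab by algebra
      also have "\<dots> \<in> q" using qc h h' ab hc by (intro qc(3)) auto
      finally show False using M(3)[OF h(3) h'(3)] q(3) by auto
    qed
  qed
  then show ?thesis using q by auto
qed

end

section \<open>Ideals saturated with respect to a prime\<close>

text \<open>The contraction of \<open>H R\<^sub>P\<close> to \<open>R\<close>. Arguments in the local ring \<open>R\<^sub>P\<close> are carried out with
  saturated ideals of \<open>R\<close>, which correspond to the ideals of \<open>R\<^sub>P\<close>.\<close>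

definition saturation :: "('a, 'b) ring_scheme \<Rightarrow> 'a set \<Rightarrow> 'a set \<Rightarrow> 'a set" where
  "saturation R P H = {a \<in> carrier R. \<exists>s \<in> carrier R - P. s \<otimes>\<^bsub>R\<^esub> a \<in> H}"

lemma saturation_mono: "H \<subseteq> K \<Longrightarrow> saturation R P H \<subseteq> saturation R P K"
  unfolding saturation_def by blast

context cring
begin

lemma saturation_ideal:
  assumes P: "primeideal P R" and H: "ideal H R"
  shows "ideal (saturation R P H) R"
proof (rule idealI_closed)
  note Hc = ideal_closed[OF H]
  note one = primeideal_closed(2)[OF P]
  show "saturation R P H \<subseteq> carrier R" by (auto simp: saturation_def)
  show "\<zero> \<in> saturation R P H" using Hc one by (auto simp: saturation_def intro!: bexI[of _ \<one>])
  fix x assume x: "x \<in> saturation R P H"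
  then obtain s where s: "x \<in> carrier R" "s \<in> carrier R - P" "s \<otimes> x \<in> H"
    by (auto simp: saturation_def)
  { fix y assume "y \<in> saturation R P H"
    then obtain t where t: "y \<in> carrier R" "t \<in> carrier R - P" "t \<otimes> y \<in> H"
      by (auto simp: saturation_def)
    have "(s \<otimes> t) \<otimes> (x \<oplus> y) = t \<otimes> (s \<otimes> x) \<oplus> s \<otimes> (t \<otimes> y)"
      using s t by (auto, algebra)
    also have "\<dots> \<in> H" using Hc s t by auto
    finally show "x \<oplus> y \<in> saturation R P H"
      using s t prime_complement_mult[OF P s(2) t(2)] unfolding saturation_def by auto }
  { fix r assume r: "r \<in> carrier R"
    have "s \<otimes> (r \<otimes> x) = r \<otimes> (s \<otimes> x)" using s r by (auto, algebra)
    then show "r \<otimes> x \<in> saturation R P H"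
      using Hc(6)[OF r s(3)] s r unfolding saturation_def by (auto intro!: bexI[of _ s]) }
qed

lemma saturation_extensive:
  assumes P: "primeideal P R" and H: "ideal H R"
  shows "H \<subseteq> saturation R P H"
proof
  fix x assume "x \<in> H"
  then show "x \<in> saturation R P H"
    using ideal_closed[OF H] primeideal_closed(2)[OF P]
    by (auto simp: saturation_def intro!: bexI[of _ \<one>])
qed

lemma saturation_idem:
  assumes P: "primeideal P R"
  shows "saturation R P (saturation R P H) \<subseteq> saturation R P H"
proof
  fix x assume "x \<in> saturation R P (saturation R P H)"
  then obtain s t where s: "x \<in> carrier R" "s \<in> carrier R - P" "t \<in> carrier R - P"
    "t \<otimes> (s \<otimes> x) \<in> H" unfolding saturation_def by auto
  moreover have "t \<otimes> (s \<otimes> x) = (t \<otimes> s) \<otimes> x" using s m_assoc by auto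
  ultimately show "x \<in> saturation R P H"
    using prime_complement_mult[OF P s(3) s(2)] unfolding saturation_def by auto
qed

lemma saturatedD:
  assumes "saturation R P H \<subseteq> H" "s \<in> carrier R - P" "a \<in> carrier R" "s \<otimes> a \<in> H"
  shows "a \<in> H"
  using assms unfolding saturation_def by auto

end

context noetherian_cring
begin

text \<open>If \<open>P\<close> is minimal over \<open>H\<close>, then \<open>R\<^sub>P / H R\<^sub>P\<close> has a nonzero element killed by \<open>P\<close>: a maximal
  member of the family of annihilators \<open>(H : z)\<close> with \<open>z \<notin> H\<close> is prime, and it lies between \<open>H\<close>
  and \<open>P\<close>.\<close>

lemma socle_element:
  assumes P: "primeideal P R" and H: "ideal H R" and sat: "saturation R P H \<subseteq> H"
    and proper: "H \<noteq> carrier R"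
    and min: "\<And>q. primeideal q R \<Longrightarrow> H \<subseteq> q \<Longrightarrow> q \<subseteq> P \<Longrightarrow> q = P"
  shows "\<exists>z\<in>carrier R. z \<notin> H \<and> (\<forall>p\<in>P. p \<otimes> z \<in> H)"
proof -
  note Hc = ideal_closed[OF H]
  define ann where "ann z = {a \<in> carrier R. a \<otimes> z \<in> H}" for z
  have annI: "ideal (ann z) R" if z: "z \<in> carrier R" for z
  proof (rule idealI_closed)
    show "ann z \<subseteq> carrier R" "\<zero> \<in> ann z" using z Hc by (auto simp: ann_def)
    fix x assume x: "x \<in> ann z"
    { fix y assume y: "y \<in> ann z"
      then show "x \<oplus> y \<in> ann z" using x z Hc(3) by (auto simp: ann_def l_distr) }
    { fix r assume "r \<in> carrier R"
      then show "r \<otimes> x \<in> ann z" using x z Hc(6) by (auto simp: ann_def m_assoc) }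
  qed
  let ?F = "{ann z | z. z \<in> carrier R \<and> z \<notin> H}"
  have "?F \<noteq> {}" using proper Hc(2) by auto
  moreover have "\<And>J. J \<in> ?F \<Longrightarrow> ideal J R" using annI by auto
  ultimately have "\<exists>M\<in>?F. \<forall>J\<in>?F. M \<subseteq> J \<longrightarrow> J = M" by (rule maximal_in_family)
  then obtain z where z: "z \<in> carrier R" "z \<notin> H"
    and max: "\<And>y. y \<in> carrier R \<Longrightarrow> y \<notin> H \<Longrightarrow> ann z \<subseteq> ann y \<Longrightarrow> ann y = ann z"
    by (elim bexE CollectE exE conjE) (metis (mono_tags, lifting) mem_Collect_eq)
  have "primeideal (ann z) R"
  proof (rule primeidealI_closed[OF annI[OF z(1)]])
    show "\<one> \<notin> ann z" using z by (auto simp: ann_def)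
    fix a b assume ab: "a \<in> carrier R" "b \<in> carrier R" "a \<otimes> b \<in> ann z"
    show "a \<in> ann z \<or> b \<in> ann z"
    proof (cases "b \<in> ann z")
      case False
      then have bz: "b \<otimes> z \<in> carrier R" "b \<otimes> z \<notin> H" using ab z by (auto simp: ann_def)
      have "ann z \<subseteq> ann (b \<otimes> z)"
      proof
        fix c assume c: "c \<in> ann z"
        then have "c \<otimes> (b \<otimes> z) = b \<otimes> (c \<otimes> z)" using ab z by (auto simp: ann_def m_lcomm)
        then show "c \<in> ann (b \<otimes> z)" using c ab Hc(6) by (auto simp: ann_def)
      qed
      then have "ann (b \<otimes> z) = ann z" using max bz by blast
      moreover have "a \<in> ann (b \<otimes> z)" using ab z by (auto simp: ann_def m_assoc)
      ultimately show ?thesis by simp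
    qed simp
  qed
  moreover have "H \<subseteq> ann z" using Hc z by (auto simp: ann_def)
  moreover have "ann z \<subseteq> P"
  proof
    fix s assume s: "s \<in> ann z"
    then show "s \<in> P" using saturatedD[OF sat, of s z] z by (auto simp: ann_def)
  qed
  ultimately have "ann z = P" using min by blast
  then show ?thesis using z by (auto simp: ann_def)
qed

text \<open>If \<open>P\<close> is minimal over \<open>W\<close>, then \<open>R\<^sub>P / W R\<^sub>P\<close> is Artinian. Noetherian induction on \<open>W\<close>
  replaces a theory of length: for a socle element \<open>z\<close> modulo \<open>W\<close>, the chain of the
  \<open>H\<^sub>n + (z)\<close> stabilizes because its members contain an ideal larger than \<open>W\<close>, and since \<open>P z \<subseteq> W\<close>
  the only further information in \<open>H\<^sub>n\<close> is whether it contains \<open>z\<close>.\<close>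

lemma saturated_chain_stabilizes:
  assumes P: "primeideal P R" and W: "ideal W R"
    and sat: "saturation R P W \<subseteq> W"
    and min: "\<And>q. primeideal q R \<Longrightarrow> W \<subseteq> q \<Longrightarrow> q \<subseteq> P \<Longrightarrow> q = P"
    and "\<And>n. ideal (H n) R" "\<And>n. saturation R P (H n) \<subseteq> H n" "\<And>n::nat. W \<subseteq> H n"
    and "\<And>n. H (Suc n) \<subseteq> H n"
  shows "\<exists>N. \<forall>n\<ge>N. H n \<subseteq> H (Suc n)"
proof -
  (* The hypotheses that depend on W or on the chain are made part of the induction statement. *)
  have "(\<forall>q. primeideal q R \<longrightarrow> W \<subseteq> q \<longrightarrow> q \<subseteq> P \<longrightarrow> q = P) \<longrightarrow> saturation R P W \<subseteq> W \<longrightarrow>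
     (\<forall>H::nat \<Rightarrow> 'a set. (\<forall>n. ideal (H n) R \<and> saturation R P (H n) \<subseteq> H n \<and> W \<subseteq> H n \<and> H (Suc n) \<subseteq> H n)
       \<longrightarrow> (\<exists>N. \<forall>n\<ge>N. H n \<subseteq> H (Suc n)))"
  proof (induction rule: noetherian_induct[OF W])
    case (1 W)
    note W = 1(1) and IH = 1(2)
    show ?case
    proof (intro impI allI)
      fix H :: "nat \<Rightarrow> 'a set"
      assume min: "\<forall>q. primeideal q R \<longrightarrow> W \<subseteq> q \<longrightarrow> q \<subseteq> P \<longrightarrow> q = P"
        and sat: "saturation R P W \<subseteq> W"
        and H: "\<forall>n. ideal (H n) R \<and> saturation R P (H n) \<subseteq> H n \<and> W \<subseteq> H n \<and> H (Suc n) \<subseteq> H n"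
      have Hid: "ideal (H n) R" and Hsat: "saturation R P (H n) \<subseteq> H n"
        and WH: "W \<subseteq> H n" and Hdec: "H (Suc n) \<subseteq> H n" for n using H by auto
      show "\<exists>N. \<forall>n\<ge>N. H n \<subseteq> H (Suc n)"
      proof (cases "W = carrier R")
        case True
        then have "H n \<subseteq> H (Suc n)" for n using WH ideal_closed(2)[OF Hid] by blast
        then show ?thesis by auto
      next
        case False
        obtain z where z: "z \<in> carrier R" "z \<notin> W" "\<And>p. p \<in> P \<Longrightarrow> p \<otimes> z \<in> W"
          using socle_element[OF P W sat False] min by blast
        define up where "up K = saturation R P (adjoin R K z)" for K
        have up: "ideal (up K) R" "saturation R P (up K) \<subseteq> up K" "K \<subseteq> up K" "z \<in> up K"
          if "ideal K R" for K
          using adjoin_ideal[OF that z(1)] saturation_ideal[OF P] saturation_idem[OF P]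
            saturation_extensive[OF P] unfolding up_def by blast+
        have upmono: "up K \<subseteq> up L" if "K \<subseteq> L" for K L
          unfolding up_def using that
          by (intro saturation_mono subsetI) (auto simp: mem_adjoin subset_iff)
        have "\<exists>N. \<forall>n\<ge>N. up (H n) \<subseteq> up (H (Suc n))"
        proof -
          have "W \<subset> up W" using up[OF W] z by blast
          from IH[OF up(1)[OF W] this] have "(\<forall>q. primeideal q R \<longrightarrow> up W \<subseteq> q \<longrightarrow> q \<subseteq> P \<longrightarrow> q = P) \<longrightarrow>
            (\<forall>H::nat \<Rightarrow> 'a set. (\<forall>n. ideal (H n) R \<and> saturation R P (H n) \<subseteq> H n \<and> up W \<subseteq> H n \<and> H (Suc n) \<subseteq> H n)
              \<longrightarrow> (\<exists>N. \<forall>n\<ge>N. H n \<subseteq> H (Suc n)))" using up[OF W] by blast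
          moreover have "\<forall>q. primeideal q R \<longrightarrow> up W \<subseteq> q \<longrightarrow> q \<subseteq> P \<longrightarrow> q = P"
            using min up(3)[OF W] by blast
          moreover have "\<forall>n. ideal (up (H n)) R \<and> saturation R P (up (H n)) \<subseteq> up (H n) \<and> up W \<subseteq> up (H n) \<and> up (H (Suc n)) \<subseteq> up (H n)"
            using up[OF Hid] upmono WH Hdec by blast
          ultimately show ?thesis by (elim impE allE[of _ "\<lambda>n. up (H n)"]) auto
        qed
        then obtain N where N: "\<And>n. n \<ge> N \<Longrightarrow> up (H n) \<subseteq> up (H (Suc n))" by auto
        have "\<exists>N'. \<forall>n\<ge>N'. z \<in> H n \<longrightarrow> z \<in> H (Suc n)"
        proof (cases "\<forall>n. z \<in> H n")
          case True
          then show ?thesis by auto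
        next
          case False
          then obtain k where k: "z \<notin> H k" by auto
          have "H n \<subseteq> H k" if "n \<ge> k" for n
            using that Hdec by (induction n rule: dec_induct) auto
          then show ?thesis using k by auto
        qed
        then obtain N' where N': "\<And>n. n \<ge> N' \<Longrightarrow> z \<in> H n \<Longrightarrow> z \<in> H (Suc n)" by auto
        have "H n \<subseteq> H (Suc n)" if n: "n \<ge> max N N'" for n
        proof
          note Hc = ideal_closed[OF Hid[of n]] and Hc' = ideal_closed[OF Hid[of "Suc n"]]
          fix a assume a: "a \<in> H n"
          then have ac: "a \<in> carrier R" using Hc(2) by auto
          have "a \<in> up (H (Suc n))" using N[of n] n up(3)[OF Hid[of n]] a by auto
          then obtain s b r where s: "s \<in> carrier R - P" and b: "b \<in> H (Suc n)" and r: "r \<in> carrier R"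
            and eq: "s \<otimes> a = b \<oplus> r \<otimes> z"
            unfolding up_def saturation_def by (auto simp: mem_adjoin)
          have bc: "b \<in> carrier R" using b Hc'(2) by auto
          have "r \<otimes> z = s \<otimes> a \<ominus> b" using eq s ac bc r z(1) by (auto, algebra)
          moreover have "b \<in> H n" using b Hdec by auto
          ultimately have rz: "r \<otimes> z \<in> H n" using Hc(5,6) a s by auto
          have "r \<otimes> z \<in> H (Suc n)"
          proof (cases "r \<in> P")
            case True
            then show ?thesis using z(3) WH by blast
          next
            case False
            then have "z \<in> H n" using saturatedD[OF Hsat _ z(1) rz] r by auto
            then have "z \<in> H (Suc n)" using N' n by auto
            then show ?thesis using Hc'(6) r by auto
          qed
          then have "s \<otimes> a \<in> H (Suc n)" using eq b Hc'(3) by auto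
          then show "a \<in> H (Suc n)" using saturatedD[OF Hsat s ac] by auto
        qed
        then show ?thesis by blast
      qed
    qed
  qed
  then show ?thesis using min sat assms(5-8) by (elim impE allE[of _ H]) auto
qed

text \<open>Nakayama's lemma in \<open>R\<^sub>P\<close>: the hypothesis says \<open>Y = H + x Y\<close> after localization. Instead of
  eliminating generators of \<open>Y\<close> one after the other, the proof takes a maximal saturated proper
  subideal \<open>E\<close> of \<open>Y\<close> above \<open>H\<close> and some \<open>a \<in> Y\<close> outside \<open>E\<close>. Modulo \<open>E\<close>, the ideal \<open>Y\<close> is
  locally generated by \<open>a\<close>, so that a multiple \<open>(t s - x c) a\<close> lies in \<open>E\<close>; its factor
  \<open>t s - x c\<close> is a unit of \<open>R\<^sub>P\<close>.\<close>

lemma saturated_nakayama: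
  assumes P: "primeideal P R" and x: "x \<in> P"
    and H: "ideal H R" "saturation R P H \<subseteq> H"
    and Y: "ideal Y R" "saturation R P Y \<subseteq> Y" and HY: "H \<subseteq> Y"
    and gen: "\<And>a. a \<in> Y \<Longrightarrow> \<exists>s\<in>carrier R - P. \<exists>b\<in>H. \<exists>r\<in>Y. s \<otimes> a = b \<oplus> x \<otimes> r"
  shows "Y \<subseteq> H"
proof (rule ccontr)
  assume "\<not> Y \<subseteq> H"
  let ?F = "{E. ideal E R \<and> saturation R P E \<subseteq> E \<and> H \<subseteq> E \<and> E \<subset> Y}"
  have "H \<in> ?F" using H HY \<open>\<not> Y \<subseteq> H\<close> by blast
  then have "?F \<noteq> {}" by blast
  from maximal_in_family[OF this] obtain E where EF: "E \<in> ?F"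
    and maxF: "\<forall>J\<in>?F. E \<subseteq> J \<longrightarrow> J = E" by blast
  then have E: "ideal E R" "saturation R P E \<subseteq> E" "H \<subseteq> E" "E \<subset> Y"
    and max: "\<And>J. ideal J R \<Longrightarrow> saturation R P J \<subseteq> J \<Longrightarrow> H \<subseteq> J \<Longrightarrow> J \<subset> Y \<Longrightarrow> E \<subseteq> J \<Longrightarrow> J = E" by simp_all
  note Ec = ideal_closed[OF E(1)] and Yc = ideal_closed[OF Y(1)]
  have xc: "x \<in> carrier R" using x primeideal_closed(1)[OF P] ideal_closed(2) by blast
  obtain a where a: "a \<in> Y" "a \<notin> E" using E(4) by auto
  have ac: "a \<in> carrier R" using a Yc(2) by auto
  define J where "J = saturation R P (adjoin R E a)"
  have J: "ideal J R" "saturation R P J \<subseteq> J" "E \<subseteq> J" "a \<in> J"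
    using adjoin_ideal[OF E(1) ac] saturation_ideal[OF P] saturation_idem[OF P]
      saturation_extensive[OF P] unfolding J_def by blast+
  have "adjoin R E a \<subseteq> Y" using adjoin_least[OF Y(1)] E(4) a by blast
  then have "J \<subseteq> Y" unfolding J_def using saturation_mono Y(2) by blast
  then have JY: "J = Y" using max J E a by blast
  obtain s b r where s: "s \<in> carrier R - P" "b \<in> H" "r \<in> Y" "s \<otimes> a = b \<oplus> x \<otimes> r" using gen a by blast
  then have "r \<in> J" using JY by simp
  then obtain t e c where t: "t \<in> carrier R - P" "e \<in> E" "c \<in> carrier R" "t \<otimes> r = e \<oplus> c \<otimes> a"
    unfolding J_def saturation_def by (auto simp: mem_adjoin)
  have bE: "b \<in> E" using s E by auto
  have carr: "b \<in> carrier R" "e \<in> carrier R" "r \<in> carrier R" "s \<in> carrier R" "t \<in> carrier R"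
    using bE t(1,2) s(1,3) Ec(2) Yc(2) by auto
  have "(t \<otimes> s \<ominus> x \<otimes> c) \<otimes> a = t \<otimes> (s \<otimes> a) \<ominus> x \<otimes> (c \<otimes> a)"
    using carr ac xc t(3) by algebra
  also have "\<dots> = t \<otimes> b \<oplus> x \<otimes> (t \<otimes> r) \<ominus> x \<otimes> (c \<otimes> a)" using s(4) carr xc ac t(3) by algebra
  also have "\<dots> = t \<otimes> b \<oplus> x \<otimes> e" unfolding t(4) using carr xc ac t(3) by algebra
  also have "\<dots> \<in> E" using Ec(3,6) bE t(2) carr xc by blast
  finally have mem: "(t \<otimes> s \<ominus> x \<otimes> c) \<otimes> a \<in> E" by blast
  note Pc = ideal_closed[OF primeideal_closed(1)[OF P]]
  have "t \<otimes> s \<ominus> x \<otimes> c \<notin> P"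
  proof
    assume "t \<otimes> s \<ominus> x \<otimes> c \<in> P"
    then have "(t \<otimes> s \<ominus> x \<otimes> c) \<oplus> c \<otimes> x \<in> P" using Pc(3,6) x t(3) by blast
    moreover have "(t \<otimes> s \<ominus> x \<otimes> c) \<oplus> c \<otimes> x = t \<otimes> s" using carr xc t(3) by algebra
    ultimately show False using prime_complement_mult[OF P t(1) s(1)] by auto
  qed
  then have "a \<in> E" using saturatedD[OF E(2) _ ac mem] carr xc t(3) by auto
  then show False using a by simp
qed

end

section \<open>The principal ideal theorem\<close>

context noetherian_cring
begin

text \<open>Krull's principal ideal theorem, in the form in which it is used for chains: the link \<open>q1\<close>
  of a chain \<open>q0 \<subset> q1 \<subset> P\<close> can be exchanged for a prime containing a given \<open>x \<in> P\<close>. Otherwise \<open>P\<close>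
  is minimal over \<open>q0 + (x)\<close>. For \<open>y \<in> q1 - q0\<close> let \<open>Y n\<close> be the contraction of
  \<open>q0 + (y\<^sup>n)\<close> from \<open>R\<^sub>P[1/x]\<close>; it plays the role of the \<open>n\<close>-th symbolic power of \<open>q1\<close>. The descending
  chain of the ideals \<open>Y n + (x)\<close> stabilizes locally at \<open>P\<close>, and \<open>Y n\<close> is closed under division
  by \<open>x\<close>, so Nakayama's lemma gives \<open>Y n = Y (n + 1)\<close>. Then \<open>y\<^sup>n \<in> Y (n + 1)\<close>, and cancelling
  \<open>y\<^sup>n\<close> modulo \<open>q0\<close> puts a power of \<open>x\<close> times an element outside \<open>P\<close> into \<open>q1\<close>, which is
  absurd.\<close>

lemma prime_between_containing:
  assumes q0: "primeideal q0 R" and q1: "primeideal q1 R" and P: "primeideal P R"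
    and lt: "q0 \<subset> q1" "q1 \<subset> P" and x: "x \<in> P"
  shows "\<exists>q. primeideal q R \<and> q0 \<subset> q \<and> q \<subset> P \<and> x \<in> q"
proof (rule ccontr)
  assume none: "\<not> ?thesis"
  then have x1: "x \<notin> q1" using lt q1 by blast
  have Pid: "ideal P R" and q0id: "ideal q0 R" and q1id: "ideal q1 R"
    using primeideal_closed(1) q0 q1 P by auto
  note Pc = ideal_closed[OF Pid] and q0c = ideal_closed[OF q0id] and q1c = ideal_closed[OF q1id]
  have xc: "x \<in> carrier R" using x Pc by auto
  have only: "q = P" if "primeideal q R" "q0 \<subseteq> q" "x \<in> q" "q \<subseteq> P" for q
    using that none x1 lt by blast
  obtain y where y: "y \<in> q1" "y \<notin> q0" using lt by auto
  have yc: "y \<in> carrier R" using y q1c by auto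
  have Kid: "ideal (adjoin R q0 (y [^] n)) R" for n :: nat using adjoin_ideal[OF q0id] yc by auto
  note Kc = ideal_closed[OF Kid]
  define Y where "Y n = {a \<in> carrier R. \<exists>k::nat. \<exists>s\<in>carrier R - P. s \<otimes> (x [^] k \<otimes> a) \<in> adjoin R q0 (y [^] n)}"
    for n :: nat
  have YI: "a \<in> Y n" if "a \<in> carrier R" "s \<in> carrier R - P"
    "s \<otimes> (x [^] k \<otimes> a) \<in> adjoin R q0 (y [^] n)" for a s n and k :: nat
    using that unfolding Y_def by blast
  have YE: "\<exists>s\<in>carrier R - P. \<exists>k::nat. s \<otimes> (x [^] k \<otimes> a) \<in> adjoin R q0 (y [^] n)"
    if "a \<in> Y n" for a n
    using that unfolding Y_def by blast
  have Yid: "ideal (Y n) R" for n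
  proof (rule idealI_closed)
    show "Y n \<subseteq> carrier R" by (auto simp: Y_def)
    show "\<zero> \<in> Y n"
      using xc Kc(1) primeideal_closed(2)[OF P] by (auto simp: Y_def intro!: bexI[of _ \<one>])
    fix a assume "a \<in> Y n"
    then obtain k :: nat and s where a: "a \<in> carrier R" "s \<in> carrier R - P"
      "s \<otimes> (x [^] k \<otimes> a) \<in> adjoin R q0 (y [^] n)" by (auto simp: Y_def)
    { fix b assume "b \<in> Y n"
      then obtain l :: nat and t where b: "b \<in> carrier R" "t \<in> carrier R - P"
        "t \<otimes> (x [^] l \<otimes> b) \<in> adjoin R q0 (y [^] n)" by (auto simp: Y_def)
      have eq: "(s \<otimes> t) \<otimes> (x [^] (k + l) \<otimes> (a \<oplus> b))
          = (t \<otimes> x [^] l) \<otimes> (s \<otimes> (x [^] k \<otimes> a)) \<oplus> (s \<otimes> x [^] k) \<otimes> (t \<otimes> (x [^] l \<otimes> b))"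
      proof -
        have st: "s \<in> carrier R" "t \<in> carrier R" using a b by auto
        have e: "(s \<otimes> t) \<otimes> ((A \<otimes> B) \<otimes> (a \<oplus> b))
            = (t \<otimes> B) \<otimes> (s \<otimes> (A \<otimes> a)) \<oplus> (s \<otimes> A) \<otimes> (t \<otimes> (B \<otimes> b))"
          if "A \<in> carrier R" "B \<in> carrier R" for A B
          using st that a(1) b(1) by algebra
        from e[OF nat_pow_closed[OF xc, of k] nat_pow_closed[OF xc, of l]] show ?thesis
          by (simp only: nat_pow_mult[OF xc])
      qed
      have "\<dots> \<in> adjoin R q0 (y [^] n)" using a b xc by (intro Kc(3)[OF Kc(6) Kc(6)]) auto
      then show "a \<oplus> b \<in> Y n"
        unfolding Y_def eq[symmetric] using prime_complement_mult[OF P a(2) b(2)] a b by blast }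
    { fix r assume r: "r \<in> carrier R"
      have "x [^] k \<in> carrier R" "s \<in> carrier R" using xc a by auto
      then have "s \<otimes> (x [^] k \<otimes> (r \<otimes> a)) = r \<otimes> (s \<otimes> (x [^] k \<otimes> a))"
        using a(1) r by algebra
      then have "s \<otimes> (x [^] k \<otimes> (r \<otimes> a)) \<in> adjoin R q0 (y [^] n)" using Kc(6)[OF r a(3)] by simp
      then show "r \<otimes> a \<in> Y n" unfolding Y_def using a r by blast }
  qed
  have Ysat: "saturation R P (Y n) \<subseteq> Y n" for n
  proof
    fix a assume "a \<in> saturation R P (Y n)"
    then obtain s t and k :: nat where a: "a \<in> carrier R" "s \<in> carrier R - P" "t \<in> carrier R - P"
      and m: "t \<otimes> (x [^] k \<otimes> (s \<otimes> a)) \<in> adjoin R q0 (y [^] n)"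
      unfolding saturation_def Y_def by auto
    have "x [^] k \<in> carrier R" "s \<in> carrier R" "t \<in> carrier R" using xc a by auto
    then have "t \<otimes> (x [^] k \<otimes> (s \<otimes> a)) = (t \<otimes> s) \<otimes> (x [^] k \<otimes> a)" using a(1) by algebra
    then show "a \<in> Y n" using YI[OF a(1) prime_complement_mult[OF P a(3,2)]] m by metis
  qed
  have Ydiv: "r \<in> Y n" if xr: "x \<otimes> r \<in> Y n" and rc: "r \<in> carrier R" for r n
  proof -
    obtain s and k :: nat where s: "s \<in> carrier R - P" "s \<otimes> (x [^] k \<otimes> (x \<otimes> r)) \<in> adjoin R q0 (y [^] n)"
      using YE[OF xr] by blast
    have "x [^] k \<otimes> (x \<otimes> r) = x [^] Suc k \<otimes> r" using rc xc by (simp add: m_assoc)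
    then show ?thesis using YI[OF rc s(1), of "Suc k" n] s(2) by simp
  qed
  have q0Y: "q0 \<subseteq> Y n" for n
  proof
    fix a assume a: "a \<in> q0"
    then have "a \<in> adjoin R q0 (y [^] n)" using adjoin_ideal(2)[OF q0id, of "y [^] n"] yc by auto
    moreover have ac: "a \<in> carrier R" using a q0c(2) by blast
    then have "\<one> \<otimes> (x [^] (0::nat) \<otimes> a) = a" by simp
    ultimately have "\<one> \<otimes> (x [^] (0::nat) \<otimes> a) \<in> adjoin R q0 (y [^] n)" by simp
    then show "a \<in> Y n" using YI[OF ac] primeideal_closed(2)[OF P] one_closed by blast
  qed
  have Ydec: "Y (Suc n) \<subseteq> Y n" for n
  proof -
    have "adjoin R q0 (y [^] Suc n) \<subseteq> adjoin R q0 (y [^] n)"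
    proof
      fix a assume "a \<in> adjoin R q0 (y [^] Suc n)"
      then obtain h r where h: "h \<in> q0" "r \<in> carrier R" "a = h \<oplus> r \<otimes> (y [^] n \<otimes> y)"
        by (auto simp: mem_adjoin)
      then have "a = h \<oplus> (r \<otimes> y) \<otimes> y [^] n" using yc by (simp add: m_assoc m_comm[of y])
      then show "a \<in> adjoin R q0 (y [^] n)" using h yc mem_adjoin by blast
    qed
    then show ?thesis unfolding Y_def by blast
  qed
  note Yc = ideal_closed[OF Yid]
  define H where "H n = saturation R P (adjoin R (Y n) x)" for n
  define W where "W = saturation R P (adjoin R q0 x)"
  note q0x = adjoin_ideal[OF q0id xc] and Yx = adjoin_ideal[OF Yid xc]
  have "\<exists>N. \<forall>n\<ge>N. H n \<subseteq> H (Suc n)"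
  proof (rule saturated_chain_stabilizes[OF P, of W])
    show "ideal W R" "saturation R P W \<subseteq> W"
      unfolding W_def using saturation_ideal[OF P] saturation_idem[OF P] q0x by auto
    show "q = P" if "primeideal q R" "W \<subseteq> q" "q \<subseteq> P" for q
      using that only q0x saturation_extensive[OF P q0x(1)] unfolding W_def by blast
    show "ideal (H n) R" "saturation R P (H n) \<subseteq> H n" for n
      unfolding H_def using saturation_ideal[OF P] saturation_idem[OF P] Yx by auto
    show "W \<subseteq> H n" for n unfolding W_def H_def
      by (intro saturation_mono) (use q0Y in \<open>auto simp: mem_adjoin subset_iff\<close>)
    show "H (Suc n) \<subseteq> H n" for n unfolding H_def
      by (intro saturation_mono) (use Ydec in \<open>auto simp: mem_adjoin subset_iff\<close>)
  qed
  then obtain n where n: "H n \<subseteq> H (Suc n)" by auto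
  have "Y n \<subseteq> Y (Suc n)"
  proof (rule saturated_nakayama[OF P x Yid Ysat Yid Ysat Ydec])
    fix a assume a: "a \<in> Y n"
    then have "a \<in> H n" unfolding H_def using Yx(2) saturation_extensive[OF P Yx(1)] by blast
    then have "a \<in> H (Suc n)" using n by auto
    then obtain s b r where s: "s \<in> carrier R - P" "b \<in> Y (Suc n)" "r \<in> carrier R" "s \<otimes> a = b \<oplus> r \<otimes> x"
      unfolding H_def saturation_def by (auto simp: mem_adjoin)
    have carr: "a \<in> carrier R" "b \<in> carrier R" "s \<in> carrier R" using a s(1,2) Yc(2) by auto
    have eq: "s \<otimes> a = b \<oplus> x \<otimes> r" unfolding s(4) m_comm[OF s(3) xc] ..
    have "x \<otimes> r = (b \<oplus> x \<otimes> r) \<ominus> b" using carr xc s(3) by algebra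
    then have "x \<otimes> r = s \<otimes> a \<ominus> b" unfolding eq .
    moreover have "s \<otimes> a \<ominus> b \<in> Y n" using Yc(5)[OF Yc(6)[OF carr(3) a]] s(2) Ydec by blast
    ultimately have "r \<in> Y n" using Ydiv s(3) by metis
    then show "\<exists>s\<in>carrier R - P. \<exists>b\<in>Y (Suc n). \<exists>r\<in>Y n. s \<otimes> a = b \<oplus> x \<otimes> r"
      using s eq by blast
  qed
  moreover have "y [^] n \<in> Y n"
  proof -
    have "\<one> \<otimes> (x [^] (0::nat) \<otimes> y [^] n) = y [^] n" using yc by simp
    then have "\<one> \<otimes> (x [^] (0::nat) \<otimes> y [^] n) \<in> adjoin R q0 (y [^] n)"
      using adjoin_ideal(3)[OF q0id, of "y [^] n"] yc by simp
    then show ?thesis using YI[OF nat_pow_closed[OF yc]] primeideal_closed(2)[OF P] one_closed by blast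
  qed
  ultimately have "y [^] n \<in> Y (Suc n)" by blast
  from YE[OF this] obtain s h r and k :: nat where s: "s \<in> carrier R - P" "h \<in> q0" "r \<in> carrier R"
    "s \<otimes> (x [^] k \<otimes> y [^] n) = h \<oplus> r \<otimes> (y [^] n \<otimes> y)"
    unfolding mem_adjoin nat_pow_Suc by blast
  have carr: "s \<in> carrier R" "h \<in> carrier R" "x [^] k \<in> carrier R" "y [^] n \<in> carrier R"
    using s(1,2) q0c(2) xc yc by auto
  have e: "B \<otimes> (s \<otimes> A \<ominus> r \<otimes> y) = s \<otimes> (A \<otimes> B) \<ominus> r \<otimes> (B \<otimes> y)"
    "(h \<oplus> r \<otimes> (B \<otimes> y)) \<ominus> r \<otimes> (B \<otimes> y) = h"
    "(s \<otimes> A \<ominus> r \<otimes> y) \<oplus> r \<otimes> y = s \<otimes> A"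
    if "A \<in> carrier R" "B \<in> carrier R" for A B
    using that carr(1,2) s(3) yc by algebra+
  have "y [^] n \<otimes> (s \<otimes> x [^] k \<ominus> r \<otimes> y) = h"
    unfolding e(1)[OF carr(3,4)] s(4) e(2)[OF carr(3,4)] ..
  then have "y [^] n \<otimes> (s \<otimes> x [^] k \<ominus> r \<otimes> y) \<in> q0" using s(2) by simp
  then have "y [^] n \<in> q0 \<or> s \<otimes> x [^] k \<ominus> r \<otimes> y \<in> q0"
    using primeideal_closed(3)[OF q0, of "y [^] n"] carr s(3) yc by simp
  then have "s \<otimes> x [^] k \<ominus> r \<otimes> y \<in> q1" using prime_pow_mem[OF q0 yc] y lt by blast
  then have "(s \<otimes> x [^] k \<ominus> r \<otimes> y) \<oplus> r \<otimes> y \<in> q1" using q1c(3,6) y(1) s(3) by blast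
  then have "s \<otimes> x [^] k \<in> q1" unfolding e(3)[OF carr(3,4)] .
  then have "s \<in> q1 \<or> x [^] k \<in> q1" using primeideal_closed(3)[OF q1, of s] carr by simp
  then show False using prime_pow_mem[OF q1 xc] x1 s(1) lt by blast
qed

end

section \<open>Chains of primes and the height theorem\<close>

text \<open>\<open>prime_chain R K P l\<close>: there is a strictly increasing chain of \<open>l + 1\<close> primes that contain
  the set \<open>K\<close>, with top member \<open>P\<close>. For \<open>K = {}\<close> this says that \<open>P\<close> has height at least \<open>l\<close>; the
  set \<open>K\<close> makes it possible to argue modulo an ideal without forming the quotient ring.\<close>

primrec prime_chain :: "('a, 'b) ring_scheme \<Rightarrow> 'a set \<Rightarrow> 'a set \<Rightarrow> nat \<Rightarrow> bool" where
  "prime_chain R K P 0 \<longleftrightarrow> primeideal P R \<and> K \<subseteq> P"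
| "prime_chain R K P (Suc l) \<longleftrightarrow> primeideal P R \<and> (\<exists>q. q \<subset> P \<and> prime_chain R K q l)"

lemma prime_chain_prime: "prime_chain R K P l \<Longrightarrow> primeideal P R"
  by (cases l) auto

lemma prime_chain_contains: "prime_chain R K P l \<Longrightarrow> K \<subseteq> P"
  by (induction l arbitrary: P) auto

lemma prime_chain_antimono: "prime_chain R K P l \<Longrightarrow> L \<subseteq> K \<Longrightarrow> prime_chain R L P l"
  by (induction l arbitrary: P) auto



context noetherian_cring
begin

text \<open>Starting from the top, each member of the chain is exchanged for a prime that contains
  \<open>x\<close>; only the lowest member cannot be exchanged, and it is dropped.\<close>

lemma prime_chain_through:
  "prime_chain R K P (Suc l) \<Longrightarrow> x \<in> P \<Longrightarrow> prime_chain R (insert x K) P l"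
proof (induction l arbitrary: P)
  case 0
  then show ?case by (auto dest: prime_chain_contains)
next
  case (Suc l)
  then obtain q where q: "primeideal P R" "q \<subset> P" "prime_chain R K q (Suc l)" by auto
  then obtain q' where q': "primeideal q R" "q' \<subset> q" "prime_chain R K q' l" by auto
  obtain p where p: "primeideal p R" "q' \<subset> p" "p \<subset> P" "x \<in> p"
    using prime_between_containing[OF prime_chain_prime[OF q'(3)] q'(1) q(1) q'(2) q(2) Suc.prems(2)]
    by blast
  then have "prime_chain R K p (Suc l)" using q' by auto
  from Suc.IH[OF this p(4)] show ?case using q p by auto
qed

text \<open>Krull's height theorem: a prime minimal over \<open>h\<close> elements has height at most \<open>h\<close>. Each element
  of \<open>Z\<close> is moved into \<open>K\<close> at the cost of one link of the chain.\<close>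

theorem height_theorem:
  assumes "finite Z" "prime_chain R K P l" "Z \<subseteq> P"
    and "\<And>q. primeideal q R \<Longrightarrow> K \<union> Z \<subseteq> q \<Longrightarrow> q \<subseteq> P \<Longrightarrow> q = P"
  shows "l \<le> card Z"
  using assms
proof (induction Z arbitrary: K l rule: finite_induct)
  case empty
  show ?case
  proof (cases l)
    case (Suc k)
    then obtain q where "q \<subset> P" "prime_chain R K q k" using empty(1) by auto
    then show ?thesis using empty(3)[of q] by (auto dest: prime_chain_prime prime_chain_contains)
  qed simp
next
  case (insert x Z)
  show ?case
  proof (cases l)
    case (Suc k)
    have "k \<le> card Z"
    proof (rule insert.IH)
      show "prime_chain R (insert x K) P k" using prime_chain_through insert.prems Suc by blast
      show "q = P" if "primeideal q R" "insert x K \<union> Z \<subseteq> q" "q \<subseteq> P" for q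
        using insert.prems(3)[of q] that by auto
    qed (use insert.prems in auto)
    then show ?thesis using Suc insert.hyps by simp
  qed simp
qed

end

section \<open>Parameters of a prime\<close>

context noetherian_cring
begin


lemma prime_avoidance:
  assumes "finite F" "\<And>p. p \<in> F \<Longrightarrow> primeideal p R" "ideal J R" "\<And>p. p \<in> F \<Longrightarrow> \<not> J \<subseteq> p"
  shows "\<exists>z\<in>J. \<forall>p\<in>F. z \<notin> p"
  using assms
proof (induction "card F" arbitrary: F rule: less_induct)
  case less
  note Jc = ideal_closed[OF less.prems(3)]
  show ?case
  proof (cases "F = {}")
    case True
    then show ?thesis using Jc(1) by auto
  next
    case False
    then obtain p where p: "p \<in> F" by auto
    show ?thesis
    proof (cases "\<exists>q\<in>F - {p}. q \<subseteq> p")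
      case True
      (* Avoiding p already avoids q. *)
      then obtain q where q: "q \<in> F" "q \<noteq> p" "q \<subseteq> p" by auto
      have "card (F - {q}) < card F" using q less.prems(1) by (metis card_Diff1_less)
      then obtain z where "z \<in> J" "\<forall>r\<in>F - {q}. z \<notin> r"
        using less.hyps[of "F - {q}"] less.prems by auto
      then show ?thesis using q p by blast
    next
      case False
      have "card (F - {p}) < card F" using p less.prems(1) by (metis card_Diff1_less)
      then obtain z where z: "z \<in> J" "\<forall>r\<in>F - {p}. z \<notin> r"
        using less.hyps[of "F - {p}"] less.prems by auto
      show ?thesis
      proof (cases "z \<in> p")
        case False
        then show ?thesis using z by blast
      next
        case True
        note pp = less.prems(2)[OF p]
        note pc = ideal_closed[OF primeideal_closed(1)[OF pp]]
        have "\<exists>w\<in>J. w \<notin> p \<and> (\<forall>q\<in>G. w \<in> q)" if "finite G" "G \<subseteq> F - {p}" for G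
          using that
        proof (induction G rule: finite_induct)
          case empty
          then show ?case using less.prems(4)[OF p] by auto
        next
          case (insert q G)
          then obtain w where w: "w \<in> J" "w \<notin> p" "\<forall>q\<in>G. w \<in> q" by auto
          obtain c where c: "c \<in> q" "c \<notin> p" using False insert by blast
          have cc: "c \<in> carrier R" "w \<in> carrier R"
            using c w Jc(2) ideal_closed(2)[OF primeideal_closed(1)] less.prems(2) insert by blast+
          have "c \<otimes> w \<in> J" using cc w Jc by auto
          moreover have "c \<otimes> w \<notin> p" using primeideal_closed(3)[OF pp cc] c w by auto
          moreover have "c \<otimes> w \<in> r" if "r \<in> insert q G" for r
          proof -
            have "ideal r R" using that insert less.prems(2) primeideal_closed(1) by blast
            from ideal_closed(6,7)[OF this] show ?thesis using that w c cc by auto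
          qed
          ultimately show ?case by blast
        qed
        then obtain w where w: "w \<in> J" "w \<notin> p" "\<forall>q\<in>F - {p}. w \<in> q"
          using less.prems(1) by blast
        have wz: "w \<in> carrier R" "z \<in> carrier R" using w z Jc(2) by auto
        have "z \<oplus> w \<in> J" using w z Jc by auto
        moreover have "z \<oplus> w \<notin> r" if r: "r \<in> F" for r
        proof
          assume m: "z \<oplus> w \<in> r"
          note rc = ideal_closed[OF primeideal_closed(1)[OF less.prems(2)[OF r]]]
          show False
          proof (cases "r = p")
            case True
            then have "(z \<oplus> w) \<ominus> z \<in> p" using m \<open>z \<in> p\<close> pc(5) by simp
            moreover have "(z \<oplus> w) \<ominus> z = w" using wz by algebra
            ultimately show False using w by simp
          next
            case False
            then have "(z \<oplus> w) \<ominus> w \<in> r" using m w rc(5) r by simp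
            moreover have "(z \<oplus> w) \<ominus> w = z" using wz by algebra
            ultimately show False using z r False by auto
          qed
        qed
        ultimately show ?thesis by blast
      qed
    qed
  qed
qed

text \<open>This takes the place of the finiteness of the set of minimal primes over \<open>K\<close>. By Noetherian
  induction: if \<open>K\<close> is proper and not prime, say \<open>a b \<in> K\<close> with \<open>a, b \<notin> K\<close>, then every prime above \<open>K\<close> lies above
  \<open>K + (a)\<close> or \<open>K + (b)\<close>, and the sets for these two ideals are united.\<close>

lemma finitely_many_primes_below:
  assumes "ideal K R"
  shows "\<exists>F. finite F \<and> (\<forall>p\<in>F. primeideal p R \<and> K \<subseteq> p)
    \<and> (\<forall>q. primeideal q R \<longrightarrow> K \<subseteq> q \<longrightarrow> (\<exists>p\<in>F. p \<subseteq> q))"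
proof (induction rule: noetherian_induct[OF assms])
  case (1 K)
  note Kc = ideal_closed[OF 1(1)]
  consider "primeideal K R" | "\<one> \<in> K" | a b where "a \<in> carrier R" "b \<in> carrier R" "a \<otimes> b \<in> K" "a \<notin> K" "b \<notin> K"
    using primeidealI_closed[OF 1(1)] by metis
  then show ?case
  proof cases
    case 1
    then show ?thesis by (intro exI[of _ "{K}"]) auto
  next
    case 2
    then show ?thesis using primeideal_closed(2) by (intro exI[of _ "{}"]) auto
  next
    case (3 a b)
    note Ka = adjoin_ideal[OF 1(1) 3(1)] and Kb = adjoin_ideal[OF 1(1) 3(2)]
    have a: "K \<subset> adjoin R K a" using Ka(2,3) 3(4) by blast
    have b: "K \<subset> adjoin R K b" using Kb(2,3) 3(5) by blast
    from 1(2)[OF Ka(1) a] obtain F where F: "finite F"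
        "\<forall>p\<in>F. primeideal p R \<and> adjoin R K a \<subseteq> p"
        "\<forall>q. primeideal q R \<longrightarrow> adjoin R K a \<subseteq> q \<longrightarrow> (\<exists>p\<in>F. p \<subseteq> q)"
      by (elim exE conjE)
    from 1(2)[OF Kb(1) b] obtain G where G: "finite G"
        "\<forall>p\<in>G. primeideal p R \<and> adjoin R K b \<subseteq> p"
        "\<forall>q. primeideal q R \<longrightarrow> adjoin R K b \<subseteq> q \<longrightarrow> (\<exists>p\<in>G. p \<subseteq> q)"
      by (elim exE conjE)
    show ?thesis
    proof (intro exI[of _ "F \<union> G"] conjI ballI allI impI)
      show "finite (F \<union> G)" using F G by simp
      show "primeideal p R" "K \<subseteq> p" if "p \<in> F \<union> G" for p using that F(2) G(2) Ka(2) Kb(2) by blast+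
      fix q assume q: "primeideal q R" "K \<subseteq> q"
      note qc = ideal_closed[OF primeideal_closed(1)[OF q(1)]]
      have "a \<in> q \<or> b \<in> q" using primeideal_closed(3)[OF q(1) 3(1,2)] 3(3) q(2) by blast
      moreover have ad: "adjoin R K c \<subseteq> q" if "c \<in> q" for c
        using adjoin_least[OF primeideal_closed(1)[OF q(1)]] q(2) that by blast
      ultimately show "\<exists>p\<in>F \<union> G. p \<subseteq> q"
      proof (elim disjE)
        assume aq: "a \<in> q"
        show ?thesis using F(3)[rule_format, OF q(1) ad[OF aq]] by blast
      next
        assume bq: "b \<in> q"
        show ?thesis using G(3)[rule_format, OF q(1) ad[OF bq]] by blast
      qed
    qed
  qed
qed

text \<open>The converse of the height theorem. Let \<open>F\<close> be the finite set of primes for \<open>K\<close> from the preceding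
  lemma, and let \<open>z \<in> P\<close> avoid the members of \<open>F\<close> that do not contain \<open>P\<close>. The lowest prime of a
  chain below \<open>P\<close> and above \<open>K \<union> {z}\<close> contains a member of \<open>F\<close>, and properly so unless it is \<open>P\<close>
  itself. So the chain can be prolonged downwards above \<open>K\<close>: passing to \<open>K \<union> {z}\<close> lowers the bound
  \<open>h\<close> by one.\<close>

theorem parameters_exist:
  assumes "primeideal P R" "K \<subseteq> P" "\<And>l. prime_chain R K P l \<Longrightarrow> l \<le> h"
  shows "\<exists>Z. finite Z \<and> card Z \<le> h \<and> Z \<subseteq> P \<and>
    (\<forall>q. primeideal q R \<longrightarrow> K \<union> Z \<subseteq> q \<longrightarrow> q \<subseteq> P \<longrightarrow> q = P)"
  using assms(2,3)
proof (induction h arbitrary: K)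
  case 0
  have "q = P" if "primeideal q R" "K \<subseteq> q" "q \<subseteq> P" for q
  proof (rule ccontr)
    assume "q \<noteq> P"
    then have "prime_chain R K P (Suc 0)" using that assms(1) by auto
    then show False using 0 by fastforce
  qed
  then show ?case by (intro exI[of _ "{}"]) auto
next
  case (Suc h)
  note Pc = ideal_closed[OF primeideal_closed(1)[OF assms(1)]]
  have Kc: "K \<subseteq> carrier R" using Suc.prems(1) Pc(2) by blast
  obtain F where F: "finite F" "\<And>p. p \<in> F \<Longrightarrow> primeideal p R \<and> Idl K \<subseteq> p"
    "\<And>q. primeideal q R \<Longrightarrow> Idl K \<subseteq> q \<Longrightarrow> \<exists>p\<in>F. p \<subseteq> q"
    using finitely_many_primes_below[OF genideal_ideal[OF Kc]] by blast
  have "\<exists>z\<in>P. \<forall>p\<in>{p\<in>F. \<not> P \<subseteq> p}. z \<notin> p"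
    by (rule prime_avoidance) (use F primeideal_closed(1)[OF assms(1)] in auto)
  then obtain z where z: "z \<in> P" "\<And>p. p \<in> F \<Longrightarrow> \<not> P \<subseteq> p \<Longrightarrow> z \<notin> p" by auto
  have "l \<le> h" if "prime_chain R (insert z K) P l" for l
  proof -
    (* The exception is the chain that consists of P alone. *)
    have ext: "prime_chain R K Q (Suc l) \<or> (l = 0 \<and> Q = P)"
      if "prime_chain R (insert z K) Q l" "Q \<subseteq> P" for Q l
      using that
    proof (induction l arbitrary: Q)
      case 0
      then have Q: "primeideal Q R" "z \<in> Q" "K \<subseteq> Q" by auto
      then have "Idl K \<subseteq> Q" using genideal_minimal[OF primeideal_closed(1)] by blast
      then obtain p where p: "p \<in> F" "p \<subseteq> Q" using F(3) Q by blast
      have Kp: "K \<subseteq> p" using F(2)[OF p(1)] genideal_self[OF Kc] by blast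
      show ?case
      proof (cases "P \<subseteq> p")
        case True
        then show ?thesis using p 0 by auto
      next
        case False
        then have "p \<subset> Q" using z(2) p Q by blast
        then show ?thesis using Q F(2)[OF p(1)] Kp by auto
      qed
    next
      case (Suc l)
      then obtain q where q: "primeideal Q R" "q \<subset> Q" "prime_chain R (insert z K) q l" by auto
      then have "prime_chain R K q (Suc l) \<or> l = 0 \<and> q = P" using Suc.IH Suc.prems by blast
      then show ?case using q Suc.prems by auto
    qed
    from ext[OF that] have "l = 0 \<or> prime_chain R K P (Suc l)" by auto
    then show ?thesis using Suc.prems(2)[of "Suc l"] by auto
  qed
  moreover have "insert z K \<subseteq> P" using z Suc.prems(1) by auto
  ultimately obtain Z where Z: "finite Z" "card Z \<le> h" "Z \<subseteq> P"
    "\<And>q. primeideal q R \<Longrightarrow> insert z K \<union> Z \<subseteq> q \<Longrightarrow> q \<subseteq> P \<Longrightarrow> q = P"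
    using Suc.IH[of "insert z K"] by blast
  show ?case
  proof (intro exI[of _ "insert z Z"] conjI allI impI)
    show "card (insert z Z) \<le> Suc h" using Z(1,2) by (simp add: card_insert_if)
    show "q = P" if "primeideal q R" "K \<union> insert z Z \<subseteq> q" "q \<subseteq> P" for q
      using Z(4)[of q] that by auto
  qed (use Z z in auto)
qed

end

section \<open>Polynomial rings\<close>

context UP_cring
begin

lemma coeff_X_mult_Suc:
  assumes "f \<in> carrier P"
  shows "up_ring.coeff P (up_ring.monom P \<one> 1 \<otimes>\<^bsub>P\<^esub> f) (Suc n) = up_ring.coeff P f n"
proof -
  have "up_ring.coeff P (up_ring.monom P \<one> 1 \<otimes>\<^bsub>P\<^esub> f) (Suc n)
      = (\<Oplus>i\<in>{..Suc n}. (if 1 = i then \<one> else \<zero>) \<otimes> up_ring.coeff P f (Suc n - i))"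
    using assms by simp
  also have "\<dots> = (\<Oplus>i\<in>{..Suc n}. (if 1 = i then up_ring.coeff P f (Suc n - i) else \<zero>))"
    using assms by (intro R.finsum_cong') auto
  also have "\<dots> = up_ring.coeff P f (Suc n - 1)"
    using assms by (intro R.finsum_singleton) auto
  finally show ?thesis by simp
qed

lemma coeff_X_mult_0:
  assumes "f \<in> carrier P"
  shows "up_ring.coeff P (up_ring.monom P \<one> 1 \<otimes>\<^bsub>P\<^esub> f) 0 = \<zero>"
  using assms by simp

lemma coeff_const_mult:
  assumes "r \<in> carrier R" "f \<in> carrier P"
  shows "up_ring.coeff P (up_ring.monom P r 0 \<otimes>\<^bsub>P\<^esub> f) n = r \<otimes> up_ring.coeff P f n"
  using assms monom_mult_is_smult by simp

lemma const_plus_X_mult: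
  assumes f: "f \<in> carrier P"
  shows "\<exists>g\<in>carrier P. f = up_ring.monom P (up_ring.coeff P f 0) 0 \<oplus>\<^bsub>P\<^esub> up_ring.monom P \<one> 1 \<otimes>\<^bsub>P\<^esub> g
    \<and> (\<forall>n. up_ring.coeff P g n = up_ring.coeff P f (Suc n))"
proof -
  have fu: "f \<in> up R" using f by (simp add: P_def UP_def)
  have cf: "up_ring.coeff P h n = h n" if "h \<in> up R" for h n using that unfolding P_def UP_def by simp
  let ?g = "\<lambda>n. f (Suc n)"
  have gu: "?g \<in> up R"
  proof
    show "f (Suc n) \<in> carrier R" for n using fu by auto
    obtain k where "bound \<zero> k f" using fu bound_upD by blast
    then have "bound \<zero> k ?g" by (auto simp: bound_def)
    then show "\<exists>k. bound \<zero> k ?g" by blast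
  qed
  then have g: "?g \<in> carrier P" unfolding P_def UP_def by simp
  have cg: "up_ring.coeff P ?g n = up_ring.coeff P f (Suc n)" for n using cf[OF fu] cf[OF gu] by simp
  have "f = up_ring.monom P (up_ring.coeff P f 0) 0 \<oplus>\<^bsub>P\<^esub> up_ring.monom P \<one> 1 \<otimes>\<^bsub>P\<^esub> ?g"
  proof (rule up_eqI)
    show "up_ring.coeff P f n = up_ring.coeff P (up_ring.monom P (up_ring.coeff P f 0) 0 \<oplus>\<^bsub>P\<^esub> up_ring.monom P \<one> 1 \<otimes>\<^bsub>P\<^esub> ?g) n" for n
    proof (cases n)
      case 0
      then show ?thesis using f g coeff_X_mult_0[OF g] by (simp del: coeff_mult)
    next
      case (Suc k)
      then show ?thesis using f g coeff_X_mult_Suc[OF g] cg by (simp del: coeff_mult)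
    qed
  qed (use f g in auto)
  with g cg show ?thesis by blast
qed

lemma UP_shift_induct [consumes 1, case_names zero step]:
  assumes f: "f \<in> carrier P"
    and zero: "Q \<zero>\<^bsub>P\<^esub>"
    and step: "\<And>f g. f \<in> carrier P \<Longrightarrow> g \<in> carrier P \<Longrightarrow>
      f = up_ring.monom P (up_ring.coeff P f 0) 0 \<oplus>\<^bsub>P\<^esub> up_ring.monom P \<one> 1 \<otimes>\<^bsub>P\<^esub> g \<Longrightarrow>
      (\<And>n. up_ring.coeff P g n = up_ring.coeff P f (Suc n)) \<Longrightarrow> Q g \<Longrightarrow> Q f"
  shows "Q f"
proof -
  have "Q f" if "f \<in> carrier P" "\<And>k. k \<ge> n \<Longrightarrow> up_ring.coeff P f k = \<zero>" for n f
    using that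
  proof (induction n arbitrary: f)
    case 0
    then have "f = \<zero>\<^bsub>P\<^esub>" by (intro up_eqI) auto
    then show ?case using zero by simp
  next
    case (Suc n)
    obtain g where g: "g \<in> carrier P" "f = up_ring.monom P (up_ring.coeff P f 0) 0 \<oplus>\<^bsub>P\<^esub> up_ring.monom P \<one> 1 \<otimes>\<^bsub>P\<^esub> g"
      "\<And>n. up_ring.coeff P g n = up_ring.coeff P f (Suc n)"
      using const_plus_X_mult[OF Suc.prems(1)] by blast
    have "Q g" by (rule Suc.IH) (use g Suc.prems in auto)
    then show ?case using step[OF Suc.prems(1) g] by blast
  qed
  from this[OF f, of "Suc (deg R f)"] show ?thesis using deg_aboveD f by auto
qed

lemma mem_ideal_of_coeffs:
  assumes q: "ideal q P" and f: "f \<in> carrier P"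
    and mem: "\<And>n. up_ring.monom P (up_ring.coeff P f n) 0 \<in> q"
  shows "f \<in> q"
proof -
  note qc = P.ideal_closed[OF q]
  have "(\<forall>n. up_ring.monom P (up_ring.coeff P f n) 0 \<in> q) \<longrightarrow> f \<in> q"
    using f
  proof (induction f rule: UP_shift_induct)
    case zero
    then show ?case using qc(1) by simp
  next
    case (step f g)
    show ?case
    proof
      assume f: "\<forall>n. up_ring.monom P (up_ring.coeff P f n) 0 \<in> q"
      then have "g \<in> q" using step.IH step(4) by simp
      then have "up_ring.monom P (up_ring.coeff P f 0) 0 \<oplus>\<^bsub>P\<^esub> up_ring.monom P \<one> 1 \<otimes>\<^bsub>P\<^esub> g \<in> q"
        using qc(3)[OF _ qc(6)] f by simp
      then show "f \<in> q" using step(3) by simp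
    qed
  qed
  then show ?thesis using mem by blast
qed

text \<open>The coefficients at \<open>X\<^sup>n\<close> of the members of \<open>J\<close> of degree at most \<open>n\<close>. Two ideals, one inside
  the other, agree as soon as these coefficient ideals agree for all \<open>n\<close>.\<close>

definition leading :: "nat \<Rightarrow> (nat \<Rightarrow> 'a) set \<Rightarrow> 'a set" where
  "leading n J = {up_ring.coeff P f n | f. f \<in> J \<and> (\<forall>m>n. up_ring.coeff P f m = \<zero>)}"

lemma leadingI: "f \<in> J \<Longrightarrow> (\<And>m. m > n \<Longrightarrow> up_ring.coeff P f m = \<zero>) \<Longrightarrow> up_ring.coeff P f n \<in> leading n J"
  unfolding leading_def by blast

lemma leading_ideal:
  assumes J: "ideal J P"
  shows "ideal (leading n J) R"
proof (rule R.idealI_closed)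
  note Jc = P.ideal_closed[OF J]
  have car: "f \<in> carrier P" if "f \<in> J" for f using Jc(2) that by blast
  show "leading n J \<subseteq> carrier R" using car by (auto simp: leading_def)
  show "\<zero> \<in> leading n J" using leadingI[OF Jc(1), of n] by simp
  fix x assume "x \<in> leading n J"
  then obtain f where f: "f \<in> J" "\<And>m. m > n \<Longrightarrow> up_ring.coeff P f m = \<zero>" "x = up_ring.coeff P f n"
    by (auto simp: leading_def)
  { fix y assume "y \<in> leading n J"
    then obtain g where g: "g \<in> J" "\<And>m. m > n \<Longrightarrow> up_ring.coeff P g m = \<zero>" "y = up_ring.coeff P g n"
      by (auto simp: leading_def)
    have "up_ring.coeff P (f \<oplus>\<^bsub>P\<^esub> g) n \<in> leading n J"
      by (rule leadingI) (use f g car Jc(3) in auto)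
    then show "x \<oplus> y \<in> leading n J" using f g car by simp }
  { fix r assume r: "r \<in> carrier R"
    have "up_ring.monom P r 0 \<otimes>\<^bsub>P\<^esub> f \<in> J" using r f(1) Jc(6) by simp
    from leadingI[OF this, of n] show "r \<otimes> x \<in> leading n J"
      using r f car coeff_const_mult[OF r] by simp }
qed

lemma leading_mono:
  assumes J: "ideal J P" and "k \<le> n"
  shows "leading k J \<subseteq> leading n J"
  using \<open>k \<le> n\<close>
proof (induction n rule: dec_induct)
  case (step n)
  have "leading n J \<subseteq> leading (Suc n) J"
  proof
    fix x assume "x \<in> leading n J"
    then obtain f where f: "f \<in> J" "\<And>m. m > n \<Longrightarrow> up_ring.coeff P f m = \<zero>" "x = up_ring.coeff P f n"
      by (auto simp: leading_def)
    have fc: "f \<in> carrier P" using f(1) P.ideal_closed(2)[OF J] by blast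
    have "up_ring.monom P \<one> 1 \<otimes>\<^bsub>P\<^esub> f \<in> J" using f(1) P.ideal_closed(6)[OF J] by simp
    moreover have "up_ring.coeff P (up_ring.monom P \<one> 1 \<otimes>\<^bsub>P\<^esub> f) m = \<zero>" if "m > Suc n" for m
      using that f(2)[of "m - 1"] coeff_X_mult_Suc[OF fc, of "m - 1"] by (cases m) auto
    ultimately have "up_ring.coeff P (up_ring.monom P \<one> 1 \<otimes>\<^bsub>P\<^esub> f) (Suc n) \<in> leading (Suc n) J"
      by (rule leadingI)
    then show "x \<in> leading (Suc n) J" using f(3) coeff_X_mult_Suc[OF fc] by simp
  qed
  then show ?case using step.IH by blast
qed simp

lemma ideal_le_if_leading_le:
  assumes I: "ideal I P" and J: "ideal J P" and JI: "J \<subseteq> I"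
    and lead: "\<And>n. leading n I \<subseteq> leading n J"
  shows "I \<subseteq> J"
proof
  note Ic = P.ideal_closed[OF I] and Jc = P.ideal_closed[OF J]
  have main: "f \<in> J" if "f \<in> I" "\<And>m. m \<ge> n \<Longrightarrow> up_ring.coeff P f m = \<zero>" for n f
    using that
  proof (induction n arbitrary: f)
    case 0
    then have "f = \<zero>\<^bsub>P\<^esub>" using Ic(2) by (intro up_eqI) auto
    then show ?case using Jc(1) by simp
  next
    case (Suc n)
    have "up_ring.coeff P f n \<in> leading n J" using leadingI[OF Suc.prems(1), of n] Suc.prems(2) lead by auto
    then obtain g where g: "g \<in> J" "\<And>m. m > n \<Longrightarrow> up_ring.coeff P g m = \<zero>" "up_ring.coeff P f n = up_ring.coeff P g n"
      unfolding leading_def by auto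
    have fg: "f \<in> carrier P" "g \<in> carrier P" using g(1) Suc.prems(1) Ic(2) Jc(2) by auto
    have "f \<ominus>\<^bsub>P\<^esub> g \<in> J"
    proof (rule Suc.IH)
      show "f \<ominus>\<^bsub>P\<^esub> g \<in> I" using Ic(5) Suc.prems(1) g(1) JI by blast
      fix m assume "m \<ge> n"
      then show "up_ring.coeff P (f \<ominus>\<^bsub>P\<^esub> g) m = \<zero>"
        using fg g(2,3) Suc.prems(2)[of m] by (cases "m = n") (auto simp: P.minus_eq R.r_neg)
    qed
    then have "(f \<ominus>\<^bsub>P\<^esub> g) \<oplus>\<^bsub>P\<^esub> g \<in> J" using g(1) Jc(3) by blast
    moreover have "(f \<ominus>\<^bsub>P\<^esub> g) \<oplus>\<^bsub>P\<^esub> g = f" using fg by (simp add: P.minus_eq P.a_assoc P.l_neg)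
    ultimately show ?case by simp
  qed
  fix f assume f: "f \<in> I"
  then have "f \<in> carrier P" using Ic(2) by blast
  then show "f \<in> J" using main[OF f, of "Suc (deg R f)"] deg_aboveD by simp
qed

end

text \<open>Hilbert's basis theorem. The ideals \<open>leading n I\<close> increase with \<open>n\<close> and are constant from some \<open>N\<close>
  on, so lifts of finite generating sets for \<open>n \<le> N\<close> generate an ideal inside \<open>I\<close> with the same
  leading coefficients as \<open>I\<close>.\<close>

theorem (in noetherian_cring) UP_noetherian: "noetherian_cring (UP R)"
proof -
  interpret U: UP_cring R "UP R" by unfold_locales simp
  let ?P = "UP R"
  have "noetherian_ring ?P"
  proof (rule U.P.noetherian_ringI)
    fix I assume I: "ideal I ?P"
    note Ic = U.P.ideal_closed[OF I]
    have "\<exists>M\<in>range (\<lambda>n. U.leading n I). \<forall>J\<in>range (\<lambda>n. U.leading n I). M \<subseteq> J \<longrightarrow> J = M"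
      by (rule maximal_in_family) (use U.leading_ideal[OF I] in auto)
    then obtain M where "M \<in> range (\<lambda>n. U.leading n I)"
      and M: "\<forall>J\<in>range (\<lambda>n. U.leading n I). M \<subseteq> J \<longrightarrow> J = M" by (rule bexE)
    then obtain N where MN: "M = U.leading N I" by blast
    have N: "U.leading n I = U.leading N I" if "U.leading N I \<subseteq> U.leading n I" for n
      using M that unfolding MN by simp
    have "\<exists>G. finite G \<and> G \<subseteq> I \<and> (\<forall>g\<in>G. \<forall>m>n. up_ring.coeff ?P g m = \<zero>) \<and>
      U.leading n I = Idl ((\<lambda>g. up_ring.coeff ?P g n) ` G)" for n
    proof -
      obtain A where A: "A \<subseteq> carrier R" "finite A" "U.leading n I = Idl A"
        using finetely_gen[OF U.leading_ideal[OF I]] by blast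
      then have "A \<subseteq> U.leading n I" using genideal_self by blast
      also have "U.leading n I = (\<lambda>g. up_ring.coeff ?P g n) ` {f \<in> I. \<forall>m>n. up_ring.coeff ?P f m = \<zero>}"
        unfolding U.leading_def by blast
      finally obtain G where G: "G \<subseteq> {f \<in> I. \<forall>m>n. up_ring.coeff ?P f m = \<zero>}" "finite G"
        "A = (\<lambda>g. up_ring.coeff ?P g n) ` G" by (blast dest: finite_subset_image[OF A(2)])
      show ?thesis
        by (rule exI[of _ G]) (use G(1,2) A(3)[unfolded G(3)] in blast)
    qed
    then have "\<exists>G. \<forall>n. finite (G n) \<and> G n \<subseteq> I \<and> (\<forall>g\<in>G n. \<forall>m>n. up_ring.coeff ?P g m = \<zero>) \<and>
      U.leading n I = Idl ((\<lambda>g. up_ring.coeff ?P g n) ` G n)" by (intro choice allI)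
    then obtain G where "\<forall>n. finite (G n) \<and> G n \<subseteq> I \<and> (\<forall>g\<in>G n. \<forall>m>n. up_ring.coeff ?P g m = \<zero>) \<and>
      U.leading n I = Idl ((\<lambda>g. up_ring.coeff ?P g n) ` G n)" by (rule exE)
    then have G: "finite (G n)" "G n \<subseteq> I"
      "g \<in> G n \<Longrightarrow> m > n \<Longrightarrow> up_ring.coeff ?P g m = \<zero>"
      "U.leading n I = Idl ((\<lambda>g. up_ring.coeff ?P g n) ` G n)" for n g m by simp_all
    define B where "B = (\<Union>n\<le>N. G n)"
    have BI: "B \<subseteq> I" and Bc: "B \<subseteq> carrier ?P" using G(2) Ic(2) by (auto simp: B_def)
    have J: "ideal (Idl\<^bsub>?P\<^esub> B) ?P" by (rule U.P.genideal_ideal[OF Bc])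
    have JI: "Idl\<^bsub>?P\<^esub> B \<subseteq> I" by (rule U.P.genideal_minimal[OF I BI])
    have small: "U.leading n I \<subseteq> U.leading n (Idl\<^bsub>?P\<^esub> B)" if "n \<le> N" for n
      unfolding G(4)[of n]
    proof (rule genideal_minimal[OF U.leading_ideal[OF J]], rule image_subsetI)
      fix g assume g: "g \<in> G n"
      then have "g \<in> Idl\<^bsub>?P\<^esub> B" using U.P.genideal_self[OF Bc] that by (auto simp: B_def)
      then show "up_ring.coeff ?P g n \<in> U.leading n (Idl\<^bsub>?P\<^esub> B)" using G(3)[OF g] by (rule U.leadingI)
    qed
    have "I \<subseteq> Idl\<^bsub>?P\<^esub> B"
    proof (rule U.ideal_le_if_leading_le[OF I J JI])
      fix n
      show "U.leading n I \<subseteq> U.leading n (Idl\<^bsub>?P\<^esub> B)"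
      proof (cases "n \<le> N")
        case False
        then have "N \<le> n" by simp
        then have "U.leading n I = U.leading N I" by (intro N U.leading_mono[OF I])
        then show ?thesis using small[of N] U.leading_mono[OF J \<open>N \<le> n\<close>] by blast
      qed (rule small)
    qed
    moreover have "finite B" using G(1) by (simp add: B_def)
    ultimately show "\<exists>A\<subseteq>carrier ?P. finite A \<and> I = Idl\<^bsub>?P\<^esub> A" using JI Bc by blast
  qed
  then show ?thesis using U.UP_cring by (simp add: noetherian_cring_def noetherian_ring_def cring_def)
qed

section \<open>Ring homomorphisms\<close>

context ring_hom_cring
begin

lemma noetherian_image:
  assumes "noetherian_cring R" and surj: "h ` carrier R = carrier S"
  shows "noetherian_cring S"
proof -
  interpret N: noetherian_cring R by fact
  have "noetherian_ring S"
  proof (rule S.noetherian_ringI)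
    fix I assume I: "ideal I S"
    obtain A where A: "A \<subseteq> carrier R" "finite A" "{r \<in> carrier R. h r \<in> I} = Idl A"
      using N.finetely_gen[OF ring.ideal_vimage[OF I]] by blast
    have hA: "h ` A \<subseteq> carrier S" using A(1) by auto
    have id: "ideal (Idl\<^bsub>S\<^esub> (h ` A)) S" by (rule S.genideal_ideal[OF hA])
    have "Idl A \<subseteq> {r \<in> carrier R. h r \<in> Idl\<^bsub>S\<^esub> (h ` A)}"
      by (rule R.genideal_minimal[OF ring.ideal_vimage[OF id]])
        (use A(1) S.genideal_self[OF hA] in auto)
    then have "I \<subseteq> Idl\<^bsub>S\<^esub> (h ` A)"
      using A(3) surj S.ideal_closed(2)[OF I] by (smt (verit) image_iff mem_Collect_eq subset_iff)
    moreover have "h ` A \<subseteq> I" using R.genideal_self[OF A(1)] A(3) by auto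
    then have "Idl\<^bsub>S\<^esub> (h ` A) \<subseteq> I" by (rule S.genideal_minimal[OF I])
    ultimately show "\<exists>A\<subseteq>carrier S. finite A \<and> I = Idl\<^bsub>S\<^esub> A" using A(2) hA by blast
  qed
  then show ?thesis using S.cring_axioms by (simp add: noetherian_cring_def noetherian_ring_def cring_def)
qed

lemma prime_chain_vimage:
  assumes surj: "h ` carrier R = carrier S"
  shows "prime_chain S K P l \<Longrightarrow> prime_chain R {r \<in> carrier R. h r \<in> K} {r \<in> carrier R. h r \<in> P} l"
proof (induction l arbitrary: P)
  case 0
  then show ?case using ring.primeideal_vimage[OF R.cring_axioms] by auto
next
  case (Suc l)
  then obtain q where q: "primeideal P S" "q \<subset> P" "prime_chain S K q l" by auto
  obtain y where y: "y \<in> P" "y \<notin> q" using q(2) by auto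
  then have "y \<in> carrier S" using S.ideal_closed(2)[OF S.primeideal_closed(1)[OF q(1)]] by blast
  then obtain x where "x \<in> carrier R" "y = h x" using surj by blast
  then have "{r \<in> carrier R. h r \<in> q} \<subset> {r \<in> carrier R. h r \<in> P}" using y q(2) by auto
  then show ?case using Suc.IH[OF q(3)] ring.primeideal_vimage[OF R.cring_axioms q(1)] by auto
qed

end

lemma prime_chain_extend:
  assumes "primeideal q0 R" "\<And>q. primeideal q R \<Longrightarrow> K \<subseteq> q \<Longrightarrow> q0 \<subset> q"
  shows "prime_chain R K P l \<Longrightarrow> prime_chain R {} P (Suc l)"
proof (induction l arbitrary: P)
  case 0
  then have "primeideal P R" "q0 \<subset> P" using assms(2) by auto
  then show ?case using assms(1) by auto
next
  case (Suc l)
  then obtain q where "primeideal P R" "q \<subset> P" "prime_chain R K q l" by auto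
  then have "prime_chain R {} q (Suc l)" using Suc.IH by blast
  then show ?case using \<open>primeideal P R\<close> \<open>q \<subset> P\<close> by (metis prime_chain.simps(2))
qed

definition map_coeffs ::
  "('a, 'b) ring_scheme \<Rightarrow> ('c, 'd) ring_scheme \<Rightarrow> ('a \<Rightarrow> 'c) \<Rightarrow> (nat \<Rightarrow> 'a) \<Rightarrow> nat \<Rightarrow> 'c" where
  "map_coeffs R S h f = (\<lambda>n. h (up_ring.coeff (UP R) f n))"

context ring_hom_cring
begin

lemma map_coeffs_closed:
  assumes "f \<in> carrier (UP R)"
  shows "map_coeffs R S h f \<in> carrier (UP S)"
    and "up_ring.coeff (UP S) (map_coeffs R S h f) n = h (up_ring.coeff (UP R) f n)"
proof -
  interpret U: UP_cring R "UP R" by unfold_locales simp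
  have "map_coeffs R S h f \<in> up S"
  proof
    show "map_coeffs R S h f n \<in> carrier S" for n using assms by (simp add: map_coeffs_def)
    have "bound \<zero>\<^bsub>S\<^esub> (deg R f) (map_coeffs R S h f)"
      using U.deg_aboveD assms by (auto simp: bound_def map_coeffs_def)
    then show "\<exists>n. bound \<zero>\<^bsub>S\<^esub> n (map_coeffs R S h f)" by blast
  qed
  then show "map_coeffs R S h f \<in> carrier (UP S)"
    "up_ring.coeff (UP S) (map_coeffs R S h f) n = h (up_ring.coeff (UP R) f n)"
    by (auto simp: UP_def map_coeffs_def)
qed

lemma map_coeffs_hom: "ring_hom_cring (UP R) (UP S) (map_coeffs R S h)"
proof -
  interpret U: UP_cring R "UP R" by unfold_locales simp
  interpret V: UP_cring S "UP S" by unfold_locales simp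
  note c = map_coeffs_closed
  show ?thesis
  proof (rule ring_hom_cringI[OF U.UP_cring V.UP_cring], rule ring_hom_memI)
    fix f assume f: "f \<in> carrier (UP R)"
    then show "map_coeffs R S h f \<in> carrier (UP S)" by (rule c(1))
    fix g assume g: "g \<in> carrier (UP R)"
    show "map_coeffs R S h (f \<oplus>\<^bsub>UP R\<^esub> g) = map_coeffs R S h f \<oplus>\<^bsub>UP S\<^esub> map_coeffs R S h g"
      by (rule V.up_eqI) (use f g c in auto)
    show "map_coeffs R S h (f \<otimes>\<^bsub>UP R\<^esub> g) = map_coeffs R S h f \<otimes>\<^bsub>UP S\<^esub> map_coeffs R S h g"
    proof (rule V.up_eqI)
      fix n
      have "h (\<Oplus>i\<in>{..n}. up_ring.coeff (UP R) f i \<otimes> up_ring.coeff (UP R) g (n - i))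
          = (\<Oplus>\<^bsub>S\<^esub>i\<in>{..n}. h (up_ring.coeff (UP R) f i) \<otimes>\<^bsub>S\<^esub> h (up_ring.coeff (UP R) g (n - i)))"
        using f g by (subst ring.hom_finsum) (auto intro!: S.finsum_cong')
      then show "up_ring.coeff (UP S) (map_coeffs R S h (f \<otimes>\<^bsub>UP R\<^esub> g)) n
          = up_ring.coeff (UP S) (map_coeffs R S h f \<otimes>\<^bsub>UP S\<^esub> map_coeffs R S h g) n"
        using f g c by simp
    qed (use f g c in auto)
  next
    show "map_coeffs R S h \<one>\<^bsub>UP R\<^esub> = \<one>\<^bsub>UP S\<^esub>"
      by (rule V.up_eqI) (use c in auto)
  qed
qed

end

lemma (in ring_hom_cring) map_coeffs_kernel_prime:
  assumes "domain S"
  shows "primeideal {f \<in> carrier (UP R). \<forall>n. h (up_ring.coeff (UP R) f n) = \<zero>\<^bsub>S\<^esub>} (UP R)"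
proof -
  interpret D: "domain" S by fact
  interpret U: UP_cring R "UP R" by unfold_locales simp
  interpret V: UP_domain S "UP S" by unfold_locales simp
  interpret H: ring_hom_cring "UP R" "UP S" "map_coeffs R S h" by (rule map_coeffs_hom)
  have eq: "map_coeffs R S h f \<in> {\<zero>\<^bsub>UP S\<^esub>} \<longleftrightarrow> (\<forall>n. h (up_ring.coeff (UP R) f n) = \<zero>\<^bsub>S\<^esub>)"
    if f: "f \<in> carrier (UP R)" for f
  proof
    assume "map_coeffs R S h f \<in> {\<zero>\<^bsub>UP S\<^esub>}"
    then have "map_coeffs R S h f = \<zero>\<^bsub>UP S\<^esub>" by simp
    then show "\<forall>n. h (up_ring.coeff (UP R) f n) = \<zero>\<^bsub>S\<^esub>"
      using map_coeffs_closed(2)[OF f] V.coeff_zero by metis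
  next
    assume "\<forall>n. h (up_ring.coeff (UP R) f n) = \<zero>\<^bsub>S\<^esub>"
    then have "map_coeffs R S h f = \<zero>\<^bsub>UP S\<^esub>"
      by (intro V.up_eqI) (simp_all add: map_coeffs_closed[OF f])
    then show "map_coeffs R S h f \<in> {\<zero>\<^bsub>UP S\<^esub>}" by simp
  qed
  have "primeideal {f \<in> carrier (UP R). map_coeffs R S h f \<in> {\<zero>\<^bsub>UP S\<^esub>}} (UP R)"
    by (rule H.ring.primeideal_vimage[OF U.UP_cring V.zeroprimeideal])
  then show ?thesis by (simp only: eq cong: conj_cong)
qed

lemma (in ideal) rcos_zero_iff: "a \<in> carrier R \<Longrightarrow> I +> a = \<zero>\<^bsub>R Quot I\<^esub> \<longleftrightarrow> a \<in> I"
  using rcos_const_imp_mem a_rcos_zero[OF is_ideal] unfolding FactRing_def by auto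

text \<open>The extension \<open>M R[X]\<close> of a prime \<open>M\<close> is the kernel of \<open>R[X] \<rightarrow> (R/M)[X]\<close>, whose target is a
  domain.\<close>

lemma (in cring) coeffs_in_prime_is_prime:
  assumes M: "primeideal M R"
  shows "primeideal {f \<in> carrier (UP R). \<forall>n. up_ring.coeff (UP R) f n \<in> M} (UP R)"
proof -
  interpret U: UP_cring R "UP R" by unfold_locales simp
  have "primeideal {f \<in> carrier (UP R). \<forall>n. M +> up_ring.coeff (UP R) f n = \<zero>\<^bsub>R Quot M\<^esub>} (UP R)"
    by (rule ring_hom_cring.map_coeffs_kernel_prime[OF primeideal.rcos_ring_hom_cring[OF M]
          primeideal.quotient_is_domain[OF M]])
  then show ?thesis
    by (simp add: ideal.rcos_zero_iff[OF primeideal_closed(1)[OF M]] cong: conj_cong)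
qed

section \<open>Adjoining one element\<close>

text \<open>Here \<open>W\<close> is \<open>B[x]\<close>, presented as a quotient of \<open>B[X]\<close>, and the hypothesis on \<open>P\<close> says that
  \<open>P\<close> lies over \<open>M\<close> and that the residue of \<open>x\<close> modulo \<open>P\<close> is transcendental over \<open>B/M\<close>. The
  preimage of \<open>P\<close> in \<open>B[X]\<close> is then \<open>M B[X]\<close>. If \<open>M\<close> is minimal over \<open>h\<close> elements, so is
  \<open>M B[X]\<close>, and the height theorem in \<open>B[X]\<close> bounds the pulled back chain. If \<open>x\<close> is algebraic over
  the domain \<open>B\<close>, the pulled back chain starts above the nonzero kernel of \<open>B[X] \<rightarrow> B[x]\<close>
  and can be prolonged by the zero ideal.\<close>

lemma height_adjoin:
  fixes B (structure)
  assumes B: "noetherian_cring B" and hom: "ring_hom_cring (UP B) W \<phi>"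
    and surj: "\<phi> ` carrier (UP B) = carrier W"
    and M: "primeideal M B"
    and P: "\<And>f. f \<in> carrier (UP B) \<Longrightarrow> \<phi> f \<in> P \<longleftrightarrow> (\<forall>n. up_ring.coeff (UP B) f n \<in> M)"
    and ht: "\<And>l. prime_chain B {} M l \<Longrightarrow> l \<le> h"
    and chain: "prime_chain W {} P l"
  shows "l \<le> h"
    and "domain B \<Longrightarrow> f \<in> carrier (UP B) \<Longrightarrow> f \<noteq> \<zero>\<^bsub>UP B\<^esub> \<Longrightarrow> \<phi> f = \<zero>\<^bsub>W\<^esub> \<Longrightarrow> Suc l \<le> h"
proof -
  interpret B: noetherian_cring B by fact
  interpret U: UP_cring B "UP B" by unfold_locales simp
  interpret UN: noetherian_cring "UP B" by (rule B.UP_noetherian)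
  interpret \<phi>: ring_hom_cring "UP B" W \<phi> by fact
  interpret C: ring_hom_cring B "UP B" "\<lambda>a. up_ring.monom (UP B) a 0"
    by (rule ring_hom_cringI[OF B.cring_axioms U.UP_cring U.const_ring_hom])
  define E where "E = {f \<in> carrier (UP B). \<forall>n. up_ring.coeff (UP B) f n \<in> M}"
  have E: "primeideal E (UP B)" unfolding E_def by (rule B.coeffs_in_prime_is_prime[OF M])
  have vim: "{f \<in> carrier (UP B). \<phi> f \<in> P} = E" using P by (auto simp: E_def)
  note Mc = B.ideal_closed[OF B.primeideal_closed(1)[OF M]]
  obtain Z where Z: "finite Z" "card Z \<le> h" "Z \<subseteq> M"
    "\<And>q. primeideal q B \<Longrightarrow> Z \<subseteq> q \<Longrightarrow> q \<subseteq> M \<Longrightarrow> q = M"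
    using B.parameters_exist[OF M, of "{}" h] ht by auto
  let ?Z = "(\<lambda>a. up_ring.monom (UP B) a 0) ` Z"
  have mem: "up_ring.monom (UP B) a 0 \<in> E \<longleftrightarrow> a \<in> M" if "a \<in> carrier B" for a
    using that Mc(1) by (auto simp: E_def)
  have bound: "k \<le> h" if "prime_chain (UP B) {} E k" for k
  proof -
    have "k \<le> card ?Z"
    proof (rule UN.height_theorem[OF _ that])
      show "finite ?Z" using Z by simp
      show "?Z \<subseteq> E" using Z(3) Mc(2) mem by auto
      fix q assume q: "primeideal q (UP B)" "{} \<union> ?Z \<subseteq> q" "q \<subseteq> E"
      have "{a \<in> carrier B. up_ring.monom (UP B) a 0 \<in> q} = M"
      proof (rule Z(4))
        show "primeideal {a \<in> carrier B. up_ring.monom (UP B) a 0 \<in> q} B"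
          by (rule C.ring.primeideal_vimage[OF B.cring_axioms q(1)])
        show "Z \<subseteq> {a \<in> carrier B. up_ring.monom (UP B) a 0 \<in> q}" using q(2) Z(3) Mc(2) by auto
        show "{a \<in> carrier B. up_ring.monom (UP B) a 0 \<in> q} \<subseteq> M" using q(3) mem by auto
      qed
      then have Mq: "up_ring.monom (UP B) a 0 \<in> q" if "a \<in> M" for a using that by blast
      have "f \<in> q" if "f \<in> E" for f
        by (rule U.mem_ideal_of_coeffs[OF U.P.primeideal_closed(1)[OF q(1)]])
          (use that Mq in \<open>auto simp: E_def\<close>)
      then have "E \<subseteq> q" by blast
      then show "q = E" using q(3) by blast
    qed
    also have "\<dots> \<le> card Z" by (rule card_image_le[OF Z(1)])
    finally show ?thesis using Z(2) by simp
  qed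
  have pull: "prime_chain (UP B) {f \<in> carrier (UP B). \<phi> f \<in> {\<zero>\<^bsub>W\<^esub>}} E l"
  proof -
    have "prime_chain W {\<zero>\<^bsub>W\<^esub>} Q k" if "prime_chain W {} Q k" for Q k
      using that
      by (induction k arbitrary: Q)
        (auto dest: \<phi>.S.ideal_closed(1)[OF \<phi>.S.primeideal_closed(1)])
    from \<phi>.prime_chain_vimage[OF surj this[OF chain]] show ?thesis unfolding vim .
  qed
  show "l \<le> h" using bound prime_chain_antimono[OF pull] by blast
  show "Suc l \<le> h" if "domain B" "f \<in> carrier (UP B)" "f \<noteq> \<zero>\<^bsub>UP B\<^esub>" "\<phi> f = \<zero>\<^bsub>W\<^esub>"
  proof (rule bound, rule prime_chain_extend[OF _ _ pull])
    interpret D: "domain" B by fact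
    interpret UD: UP_domain B "UP B" by unfold_locales
    show "primeideal {\<zero>\<^bsub>UP B\<^esub>} (UP B)" by (rule UD.zeroprimeideal)
    fix q assume "primeideal q (UP B)" "{f \<in> carrier (UP B). \<phi> f \<in> {\<zero>\<^bsub>W\<^esub>}} \<subseteq> q"
    then show "{\<zero>\<^bsub>UP B\<^esub>} \<subset> q"
      using that U.P.ideal_closed(1)[OF U.P.primeideal_closed(1)] by blast
  qed
qed

section \<open>Algebraic dependence\<close>

text \<open>A homogeneous linear system over a domain with more unknowns than equations, solved by
  Gaussian elimination without division: the pivot \<open>v p m\<close> clears the last equation by cross
  multiplication.\<close>

lemma (in domain) nontrivial_solution:
  fixes v :: "'i \<Rightarrow> nat \<Rightarrow> 'a"
  assumes "finite I" "m < card I" "\<And>i k. i \<in> I \<Longrightarrow> v i k \<in> carrier R"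
  shows "\<exists>c. (\<forall>i\<in>I. c i \<in> carrier R) \<and> (\<exists>i\<in>I. c i \<noteq> \<zero>) \<and> (\<forall>k<m. (\<Oplus>i\<in>I. c i \<otimes> v i k) = \<zero>)"
  using assms
proof (induction m arbitrary: I v)
  case 0
  then obtain i where "i \<in> I" by fastforce
  then show ?case by (intro exI[of _ "\<lambda>_. \<one>"]) auto
next
  case (Suc m)
  show ?case
  proof (cases "\<forall>i\<in>I. v i m = \<zero>")
    case True
    obtain c where c: "\<And>i. i \<in> I \<Longrightarrow> c i \<in> carrier R" "\<exists>i\<in>I. c i \<noteq> \<zero>"
      "\<And>k. k < m \<Longrightarrow> (\<Oplus>i\<in>I. c i \<otimes> v i k) = \<zero>"
      using Suc.IH[of I v, OF Suc.prems(1) Suc_lessD[OF Suc.prems(2)] Suc.prems(3)] by blast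
    have "(\<Oplus>i\<in>I. c i \<otimes> v i m) = (\<Oplus>i\<in>I. \<zero>)"
      by (rule finsum_cong') (use True c(1) in auto)
    then have "(\<Oplus>i\<in>I. c i \<otimes> v i m) = \<zero>" by simp
    then have "\<forall>k<Suc m. (\<Oplus>i\<in>I. c i \<otimes> v i k) = \<zero>" using c(3) by (auto simp: less_Suc_eq)
    then show ?thesis using c(1,2) by blast
  next
    case False
    then obtain p where p: "p \<in> I" "v p m \<noteq> \<zero>" by auto
    define J where "J = I - {p}"
    have J: "finite J" "p \<notin> J" "I = insert p J" using Suc.prems p by (auto simp: J_def)
    have vc: "v p k \<in> carrier R" "i \<in> J \<Longrightarrow> v i k \<in> carrier R" for i k
      using Suc.prems(3) J(3) by auto
    define w where "w i k = v p m \<otimes> v i k \<ominus> v i m \<otimes> v p k" for i k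
    have cardJ: "m < card J" using Suc.prems(2) J by simp
    have wc: "w i k \<in> carrier R" if "i \<in> J" for i k unfolding w_def using vc that by simp
    obtain c where c: "\<And>i. i \<in> J \<Longrightarrow> c i \<in> carrier R" "\<exists>i\<in>J. c i \<noteq> \<zero>"
      "\<And>k. k < m \<Longrightarrow> (\<Oplus>i\<in>J. c i \<otimes> w i k) = \<zero>"
      using Suc.IH[of J w, OF J(1) cardJ wc] by blast
    define s where "s k = (\<Oplus>i\<in>J. c i \<otimes> v i k)" for k
    have sc: "s k \<in> carrier R" for k unfolding s_def using c(1) vc by (intro finsum_closed) auto
    have cw: "(\<Oplus>i\<in>J. c i \<otimes> w i k) = v p m \<otimes> s k \<oplus> (\<ominus> v p k) \<otimes> s m" for k
    proof -
      have "(\<Oplus>i\<in>J. c i \<otimes> w i k)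
          = (\<Oplus>i\<in>J. v p m \<otimes> (c i \<otimes> v i k) \<oplus> (\<ominus> v p k) \<otimes> (c i \<otimes> v i m))"
      proof (rule finsum_cong')
        fix i assume "i \<in> J"
        then have "c i \<in> carrier R" "v i k \<in> carrier R" "v i m \<in> carrier R" using c(1) vc by auto
        then show "c i \<otimes> w i k = v p m \<otimes> (c i \<otimes> v i k) \<oplus> (\<ominus> v p k) \<otimes> (c i \<otimes> v i m)"
          unfolding w_def using vc(1)[of k] vc(1)[of m] by algebra
      qed (use c(1) vc in auto)
      also have "\<dots> = (\<Oplus>i\<in>J. v p m \<otimes> (c i \<otimes> v i k)) \<oplus> (\<Oplus>i\<in>J. (\<ominus> v p k) \<otimes> (c i \<otimes> v i m))"
        by (rule finsum_addf) (use c(1) vc in auto)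
      also have "\<dots> = v p m \<otimes> s k \<oplus> (\<ominus> v p k) \<otimes> s m"
      proof -
        have "(\<Oplus>i\<in>J. b \<otimes> (c i \<otimes> v i l)) = b \<otimes> s l" if "b \<in> carrier R" for b l
          unfolding s_def using finsum_rdistr[OF J(1) that, of "\<lambda>i. c i \<otimes> v i l"] c(1) vc by auto
        then show ?thesis using vc by simp
      qed
      finally show ?thesis .
    qed
    define c' where "c' i = (if i = p then \<ominus> s m else v p m \<otimes> c i)" for i
    have sum: "(\<Oplus>i\<in>I. c' i \<otimes> v i k) = v p m \<otimes> s k \<oplus> (\<ominus> v p k) \<otimes> s m" for k
    proof -
      have "(\<Oplus>i\<in>I. c' i \<otimes> v i k) = c' p \<otimes> v p k \<oplus> (\<Oplus>i\<in>J. c' i \<otimes> v i k)"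
        unfolding J(3) by (rule finsum_insert[OF J(1,2)]) (use c(1) vc sc J(2) in \<open>auto simp: c'_def\<close>)
      also have "(\<Oplus>i\<in>J. c' i \<otimes> v i k) = (\<Oplus>i\<in>J. v p m \<otimes> (c i \<otimes> v i k))"
        by (rule finsum_cong') (use c(1) vc J(2) in \<open>auto simp: c'_def m_assoc\<close>)
      also have "\<dots> = v p m \<otimes> s k"
        unfolding s_def using finsum_rdistr[OF J(1) vc(1)[of m], of "\<lambda>i. c i \<otimes> v i k"] c(1) vc by auto
      also have "c' p \<otimes> v p k \<oplus> v p m \<otimes> s k = v p m \<otimes> s k \<oplus> (\<ominus> v p k) \<otimes> s m"
        unfolding c'_def using vc(1)[of k] vc(1)[of m] sc[of k] sc[of m] by (simp, algebra)
      finally show ?thesis .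
    qed
    have "\<forall>i\<in>I. c' i \<in> carrier R" using c(1) vc sc J(3) by (auto simp: c'_def)
    moreover have "\<exists>i\<in>I. c' i \<noteq> \<zero>"
    proof -
      obtain i where i: "i \<in> J" "c i \<noteq> \<zero>" using c(2) by auto
      then have "c' i \<noteq> \<zero>" using c(1) vc p(2) J(2) integral[of "v p m" "c i"] by (auto simp: c'_def)
      then show ?thesis using i J(3) by auto
    qed
    moreover have "(\<Oplus>i\<in>I. c' i \<otimes> v i k) = \<zero>" if "k < Suc m" for k
    proof (cases "k = m")
      case True
      then show ?thesis unfolding sum using vc(1)[of m] sc[of m] by (simp add: l_minus r_neg)
    next
      case False
      then show ?thesis using sum cw c(3)[of k] that by simp
    qed
    ultimately show ?thesis by blast
  qed
qed

lemma (in abelian_monoid) finsum_Times: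
  assumes "finite A" "finite B" "\<And>i j. i \<in> A \<Longrightarrow> j \<in> B \<Longrightarrow> f (i, j) \<in> carrier G"
  shows "finsum G f (A \<times> B) = (\<Oplus>j\<in>B. \<Oplus>i\<in>A. f (i, j))"
  using assms(2,3)
proof (induction B rule: finite_induct)
  case (insert b B)
  have "A \<times> insert b B = (\<lambda>i. (i, b)) ` A \<union> A \<times> B" by auto
  then have "finsum G f (A \<times> insert b B) = finsum G f ((\<lambda>i. (i, b)) ` A \<union> A \<times> B)" by simp
  also have "\<dots> = finsum G f ((\<lambda>i. (i, b)) ` A) \<oplus> finsum G f (A \<times> B)"
    by (rule finsum_Un_disjoint) (use assms(1) insert in auto)
  also have "finsum G f ((\<lambda>i. (i, b)) ` A) = (\<Oplus>i\<in>A. f (i, b))"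
    by (rule finsum_reindex) (use insert.prems in \<open>auto simp: inj_on_def\<close>)
  also have "finsum G f (A \<times> B) = (\<Oplus>j\<in>B. \<Oplus>i\<in>A. f (i, j))"
    by (rule insert.IH) (use insert.prems in auto)
  also have "(\<Oplus>i\<in>A. f (i, b)) \<oplus> (\<Oplus>j\<in>B. \<Oplus>i\<in>A. f (i, j)) = (\<Oplus>j\<in>insert b B. \<Oplus>i\<in>A. f (i, j))"
    by (rule finsum_insert[symmetric]) (use insert in \<open>auto intro!: finsum_closed\<close>)
  finally show ?case .
qed simp

definition algebraic_over :: "('a, 'b) ring_scheme \<Rightarrow> 'a set \<Rightarrow> 'a \<Rightarrow> bool" where
  "algebraic_over V B x \<longleftrightarrow> (\<exists>(N::nat) c. (\<forall>j\<le>N. c j \<in> B) \<and> (\<exists>j\<le>N. c j \<noteq> \<zero>\<^bsub>V\<^esub>) \<and>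
     (\<Oplus>\<^bsub>V\<^esub>j\<in>{..N}. c j \<otimes>\<^bsub>V\<^esub> x [^]\<^bsub>V\<^esub> j) = \<zero>\<^bsub>V\<^esub>)"

lemma algebraic_over_mono: "algebraic_over V B x \<Longrightarrow> B \<subseteq> B' \<Longrightarrow> algebraic_over V B' x"
  unfolding algebraic_over_def by blast

context UP_domain
begin

lemma deg_pow_le:
  assumes "f \<in> carrier P"
  shows "deg R (f [^]\<^bsub>P\<^esub> (i::nat)) \<le> i * deg R f"
proof (induction i)
  case (Suc i)
  have "deg R (f [^]\<^bsub>P\<^esub> Suc i) \<le> deg R (f [^]\<^bsub>P\<^esub> i) + deg R f"
    using deg_mult_ring[of "f [^]\<^bsub>P\<^esub> i" f] assms by simp
  then show ?case using Suc by simp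
qed simp

text \<open>With \<open>e = deg f + deg g\<close>, the \<open>(N + 1)\<^sup>2\<close> products \<open>f\<^sup>i g\<^sup>j\<close> with \<open>i, j \<le> N\<close> have at most
  \<open>N e + 1\<close> coefficients each, so they are linearly dependent over \<open>R\<close> as soon as \<open>N > e\<close>.\<close>

lemma two_polynomials_dependent:
  assumes f: "f \<in> carrier P" and g: "g \<in> carrier P"
  shows "\<exists>(N::nat) c. (\<forall>i\<le>N. \<forall>j\<le>N. c i j \<in> carrier R) \<and> (\<exists>i\<le>N. \<exists>j\<le>N. c i j \<noteq> \<zero>) \<and>
    (\<Oplus>\<^bsub>P\<^esub>j\<in>{..N}. (\<Oplus>\<^bsub>P\<^esub>i\<in>{..N}. up_ring.monom P (c i j) 0 \<otimes>\<^bsub>P\<^esub> f [^]\<^bsub>P\<^esub> i) \<otimes>\<^bsub>P\<^esub> g [^]\<^bsub>P\<^esub> j) = \<zero>\<^bsub>P\<^esub>"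
proof -
  define e where "e = deg R f + deg R g"
  define N where "N = Suc e"
  let ?I = "{..N} \<times> {..N}"
  define u where "u i j = f [^]\<^bsub>P\<^esub> i \<otimes>\<^bsub>P\<^esub> g [^]\<^bsub>P\<^esub> j" for i j :: nat
  have uc: "u i j \<in> carrier P" for i j unfolding u_def using f g by simp
  have udeg: "deg R (u i j) \<le> N * e" if "i \<le> N" "j \<le> N" for i j
  proof -
    have "deg R (u i j) \<le> deg R (f [^]\<^bsub>P\<^esub> i) + deg R (g [^]\<^bsub>P\<^esub> j)"
      unfolding u_def using f g by (intro deg_mult_ring) auto
    also have "\<dots> \<le> i * deg R f + j * deg R g" using deg_pow_le f g by (intro add_mono) auto
    also have "\<dots> \<le> N * deg R f + N * deg R g" using that by (intro add_mono mult_right_mono) auto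
    finally show ?thesis by (simp add: e_def add_mult_distrib2)
  qed
  have "\<exists>c. (\<forall>p\<in>?I. c p \<in> carrier R) \<and> (\<exists>p\<in>?I. c p \<noteq> \<zero>) \<and>
    (\<forall>k<Suc (N * e). (\<Oplus>p\<in>?I. c p \<otimes> up_ring.coeff P (u (fst p) (snd p)) k) = \<zero>)"
  proof (rule R.nontrivial_solution)
    show "Suc (N * e) < card ?I" by (simp add: N_def)
  qed (use uc in auto)
  then obtain c where c0: "(\<forall>p\<in>?I. c p \<in> carrier R) \<and> (\<exists>p\<in>?I. c p \<noteq> \<zero>) \<and>
    (\<forall>k<Suc (N * e). (\<Oplus>p\<in>?I. c p \<otimes> up_ring.coeff P (u (fst p) (snd p)) k) = \<zero>)" by (rule exE)
  have c: "p \<in> ?I \<Longrightarrow> c p \<in> carrier R" "\<exists>p\<in>?I. c p \<noteq> \<zero>"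
    "k < Suc (N * e) \<Longrightarrow> (\<Oplus>p\<in>?I. c p \<otimes> up_ring.coeff P (u (fst p) (snd p)) k) = \<zero>" for p k
    using c0 by blast+
  let ?t = "\<lambda>p. up_ring.monom P (c p) 0 \<otimes>\<^bsub>P\<^esub> u (fst p) (snd p)"
  have tc: "?t p \<in> carrier P" if "p \<in> ?I" for p using c(1)[OF that] uc by simp
  have zero: "(\<Oplus>\<^bsub>P\<^esub>p\<in>?I. ?t p) = \<zero>\<^bsub>P\<^esub>"
  proof (rule up_eqI)
    fix k
    have "up_ring.coeff P (\<Oplus>\<^bsub>P\<^esub>p\<in>?I. ?t p) k = (\<Oplus>p\<in>?I. up_ring.coeff P (?t p) k)"
      using tc by (intro coeff_finsum) auto
    also have "\<dots> = (\<Oplus>p\<in>?I. c p \<otimes> up_ring.coeff P (u (fst p) (snd p)) k)"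
      by (rule R.finsum_cong') (use c(1) uc coeff_const_mult in \<open>auto simp del: coeff_mult\<close>)
    also have "\<dots> = \<zero>"
    proof (cases "k < Suc (N * e)")
      case False
      have "(\<Oplus>p\<in>?I. c p \<otimes> up_ring.coeff P (u (fst p) (snd p)) k) = (\<Oplus>p\<in>?I. \<zero>)"
      proof (rule R.finsum_cong')
        fix p assume p: "p \<in> ?I"
        then have "deg R (u (fst p) (snd p)) < k" using udeg[of "fst p" "snd p"] False by auto
        then show "c p \<otimes> up_ring.coeff P (u (fst p) (snd p)) k = \<zero>"
          using deg_aboveD uc c(1)[OF p] by simp
      qed auto
      then show ?thesis by simp
    qed (rule c(3))
    finally show "up_ring.coeff P (\<Oplus>\<^bsub>P\<^esub>p\<in>?I. ?t p) k = up_ring.coeff P \<zero>\<^bsub>P\<^esub> k" by simp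
  qed (use tc in auto)
  have split: "finsum P ?t ?I = (\<Oplus>\<^bsub>P\<^esub>j\<in>{..N}. \<Oplus>\<^bsub>P\<^esub>i\<in>{..N}. ?t (i, j))"
    by (rule P.finsum_Times) (use tc in auto)
  have inner: "(\<Oplus>\<^bsub>P\<^esub>i\<in>{..N}. ?t (i, j))
      = (\<Oplus>\<^bsub>P\<^esub>i\<in>{..N}. up_ring.monom P (c (i, j)) 0 \<otimes>\<^bsub>P\<^esub> f [^]\<^bsub>P\<^esub> i) \<otimes>\<^bsub>P\<^esub> g [^]\<^bsub>P\<^esub> j" if "j \<in> {..N}" for j
  proof -
    have "(\<Oplus>\<^bsub>P\<^esub>i\<in>{..N}. ?t (i, j))
        = (\<Oplus>\<^bsub>P\<^esub>i\<in>{..N}. (up_ring.monom P (c (i, j)) 0 \<otimes>\<^bsub>P\<^esub> f [^]\<^bsub>P\<^esub> i) \<otimes>\<^bsub>P\<^esub> g [^]\<^bsub>P\<^esub> j)"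
      by (rule P.finsum_cong') (use c(1) f g that in \<open>auto simp: u_def P.m_assoc\<close>)
    also have "\<dots> = (\<Oplus>\<^bsub>P\<^esub>i\<in>{..N}. up_ring.monom P (c (i, j)) 0 \<otimes>\<^bsub>P\<^esub> f [^]\<^bsub>P\<^esub> i) \<otimes>\<^bsub>P\<^esub> g [^]\<^bsub>P\<^esub> j"
      by (rule P.finsum_ldistr[symmetric]) (use c(1) f g that in auto)
    finally show ?thesis .
  qed
  have "(\<Oplus>\<^bsub>P\<^esub>j\<in>{..N}. \<Oplus>\<^bsub>P\<^esub>i\<in>{..N}. ?t (i, j))
      = (\<Oplus>\<^bsub>P\<^esub>j\<in>{..N}. (\<Oplus>\<^bsub>P\<^esub>i\<in>{..N}. up_ring.monom P (c (i, j)) 0 \<otimes>\<^bsub>P\<^esub> f [^]\<^bsub>P\<^esub> i) \<otimes>\<^bsub>P\<^esub> g [^]\<^bsub>P\<^esub> j)"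
    by (rule P.finsum_cong'[OF refl _ inner]) (use c(1) f g in \<open>auto intro!: P.finsum_closed\<close>)
  then have "(\<Oplus>\<^bsub>P\<^esub>j\<in>{..N}. (\<Oplus>\<^bsub>P\<^esub>i\<in>{..N}. up_ring.monom P (c (i, j)) 0 \<otimes>\<^bsub>P\<^esub> f [^]\<^bsub>P\<^esub> i) \<otimes>\<^bsub>P\<^esub> g [^]\<^bsub>P\<^esub> j) = \<zero>\<^bsub>P\<^esub>"
    using split zero by (simp only:)
  then show ?thesis using c(1,2) by (intro exI[of _ N] exI[of _ "\<lambda>i j. c (i, j)"]) auto
qed

text \<open>\<open>R[t]\<close> has transcendence degree one over \<open>R\<close>. The relation between \<open>f\<close> and \<open>g\<close> is read as a polynomial
  in \<open>g\<close> with coefficients in \<open>R[f]\<close>; one of these coefficients is nonzero because \<open>f\<close> is not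
  algebraic over \<open>R\<close>.\<close>

lemma algebraic_over_transcendental:
  assumes B: "subring B P" and const: "(\<lambda>a. up_ring.monom P a 0) ` carrier R \<subseteq> B" and f: "f \<in> B"
    and trans: "\<not> algebraic_over P ((\<lambda>a. up_ring.monom P a 0) ` carrier R) f"
    and g: "g \<in> carrier P"
  shows "algebraic_over P B g"
proof -
  note Bc = subringE[OF B]
  have fc: "f \<in> carrier P" using f Bc(1) by blast
  obtain N :: nat and c where c: "\<And>i j. i \<le> N \<Longrightarrow> j \<le> N \<Longrightarrow> c i j \<in> carrier R"
    "\<exists>i\<le>N. \<exists>j\<le>N. c i j \<noteq> \<zero>"
    "(\<Oplus>\<^bsub>P\<^esub>j\<in>{..N}. (\<Oplus>\<^bsub>P\<^esub>i\<in>{..N}. up_ring.monom P (c i j) 0 \<otimes>\<^bsub>P\<^esub> f [^]\<^bsub>P\<^esub> i) \<otimes>\<^bsub>P\<^esub> g [^]\<^bsub>P\<^esub> j) = \<zero>\<^bsub>P\<^esub>"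
    using two_polynomials_dependent[OF fc g] by (elim exE conjE) blast
  define b where "b j = (\<Oplus>\<^bsub>P\<^esub>i\<in>{..N}. up_ring.monom P (c i j) 0 \<otimes>\<^bsub>P\<^esub> f [^]\<^bsub>P\<^esub> i)" for j
  have pow: "f [^]\<^bsub>P\<^esub> i \<in> B" for i :: nat by (induction i) (use Bc f in auto)
  have tm: "up_ring.monom P (c i j) 0 \<otimes>\<^bsub>P\<^esub> f [^]\<^bsub>P\<^esub> i \<in> B" if "i \<le> N" "j \<le> N" for i j
    using pow c(1)[OF that] const Bc(6) by blast
  have fin: "(\<Oplus>\<^bsub>P\<^esub>i\<in>A. h i) \<in> B" if "finite A" "\<And>i. i \<in> A \<Longrightarrow> h i \<in> B" for h and A :: "nat set"
    using that
  proof (induction A rule: finite_induct)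
    case (insert a A)
    have "(\<Oplus>\<^bsub>P\<^esub>i\<in>insert a A. h i) = h a \<oplus>\<^bsub>P\<^esub> (\<Oplus>\<^bsub>P\<^esub>i\<in>A. h i)"
      using insert Bc(1) by (intro P.finsum_insert) auto
    then show ?case using insert Bc(7) by simp
  qed (use Bc in simp)
  have bB: "\<forall>j\<le>N. b j \<in> B" unfolding b_def using tm by (auto intro!: fin)
  moreover have "\<exists>j\<le>N. b j \<noteq> \<zero>\<^bsub>P\<^esub>"
  proof -
    obtain i j where ij: "i \<le> N" "j \<le> N" "c i j \<noteq> \<zero>" using c(2) by blast
    have "up_ring.monom P (c i j) 0 \<noteq> \<zero>\<^bsub>P\<^esub>"
      using ij c(1) coeff_monom[of "c i j" 0 0] by (metis coeff_zero)
    then have nz: "\<exists>i\<le>N. up_ring.monom P (c i j) 0 \<noteq> \<zero>\<^bsub>P\<^esub>" using ij(1) by blast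
    have mem: "\<forall>i\<le>N. up_ring.monom P (c i j) 0 \<in> (\<lambda>a. up_ring.monom P a 0) ` carrier R"
      using c(1) ij(2) by blast
    have "b j \<noteq> \<zero>\<^bsub>P\<^esub>"
    proof
      assume "b j = \<zero>\<^bsub>P\<^esub>"
      then have "algebraic_over P ((\<lambda>a. up_ring.monom P a 0) ` carrier R) f"
        unfolding algebraic_over_def b_def
        by - (rule exI[of _ N], rule exI[of _ "\<lambda>i. up_ring.monom P (c i j) 0"], intro conjI mem nz)
      then show False using trans by simp
    qed
    then show ?thesis using ij(2) by blast
  qed
  moreover have "(\<Oplus>\<^bsub>P\<^esub>j\<in>{..N}. b j \<otimes>\<^bsub>P\<^esub> g [^]\<^bsub>P\<^esub> j) = \<zero>\<^bsub>P\<^esub>" using c(3) unfolding b_def .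
  ultimately show ?thesis
    unfolding algebraic_over_def by - (rule exI[of _ N], rule exI[of _ b], intro conjI)
qed

end

section \<open>Adjoining elements one at a time\<close>

lemma (in ring) subring_ideal_closed:
  assumes S: "subring S R" and I: "ideal I (R\<lparr>carrier := S\<rparr>)"
  shows "\<zero> \<in> I" and "I \<subseteq> S"
    and "x \<in> I \<Longrightarrow> y \<in> I \<Longrightarrow> x \<oplus> y \<in> I"
    and "r \<in> S \<Longrightarrow> x \<in> I \<Longrightarrow> r \<otimes> x \<in> I"
    and "x \<in> S \<Longrightarrow> x \<oplus> y \<in> I \<Longrightarrow> y \<in> I \<Longrightarrow> x \<in> I"
proof -
  interpret T: ring "R\<lparr>carrier := S\<rparr>" by (rule subring_is_ring[OF S])
  note Sc = subringE[OF S]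
  note Ic = T.ideal_closed[OF I, simplified]
  show "\<zero> \<in> I" and sub: "I \<subseteq> S" using Ic(1,2) by auto
  show add: "x \<in> I \<Longrightarrow> y \<in> I \<Longrightarrow> x \<oplus> y \<in> I" for x y using Ic(3) by simp
  show mult: "r \<in> S \<Longrightarrow> x \<in> I \<Longrightarrow> r \<otimes> x \<in> I" for r x using Ic(6) by simp
  assume x: "x \<in> S" "x \<oplus> y \<in> I" "y \<in> I"
  have c: "x \<in> carrier R" "y \<in> carrier R" using x Sc(1) sub by auto
  have "(x \<oplus> y) \<oplus> (\<ominus> \<one>) \<otimes> y \<in> I" using Sc(5)[OF Sc(3)] by (intro add[OF x(2) mult[OF _ x(3)]])
  moreover have "(x \<oplus> y) \<oplus> (\<ominus> \<one>) \<otimes> y = x" using c by (simp add: l_minus a_assoc r_neg)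
  ultimately show "x \<in> I" by simp
qed

lemma (in cring) subring_prime_closed:
  assumes S: "subring S R" and I: "primeideal I (R\<lparr>carrier := S\<rparr>)"
  shows "ideal I (R\<lparr>carrier := S\<rparr>)" and "\<one> \<notin> I"
    and "a \<in> S \<Longrightarrow> b \<in> S \<Longrightarrow> a \<otimes> b \<in> I \<Longrightarrow> a \<in> I \<or> b \<in> I"
proof -
  interpret T: ring "R\<lparr>carrier := S\<rparr>" by (rule subring_is_ring[OF S])
  note Ic = T.primeideal_closed[OF I, simplified]
  show "ideal I (R\<lparr>carrier := S\<rparr>)" "\<one> \<notin> I" using Ic by auto
  show "a \<in> S \<Longrightarrow> b \<in> S \<Longrightarrow> a \<otimes> b \<in> I \<Longrightarrow> a \<in> I \<or> b \<in> I" using Ic(3) by simp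
qed

lemma (in cring) subring_cring: "subring S R \<Longrightarrow> cring (R\<lparr>carrier := S\<rparr>)"
  using subcring_iff subcringI' subringE(1) by blast

lemma (in cring) inclusion_hom:
  assumes "subring B R" "subring S R" "B \<subseteq> S"
  shows "ring_hom_cring (R\<lparr>carrier := B\<rparr>) (R\<lparr>carrier := S\<rparr>) id"
  by (rule ring_hom_cringI[OF subring_cring[OF assms(1)] subring_cring[OF assms(2)]])
    (use assms(3) in \<open>auto simp: ring_hom_def\<close>)

lemma (in cring) prime_restrict:
  assumes "subring B R" "subring S R" "B \<subseteq> S" "primeideal Q (R\<lparr>carrier := S\<rparr>)"
  shows "primeideal (Q \<inter> B) (R\<lparr>carrier := B\<rparr>)"
proof -
  interpret h: ring_hom_cring "R\<lparr>carrier := B\<rparr>" "R\<lparr>carrier := S\<rparr>" id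
    by (rule inclusion_hom[OF assms(1-3)])
  have "primeideal {r \<in> carrier (R\<lparr>carrier := B\<rparr>). id r \<in> Q} (R\<lparr>carrier := B\<rparr>)"
    by (rule h.ring.primeideal_vimage[OF subring_cring[OF assms(1)] assms(4)])
  moreover have "{r \<in> carrier (R\<lparr>carrier := B\<rparr>). id r \<in> Q} = Q \<inter> B" by auto
  ultimately show ?thesis by simp
qed

text \<open>One step of the construction: \<open>B' = B[x]\<close>. The primes \<open>P0 \<subseteq> P1 \<subseteq> P2\<close> are the bottom and two
  neighbours of a chain, and \<open>x\<close> separates the neighbours. If \<open>r\<^sub>0 + r\<^sub>1 x + \<dots>\<close> lies in \<open>P1\<close>,
  then \<open>r\<^sub>0 \<in> P2 \<inter> B \<subseteq> P0\<close> since \<open>x \<in> P2\<close>; the rest is \<open>x\<close> times a shorter expression, and \<open>x\<close> can be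
  cancelled since \<open>x \<notin> P1\<close>. So all coefficients lie in \<open>P0\<close>. This shows both that the
  residue of \<open>x\<close> modulo \<open>P0\<close> is transcendental and that \<open>P1\<close> and \<open>P0\<close> have the same trace on \<open>B[x]\<close>,
  which is what the next step needs.\<close>

lemma (in domain) adjoin_transcendental_residue:
  fixes B S P0 P1 P2 :: "'a set"
  assumes B: "subring B R" and noeth: "noetherian_cring (R\<lparr>carrier := B\<rparr>)"
    and S: "subring S R" and BS: "B \<subseteq> S" and x: "x \<in> S" "x \<in> P2" "x \<notin> P1"
    and P0: "primeideal P0 (R\<lparr>carrier := S\<rparr>)" and P1: "primeideal P1 (R\<lparr>carrier := S\<rparr>)"
    and P2: "primeideal P2 (R\<lparr>carrier := S\<rparr>)"
    and le: "P0 \<subseteq> P1" "P1 \<subseteq> P2" and contr: "P2 \<inter> B \<subseteq> P0"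
  shows "\<exists>B'. subring B' R \<and> noetherian_cring (R\<lparr>carrier := B'\<rparr>) \<and> B \<subseteq> B' \<and> x \<in> B' \<and> B' \<subseteq> S
    \<and> P1 \<inter> B' \<subseteq> P0 \<and>
    (\<forall>h. (\<forall>l. prime_chain (R\<lparr>carrier := B\<rparr>) {} (P0 \<inter> B) l \<longrightarrow> l \<le> h) \<longrightarrow>
      (\<forall>l. prime_chain (R\<lparr>carrier := B'\<rparr>) {} (P0 \<inter> B') l \<longrightarrow> l \<le> h \<and> (algebraic_over R B x \<longrightarrow> Suc l \<le> h)))"
proof -
  let ?B = "R\<lparr>carrier := B\<rparr>"
  note Sc = subringE[OF S] and Bc = subringE[OF B]
  note P0c = subring_ideal_closed[OF S subring_prime_closed(1)[OF S P0]]
  note P1c = subring_ideal_closed[OF S subring_prime_closed(1)[OF S P1]]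
  note P2c = subring_ideal_closed[OF S subring_prime_closed(1)[OF S P2]]
  have xc: "x \<in> carrier R" using x Sc by auto
  interpret NB: noetherian_cring ?B by fact
  have "ring_hom_cring ?B (R\<lparr>carrier := carrier R\<rparr>) id"
    by (rule inclusion_hom[OF B carrier_is_subring Bc(1)])
  then interpret i: ring_hom_cring ?B R id by simp
  interpret E: UP_pre_univ_prop ?B R id "UP ?B" by (unfold_locales; simp)
  define \<phi> where "\<phi> = UnivPoly.eval ?B R id x"
  have "\<phi> \<in> ring_hom (UP ?B) R" unfolding \<phi>_def by (rule E.eval_ring_hom[OF xc])
  then interpret \<phi>: ring_hom_cring "UP ?B" R \<phi>
    by (rule ring_hom_cringI[OF E.UP_cring cring_axioms])
  have const: "\<phi> (up_ring.monom (UP ?B) r 0) = r" if "r \<in> B" for r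
    unfolding \<phi>_def using E.eval_const[OF xc, of r] that by simp
  have mon: "\<phi> (up_ring.monom (UP ?B) r n) = r \<otimes> x [^] n" if "r \<in> B" for r n
    unfolding \<phi>_def using E.eval_monom[of r x n] that xc by simp
  have X: "\<phi> (up_ring.monom (UP ?B) \<one> 1) = x"
    unfolding \<phi>_def using E.eval_monom1[OF xc] by simp
  have cB: "up_ring.coeff (UP ?B) f n \<in> B" if "f \<in> carrier (UP ?B)" for f n
    using E.coeff_closed[OF that] by simp
  have split: "\<phi> f = up_ring.coeff (UP ?B) f 0 \<oplus> x \<otimes> \<phi> g"
    if "f \<in> carrier (UP ?B)" "g \<in> carrier (UP ?B)"
      "f = up_ring.monom (UP ?B) (up_ring.coeff (UP ?B) f 0) 0 \<oplus>\<^bsub>UP ?B\<^esub> up_ring.monom (UP ?B) \<one>\<^bsub>?B\<^esub> 1 \<otimes>\<^bsub>UP ?B\<^esub> g"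
    for f g
  proof -
    have m: "up_ring.monom (UP ?B) (up_ring.coeff (UP ?B) f 0) 0 \<in> carrier (UP ?B)"
      "up_ring.monom (UP ?B) \<one>\<^bsub>?B\<^esub> 1 \<in> carrier (UP ?B)"
      using cB[OF that(1)] Bc(3) by (intro E.monom_closed; simp)+
    have "\<phi> f = \<phi> (up_ring.monom (UP ?B) (up_ring.coeff (UP ?B) f 0) 0 \<oplus>\<^bsub>UP ?B\<^esub> up_ring.monom (UP ?B) \<one>\<^bsub>?B\<^esub> 1 \<otimes>\<^bsub>UP ?B\<^esub> g)"
      by (subst that(3)) (rule refl)
    also have "\<dots> = \<phi> (up_ring.monom (UP ?B) (up_ring.coeff (UP ?B) f 0) 0)
        \<oplus> \<phi> (up_ring.monom (UP ?B) \<one>\<^bsub>?B\<^esub> 1) \<otimes> \<phi> g"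
      using m that(2) by (simp only: \<phi>.hom_add \<phi>.hom_mult E.UP_mult_closed)
    finally show ?thesis using const[OF cB[OF that(1)]] X by simp
  qed
  define B' where "B' = \<phi> ` carrier (UP ?B)"
  let ?B' = "R\<lparr>carrier := B'\<rparr>"
  have B': "subring B' R"
    unfolding B'_def by (rule \<phi>.ring.img_is_subring[OF ring.carrier_is_subring[OF cring.axioms(1)[OF E.UP_cring]]])
  interpret D': "domain" ?B' by (rule subring_is_domain[OF B'])
  have hom': "ring_hom_cring (UP ?B) ?B' \<phi>"
    by (rule ring_hom_cringI[OF E.UP_cring D'.cring_axioms])
      (auto simp: ring_hom_def B'_def)
  have surj: "\<phi> ` carrier (UP ?B) = carrier ?B'" by (simp add: B'_def)
  have BB': "B \<subseteq> B'"
  proof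
    fix r assume "r \<in> B"
    then have "r = \<phi> (up_ring.monom (UP ?B) r 0)" "up_ring.monom (UP ?B) r 0 \<in> carrier (UP ?B)"
      using const by (auto intro: E.monom_closed)
    then show "r \<in> B'" unfolding B'_def by blast
  qed
  have xB': "x \<in> B'"
  proof -
    have "up_ring.monom (UP ?B) \<one> 1 \<in> carrier (UP ?B)" using Bc(3) by (intro E.monom_closed) simp
    then show ?thesis unfolding B'_def using X by blast
  qed
  have \<phi>S: "\<phi> f \<in> S" if "f \<in> carrier (UP ?B)" for f
    using that
  proof (induction f rule: E.UP_shift_induct)
    case zero
    then show ?case using Sc(2) by simp
  next
    case (step f g)
    have "up_ring.coeff (UP ?B) f 0 \<in> S" using cB[OF step(1)] BS by blast
    then show ?case unfolding split[OF step(1-3)] using step.IH x Sc(6,7) by blast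
  qed
  have down: "\<phi> f \<in> P1 \<longrightarrow> (\<forall>n. up_ring.coeff (UP ?B) f n \<in> P0)" if "f \<in> carrier (UP ?B)" for f
    using that
  proof (induction f rule: E.UP_shift_induct)
    case zero
    then show ?case using P0c(1) by simp
  next
    case (step f g)
    let ?r = "up_ring.coeff (UP ?B) f 0"
    show ?case
    proof
      assume f1: "\<phi> f \<in> P1"
      have gS: "\<phi> g \<in> S" by (rule \<phi>S[OF step(2)])
      have rS: "?r \<in> S" using cB[OF step(1)] BS by blast
      have xg: "x \<otimes> \<phi> g \<in> S" using gS x Sc(6) by blast
      have "x \<otimes> \<phi> g \<in> P2"
        using P2c(4)[OF gS x(2)] m_comm[of x "\<phi> g"] xc gS Sc(1) by (metis subsetD)
      moreover have "?r \<oplus> x \<otimes> \<phi> g \<in> P2" using f1 le(2) split[OF step(1-3)] by auto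
      ultimately have "?r \<in> P2" using P2c(5) rS by blast
      then have r0: "?r \<in> P0" using cB[OF step(1)] contr by blast
      have "x \<otimes> \<phi> g \<oplus> ?r \<in> P1"
        using f1 split[OF step(1-3)] a_comm[of ?r "x \<otimes> \<phi> g"] rS xg Sc(1) by (metis subsetD)
      then have "x \<otimes> \<phi> g \<in> P1" using P1c(5)[OF xg] r0 le(1) by blast
      then have "\<phi> g \<in> P1" using subring_prime_closed(3)[OF S P1 x(1) gS] x(3) by blast
      then have g0: "up_ring.coeff (UP ?B) f (Suc n) \<in> P0" for n using step.IH step(4) by metis
      show "\<forall>n. up_ring.coeff (UP ?B) f n \<in> P0"
      proof
        show "up_ring.coeff (UP ?B) f n \<in> P0" for n by (cases n) (use r0 g0 in auto)
      qed
    qed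
  qed
  have up: "(\<forall>n. up_ring.coeff (UP ?B) f n \<in> P0) \<longrightarrow> \<phi> f \<in> P0" if "f \<in> carrier (UP ?B)" for f
    using that
  proof (induction f rule: E.UP_shift_induct)
    case zero
    then show ?case using P0c(1) by simp
  next
    case (step f g)
    show ?case
    proof
      assume f: "\<forall>n. up_ring.coeff (UP ?B) f n \<in> P0"
      then have "\<phi> g \<in> P0" using step.IH step(4) by simp
      then show "\<phi> f \<in> P0" unfolding split[OF step(1-3)] using f P0c(3,4) x(1) by blast
    qed
  qed
  have PB: "\<phi> f \<in> P0 \<inter> B' \<longleftrightarrow> (\<forall>n. up_ring.coeff (UP ?B) f n \<in> P0 \<inter> B)"
    if f: "f \<in> carrier (UP ?B)" for f
    using down[OF f] up[OF f] cB[OF f] f le(1) unfolding B'_def by blast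
  have "P1 \<inter> B' \<subseteq> P0" using down up unfolding B'_def by blast
  moreover have "B' \<subseteq> S" using \<phi>S unfolding B'_def by blast
  moreover have "noetherian_cring ?B'"
    by (rule ring_hom_cring.noetherian_image[OF hom' NB.UP_noetherian surj])
  moreover have "l \<le> h \<and> (algebraic_over R B x \<longrightarrow> Suc l \<le> h)"
    if ht: "\<And>l. prime_chain ?B {} (P0 \<inter> B) l \<Longrightarrow> l \<le> h"
      and chain: "prime_chain ?B' {} (P0 \<inter> B') l" for h l
  proof
    show "l \<le> h"
      by (rule height_adjoin(1)[OF noeth hom' surj prime_restrict[OF B S BS P0] PB ht chain])
    show "algebraic_over R B x \<longrightarrow> Suc l \<le> h"
    proof
      assume "algebraic_over R B x"
      then obtain N :: nat and c where c: "\<And>j. j \<le> N \<Longrightarrow> c j \<in> B" "\<exists>j\<le>N. c j \<noteq> \<zero>"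
        "(\<Oplus>j\<in>{..N}. c j \<otimes> x [^] j) = \<zero>" unfolding algebraic_over_def by blast
      let ?t = "\<lambda>j. up_ring.monom (UP ?B) (c j) j"
      define f where "f = (\<Oplus>\<^bsub>UP ?B\<^esub>j\<in>{..N}. ?t j)"
      have tc: "?t \<in> {..N} \<rightarrow> carrier (UP ?B)" using c(1) by (auto intro: E.monom_closed)
      have fc: "f \<in> carrier (UP ?B)" unfolding f_def by (rule E.P.finsum_closed[OF tc])
      have "\<phi> f = (\<Oplus>j\<in>{..N}. \<phi> (?t j))"
        unfolding f_def using \<phi>.ring.hom_finsum[OF tc] by (simp add: comp_def)
      also have "\<dots> = (\<Oplus>j\<in>{..N}. c j \<otimes> x [^] j)"
        by (rule finsum_cong') (use c(1) mon subsetD[OF Bc(1) c(1)] xc in auto)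
      finally have f0: "\<phi> f = \<zero>\<^bsub>?B'\<^esub>" using c(3) by simp
      obtain k where k: "k \<le> N" "c k \<noteq> \<zero>" using c(2) by blast
      have "up_ring.coeff (UP ?B) f k = (\<Oplus>\<^bsub>?B\<^esub>j\<in>{..N}. up_ring.coeff (UP ?B) (?t j) k)"
        unfolding f_def by (rule E.coeff_finsum[OF _ tc]) simp
      also have "\<dots> = (\<Oplus>\<^bsub>?B\<^esub>j\<in>{..N}. if k = j then c j else \<zero>\<^bsub>?B\<^esub>)"
        by (rule NB.finsum_cong') (use c(1) Bc(2) in auto)
      also have "\<dots> = c k" by (rule NB.finsum_singleton) (use k c(1) in auto)
      finally have "up_ring.coeff (UP ?B) f k \<noteq> \<zero>\<^bsub>?B\<^esub>" using k by simp
      then have "f \<noteq> \<zero>\<^bsub>UP ?B\<^esub>" using E.coeff_zero by metis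
      then show "Suc l \<le> h"
        using height_adjoin(2)[OF noeth hom' surj prime_restrict[OF B S BS P0] PB ht chain
            subring_is_domain[OF B] fc _ f0] by blast
    qed
  qed
  ultimately show ?thesis using B' BB' xB' by (intro exI[of _ B']) blast
qed

context UP_domain
begin

text \<open>The dimension inequality for subrings of \<open>R[t]\<close>, where \<open>R\<close> is a Noetherian domain: a chain of
  primes that all have the same nonzero trace on \<open>R\<close> is no longer than the height of this trace.
  The elements \<open>x \<in> Q (n - k) - Q (n - k - 1)\<close> are adjoined to \<open>R\<close> from the top of the chain downwards. Every
  adjunction lowers the height by one, except possibly the first adjunction of an element that is
  transcendental over \<open>R\<close>, after which the whole of \<open>R[t]\<close> is algebraic. The last height is
  still at least one because the trace is nonzero.\<close>

theorem chain_length_bound: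
  assumes noeth: "noetherian_cring R"
    and S: "subring S P" and CS: "(\<lambda>a. up_ring.monom P a 0) ` carrier R \<subseteq> S"
    and Q: "\<And>i. i \<le> n \<Longrightarrow> primeideal (Q i) (P\<lparr>carrier := S\<rparr>)"
    and Q_less: "\<And>i. i < n \<Longrightarrow> Q i \<subset> Q (Suc i)"
    and contr: "\<And>a. a \<in> carrier R \<Longrightarrow> up_ring.monom P a 0 \<in> Q n \<Longrightarrow> up_ring.monom P a 0 \<in> Q 0"
    and nonzero: "\<exists>a\<in>carrier R. a \<noteq> \<zero> \<and> up_ring.monom P a 0 \<in> Q 0"
    and ht: "\<And>l. prime_chain R {} {a \<in> carrier R. up_ring.monom P a 0 \<in> Q 0} l \<Longrightarrow> l \<le> d"
  shows "n \<le> d"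
proof -
  interpret NR: noetherian_cring R by fact
  define C where "C = (\<lambda>a. up_ring.monom P a 0) ` carrier R"
  interpret c: ring_hom_cring R P "\<lambda>a. up_ring.monom P a 0"
    by (rule ring_hom_cringI[OF R.cring_axioms UP_cring const_ring_hom])
  have C: "subring C P" unfolding C_def by (rule c.ring.img_is_subring[OF R.carrier_is_subring])
  have Cc: "cring (P\<lparr>carrier := C\<rparr>)" by (rule P.subring_cring[OF C])
  interpret cC: ring_hom_cring R "P\<lparr>carrier := C\<rparr>" "\<lambda>a. up_ring.monom P a 0"
    by (rule ring_hom_cringI[OF R.cring_axioms Cc]) (auto simp: ring_hom_def C_def)
  have surjC: "(\<lambda>a. up_ring.monom P a 0) ` carrier R = carrier (P\<lparr>carrier := C\<rparr>)" by (simp add: C_def)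
  have Q_mono: "Q i \<subseteq> Q j" if "i \<le> j" "j \<le> n" for i j
    using that
  proof (induction j rule: dec_induct)
    case (step j)
    then show ?case using Q_less[of j] by auto
  qed simp
  have Q0: "primeideal (Q 0) (P\<lparr>carrier := S\<rparr>)" using Q by simp
  (* State after k adjunctions: either no step was wasted, or exactly one may have been wasted
     and every element of R[t] is algebraic over B. *)
  let ?inv = "\<lambda>k B. subring B P \<and> noetherian_cring (P\<lparr>carrier := B\<rparr>) \<and> C \<subseteq> B \<and> B \<subseteq> S \<and>
    Q (n - k) \<inter> B \<subseteq> Q 0 \<and>
    ((\<forall>l. prime_chain (P\<lparr>carrier := B\<rparr>) {} (Q 0 \<inter> B) l \<longrightarrow> l + k \<le> d) \<or>
     (\<forall>g\<in>carrier P. algebraic_over P B g) \<and>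
       (\<forall>l. prime_chain (P\<lparr>carrier := B\<rparr>) {} (Q 0 \<inter> B) l \<longrightarrow> l + k \<le> Suc d))"
  have "\<exists>B. ?inv k B" if "k \<le> n" for k
    using that
  proof (induction k)
    case 0
    have noC: "noetherian_cring (P\<lparr>carrier := C\<rparr>)" by (rule cC.noetherian_image[OF noeth surjC])
    have "l \<le> d" if "prime_chain (P\<lparr>carrier := C\<rparr>) {} (Q 0 \<inter> C) l" for l
    proof -
      have "{a \<in> carrier R. up_ring.monom P a 0 \<in> Q 0 \<inter> C} = {a \<in> carrier R. up_ring.monom P a 0 \<in> Q 0}"
        by (auto simp: C_def)
      then show ?thesis using cC.prime_chain_vimage[OF surjC that] by (intro ht) simp
    qed
    moreover have "Q n \<inter> C \<subseteq> Q 0" using contr by (auto simp: C_def)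
    ultimately show ?case using C noC CS by (intro exI[of _ C]) (auto simp: C_def)
  next
    case (Suc k)
    then obtain B where B: "subring B P" "noetherian_cring (P\<lparr>carrier := B\<rparr>)" "C \<subseteq> B" "B \<subseteq> S"
      "Q (n - k) \<inter> B \<subseteq> Q 0" and
      alt: "(\<forall>l. prime_chain (P\<lparr>carrier := B\<rparr>) {} (Q 0 \<inter> B) l \<longrightarrow> l + k \<le> d) \<or>
     (\<forall>g\<in>carrier P. algebraic_over P B g) \<and>
       (\<forall>l. prime_chain (P\<lparr>carrier := B\<rparr>) {} (Q 0 \<inter> B) l \<longrightarrow> l + k \<le> Suc d)"
      using Suc_leD by blast
    have nk: "Suc (n - Suc k) = n - k" using Suc.prems by simp
    have "Q (n - Suc k) \<subset> Q (n - k)" using Q_less[of "n - Suc k"] Suc.prems nk by simp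
    then obtain x where x: "x \<in> Q (n - k)" "x \<notin> Q (n - Suc k)" by blast
    have xS: "x \<in> S"
      using x(1) P.subring_ideal_closed(2)[OF S P.subring_prime_closed(1)[OF S Q[of "n - k"]]] by auto
    have xP: "x \<in> carrier P" using xS subringE(1)[OF S] by blast
    have nk': "n - Suc k \<le> n" "n - k \<le> n" "n - Suc k \<le> n - k" by auto
    from domain.adjoin_transcendental_residue[OF UP_domain B(1,2) S B(4) xS x Q0 Q[OF nk'(1)] Q[OF nk'(2)]
        Q_mono[OF le0 nk'(1)] Q_mono[OF nk'(3,2)] B(5)]
    obtain B' where B': "subring B' P" "noetherian_cring (P\<lparr>carrier := B'\<rparr>)" "B \<subseteq> B'" "x \<in> B'" "B' \<subseteq> S"
      "Q (n - Suc k) \<inter> B' \<subseteq> Q 0" and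
      h: "\<forall>h. (\<forall>l. prime_chain (P\<lparr>carrier := B\<rparr>) {} (Q 0 \<inter> B) l \<longrightarrow> l \<le> h) \<longrightarrow>
      (\<forall>l. prime_chain (P\<lparr>carrier := B'\<rparr>) {} (Q 0 \<inter> B') l \<longrightarrow> l \<le> h \<and> (algebraic_over P B x \<longrightarrow> Suc l \<le> h))"
      by (elim exE conjE)
    have base: "prime_chain (P\<lparr>carrier := B\<rparr>) {} (Q 0 \<inter> B) 0"
      using P.prime_restrict[OF B(1) S B(4) Q0] by simp
    have sharpen: "Suc l + k \<le> e" if "algebraic_over P B x"
      "\<forall>l. prime_chain (P\<lparr>carrier := B\<rparr>) {} (Q 0 \<inter> B) l \<longrightarrow> l + k \<le> e"
      "prime_chain (P\<lparr>carrier := B'\<rparr>) {} (Q 0 \<inter> B') l" for l e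
    proof -
      have "k \<le> e" using that(2) base by fastforce
      have "\<forall>l. prime_chain (P\<lparr>carrier := B\<rparr>) {} (Q 0 \<inter> B) l \<longrightarrow> l \<le> e - k" using that(2) by fastforce
      then have "Suc l \<le> e - k" using h that(1,3) by blast
      then show ?thesis using \<open>k \<le> e\<close> by simp
    qed
    have keep: "l + k \<le> e" if "\<forall>l. prime_chain (P\<lparr>carrier := B\<rparr>) {} (Q 0 \<inter> B) l \<longrightarrow> l + k \<le> e"
      "prime_chain (P\<lparr>carrier := B'\<rparr>) {} (Q 0 \<inter> B') l" for l e
    proof -
      have "k \<le> e" using that(1) base by fastforce
      have "\<forall>l. prime_chain (P\<lparr>carrier := B\<rparr>) {} (Q 0 \<inter> B) l \<longrightarrow> l \<le> e - k" using that(1) by fastforce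
      then have "l \<le> e - k" using h that(2) by blast
      then show ?thesis using \<open>k \<le> e\<close> by simp
    qed
    have "(\<forall>l. prime_chain (P\<lparr>carrier := B'\<rparr>) {} (Q 0 \<inter> B') l \<longrightarrow> l + Suc k \<le> d) \<or>
     (\<forall>g\<in>carrier P. algebraic_over P B' g) \<and>
       (\<forall>l. prime_chain (P\<lparr>carrier := B'\<rparr>) {} (Q 0 \<inter> B') l \<longrightarrow> l + Suc k \<le> Suc d)"
    proof (cases "algebraic_over P B x")
      case True
      from alt show ?thesis
      proof
        assume a: "\<forall>l. prime_chain (P\<lparr>carrier := B\<rparr>) {} (Q 0 \<inter> B) l \<longrightarrow> l + k \<le> d"
        show ?thesis by (rule disjI1) (use sharpen[OF True a] in simp)
      next
        assume a: "(\<forall>g\<in>carrier P. algebraic_over P B g) \<and>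
          (\<forall>l. prime_chain (P\<lparr>carrier := B\<rparr>) {} (Q 0 \<inter> B) l \<longrightarrow> l + k \<le> Suc d)"
        show ?thesis
        proof (rule disjI2, intro conjI ballI)
          show "algebraic_over P B' g" if "g \<in> carrier P" for g
            using conjunct1[OF a] that algebraic_over_mono[OF _ B'(3)] by blast
          show "\<forall>l. prime_chain (P\<lparr>carrier := B'\<rparr>) {} (Q 0 \<inter> B') l \<longrightarrow> l + Suc k \<le> Suc d"
            using sharpen[OF True conjunct2[OF a]] by simp
        qed
      qed
    next
      case False
      then have 1: "\<forall>l. prime_chain (P\<lparr>carrier := B\<rparr>) {} (Q 0 \<inter> B) l \<longrightarrow> l + k \<le> d"
        using alt xP by blast
      have CB': "C \<subseteq> B'" using B(3) B'(3) by (rule subset_trans)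
      have nC: "\<not> algebraic_over P C x" using False algebraic_over_mono[OF _ B(3)] by metis
      have "algebraic_over P B' g" if "g \<in> carrier P" for g
        by (rule algebraic_over_transcendental[OF B'(1) CB'[unfolded C_def] B'(4) nC[unfolded C_def] that])
      moreover have "\<forall>l. prime_chain (P\<lparr>carrier := B'\<rparr>) {} (Q 0 \<inter> B') l \<longrightarrow> l + Suc k \<le> Suc d"
        using keep[OF 1] by simp
      ultimately show ?thesis by blast
    qed
    then have "?inv (Suc k) B'" by (intro conjI B' subset_trans[OF B(3) B'(3)])
    then show ?case by (rule exI)
  qed
  from this[OF le_refl] obtain B where inv: "?inv n B" by (rule exE)
  have B: "subring B P" "C \<subseteq> B" "B \<subseteq> S" using inv by blast+
  have l: "l + n \<le> Suc d" if "prime_chain (P\<lparr>carrier := B\<rparr>) {} (Q 0 \<inter> B) l" for l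
    using inv that le_SucI by blast
  interpret DB: "domain" "P\<lparr>carrier := B\<rparr>" by (rule domain.subring_is_domain[OF UP_domain B(1)])
  obtain a where a: "a \<in> carrier R" "a \<noteq> \<zero>" "up_ring.monom P a 0 \<in> Q 0" using nonzero by blast
  have "up_ring.monom P a 0 \<noteq> \<zero>\<^bsub>P\<^esub>" using a coeff_monom[of a 0 0] by (metis coeff_zero)
  moreover have "up_ring.monom P a 0 \<in> B" using a(1) B(2) by (auto simp: C_def)
  moreover have "\<zero>\<^bsub>P\<^esub> \<in> Q 0 \<inter> B"
    using P.subring_ideal_closed(1)[OF S P.subring_prime_closed(1)[OF S Q0]] subringE(2)[OF B(1)] by simp
  ultimately have "{\<zero>\<^bsub>P\<^esub>} \<subset> Q 0 \<inter> B" using a(3) by blast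
  moreover have "primeideal {\<zero>\<^bsub>P\<^esub>} (P\<lparr>carrier := B\<rparr>)" using DB.zeroprimeideal by simp
  ultimately have "prime_chain (P\<lparr>carrier := B\<rparr>) {} (Q 0 \<inter> B) (Suc 0)"
    using P.prime_restrict[OF B(1) S B(3) Q0] by auto
  then show ?thesis using l by fastforce
qed

end

section \<open>Krull dimension and local rings\<close>

lemma prime_chain_le_krull_dim:
  assumes "prime_chain R K P l"
  shows "enat l \<le> krull_dim R"
proof -
  have "\<exists>p. p l = P \<and> (\<forall>i\<le>l. primeideal (p i) R) \<and> (\<forall>i<l. p i \<subset> p (Suc i))"
    using assms
  proof (induction l arbitrary: P)
    case 0
    then show ?case by (intro exI[of _ "\<lambda>_. P"]) simp
  next
    case (Suc l)
    from Suc.prems obtain q where q: "primeideal P R" "q \<subset> P" and ch: "prime_chain R K q l"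
      by auto
    from Suc.IH[OF ch] obtain p where
      p: "p l = q" "\<forall>i\<le>l. primeideal (p i) R" "\<forall>i<l. p i \<subset> p (Suc i)"
      by (elim exE conjE)
    show ?case
      by (intro exI[of _ "p(Suc l := P)"]) (use p q in \<open>auto simp: le_Suc_eq less_Suc_eq\<close>)
  qed
  then have "enat l \<in> {enat n | n. \<exists>p :: nat \<Rightarrow> 'a set.
     (\<forall>i\<le>n. primeideal (p i) R) \<and> (\<forall>i<n. p i \<subset> p (Suc i))}" by blast
  then show ?thesis unfolding krull_dim_def by (rule Sup_upper)
qed

sublocale local_ring \<subseteq> noetherian_cring R by unfold_locales

context local_ring
begin

lemma maximal_prime: "primeideal m R"
  by (rule maximalideal_prime[OF maximal])

lemma proper_ideal_le:
  assumes "ideal J R" "\<one> \<notin> J"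
  shows "J \<subseteq> m"
proof -
  let ?F = "{K. ideal K R \<and> \<one> \<notin> K \<and> J \<subseteq> K}"
  have "?F \<noteq> {}" using assms by blast
  moreover have "\<And>K. K \<in> ?F \<Longrightarrow> ideal K R" by blast
  ultimately have "\<exists>M\<in>?F. \<forall>K\<in>?F. M \<subseteq> K \<longrightarrow> K = M" by (rule maximal_in_family)
  then obtain M where MF: "M \<in> ?F" and max: "\<forall>K\<in>?F. M \<subseteq> K \<longrightarrow> K = M" by (rule bexE)
  have "maximalideal M R"
  proof (rule maximalidealI)
    show "ideal M R" using MF by blast
    show "carrier R \<noteq> M" using MF by auto
    fix K assume K: "ideal K R" "M \<subseteq> K" "K \<subseteq> carrier R"
    show "K = M \<or> K = carrier R"
    proof (cases "\<one> \<in> K")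
      case True
      then show ?thesis using ideal.one_imp_carrier[OF K(1)] by blast
    next
      case False
      have "K \<in> ?F" using False K(1,2) MF by blast
      then show ?thesis using max K(2) by blast
    qed
  qed
  then have "M = m" by (rule maximal_unique)
  then show ?thesis using MF by blast
qed

lemma prime_over_maximal:
  assumes "primeideal q R" "m \<subseteq> q"
  shows "q = m"
  using proper_ideal_le[OF primeideal_closed(1,2)[OF assms(1)]] assms(2) by blast

text \<open>If no power of \<open>a\<close> vanishes, some prime avoids all powers of \<open>a\<close>; it lies strictly below \<open>m\<close>.\<close>

lemma nilpotent_if_dim_0:
  assumes "krull_dim R = 0" "a \<in> m"
  shows "\<exists>k::nat. a [^] k = \<zero>"
proof (rule ccontr)
  assume nz: "\<not> ?thesis"
  have ac: "a \<in> carrier R" using assms(2) ideal_closed(2)[OF primeideal_closed(1)[OF maximal_prime]] by blast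
  have "\<exists>q. primeideal q R \<and> {\<zero>} \<subseteq> q \<and> range (\<lambda>k::nat. a [^] k) \<inter> q = {}"
  proof (rule prime_disjoint_from_monoid[OF zeroideal])
    show "range (\<lambda>k::nat. a [^] k) \<subseteq> carrier R" using ac by auto
    show "\<one> \<in> range (\<lambda>k::nat. a [^] k)" by (rule range_eqI[of _ _ 0]) simp
    show "x \<otimes> y \<in> range (\<lambda>k::nat. a [^] k)" if xy: "x \<in> range (\<lambda>k::nat. a [^] k)" "y \<in> range (\<lambda>k::nat. a [^] k)" for x y
    proof -
      obtain i j :: nat where "x = a [^] i" "y = a [^] j" using xy by blast
      then have "x \<otimes> y = a [^] (i + j)" by (simp add: nat_pow_mult ac)
      then show ?thesis by blast
    qed
    show "range (\<lambda>k::nat. a [^] k) \<inter> {\<zero>} = {}" using nz by auto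
  qed
  then obtain q where q: "primeideal q R" "range (\<lambda>k::nat. a [^] k) \<inter> q = {}" by blast
  have "a [^] (1::nat) \<notin> q" using q(2) by blast
  then have "a \<notin> q" using ac by simp
  then have "q \<subset> m" using proper_ideal_le[OF primeideal_closed(1,2)[OF q(1)]] assms(2) by blast
  then have "prime_chain R {} m (Suc 0)" using q(1) maximal_prime by auto
  from prime_chain_le_krull_dim[OF this] show False using assms(1) by (simp add: zero_enat_def)
qed

lemma prime_below_maximal:
  assumes "krull_dim R \<noteq> 0"
  shows "\<exists>q. primeideal q R \<and> q \<subset> m"
proof (rule ccontr)
  assume none: "\<not> ?thesis"
  have "krull_dim R \<le> 0"
    unfolding krull_dim_def
  proof (rule Sup_least)
    fix x assume "x \<in> {enat n | n. \<exists>p :: nat \<Rightarrow> 'a set.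
     (\<forall>i\<le>n. primeideal (p i) R) \<and> (\<forall>i<n. p i \<subset> p (Suc i))}"
    then obtain n and p :: "nat \<Rightarrow> 'a set" where x: "x = enat n"
      and p: "\<forall>i\<le>n. primeideal (p i) R" "\<forall>i<n. p i \<subset> p (Suc i)" by blast
    have "n = 0"
    proof (rule ccontr)
      assume "n \<noteq> 0"
      then have "primeideal (p 0) R" "primeideal (p 1) R" "p 0 \<subset> p 1" using p by auto
      moreover from this have "p 1 \<subseteq> m" using proper_ideal_le primeideal_closed(1,2) by blast
      ultimately show False using none by blast
    qed
    then show "x \<le> 0" using x by (simp add: zero_enat_def)
  qed
  then show False using assms by simp
qed

end

section \<open>Rees rings\<close>

lemma (in ring) subring_ideal_finsum:
  assumes S: "subring S R" and I: "ideal I (R\<lparr>carrier := S\<rparr>)"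
    and "finite A" "\<And>i. i \<in> A \<Longrightarrow> g i \<in> I"
  shows "finsum R g A \<in> I"
  using assms(3,4)
proof (induction A rule: finite_induct)
  case empty
  then show ?case using subring_ideal_closed(1)[OF S I] by simp
next
  case (insert a A)
  have "g i \<in> carrier R" if "i \<in> insert a A" for i
    using insert.prems[OF that] subring_ideal_closed(2)[OF S I] subringE(1)[OF S] by blast
  then have "finsum R g (insert a A) = g a \<oplus> finsum R g A"
    using insert.hyps by (intro finsum_insert) auto
  then show ?case using insert subring_ideal_closed(3)[OF S I] by simp
qed

lemma (in ring_hom_cring) image_of_prime:
  assumes surj: "h ` carrier R = carrier S" and P: "primeideal P R"
    and ker: "\<And>x. x \<in> carrier R \<Longrightarrow> h x = \<zero>\<^bsub>S\<^esub> \<Longrightarrow> x \<in> P"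
  shows "x \<in> carrier R \<Longrightarrow> h x \<in> h ` P \<longleftrightarrow> x \<in> P" and "primeideal (h ` P) S"
proof -
  note Pc = R.ideal_closed[OF R.primeideal_closed(1)[OF P]]
  have mem: "h x \<in> h ` P \<longleftrightarrow> x \<in> P" if x: "x \<in> carrier R" for x
  proof
    assume "h x \<in> h ` P"
    then obtain y where y: "y \<in> P" "h x = h y" by blast
    have yc: "y \<in> carrier R" using y(1) Pc(2) by blast
    have "h (x \<ominus> y) = h x \<oplus>\<^bsub>S\<^esub> (\<ominus>\<^bsub>S\<^esub> h y)" using x yc by (simp add: R.minus_eq)
    also have "\<dots> = \<zero>\<^bsub>S\<^esub>" unfolding y(2) using yc by (simp add: S.r_neg)
    finally have "x \<ominus> y \<in> P" using ker x yc by simp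
    then have "(x \<ominus> y) \<oplus> y \<in> P" using Pc(3) y(1) by blast
    then show "x \<in> P" using x yc by (simp add: R.minus_eq R.a_assoc R.l_neg)
  qed blast
  then show "x \<in> carrier R \<Longrightarrow> h x \<in> h ` P \<longleftrightarrow> x \<in> P" by blast
  have hP: "h x \<in> h ` P" if "x \<in> P" for x using that by blast
  show "primeideal (h ` P) S"
  proof (rule S.primeidealI_closed, rule S.idealI_closed)
    show "h ` P \<subseteq> carrier S" using Pc(2) by auto
    show "\<zero>\<^bsub>S\<^esub> \<in> h ` P" using hP[OF Pc(1)] by simp
    show "\<one>\<^bsub>S\<^esub> \<notin> h ` P" using mem[of \<one>] R.primeideal_closed(2)[OF P] by simp
    fix u
    { fix v assume "u \<in> h ` P" "v \<in> h ` P"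
      then obtain x y where xy: "x \<in> P" "y \<in> P" "u = h x" "v = h y" by blast
      moreover have "x \<in> carrier R" "y \<in> carrier R" using xy Pc(2) by auto
      ultimately show "u \<oplus>\<^bsub>S\<^esub> v \<in> h ` P" using hP[OF Pc(3)[OF xy(1,2)]] by simp }
    { fix r assume "r \<in> carrier S" "u \<in> h ` P"
      then obtain x y where xy: "x \<in> carrier R" "y \<in> P" "r = h x" "u = h y" using surj by blast
      moreover have "y \<in> carrier R" using xy Pc(2) by auto
      ultimately show "r \<otimes>\<^bsub>S\<^esub> u \<in> h ` P" using hP[OF Pc(6)[OF xy(1,2)]] by simp }
    { fix v assume uv: "u \<in> carrier S" "v \<in> carrier S" "u \<otimes>\<^bsub>S\<^esub> v \<in> h ` P"
      then obtain x y where xy: "x \<in> carrier R" "y \<in> carrier R" "u = h x" "v = h y" using surj by blast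
      have "h (x \<otimes> y) \<in> h ` P" using uv(3) xy by simp
      then have "x \<otimes> y \<in> P" using mem[OF R.m_closed[OF xy(1,2)]] by blast
      then have "x \<in> P \<or> y \<in> P" using R.primeideal_closed(3)[OF P xy(1,2)] by blast
      then show "u \<in> h ` P \<or> v \<in> h ` P" using xy by blast }
  qed
qed

context ring_filtration
begin

lemma filt_antimono: "i \<le> j \<Longrightarrow> I j \<subseteq> I i"
  by (induction j rule: dec_induct) (use filt_decr in blast)+

lemma rees_carrier:
  "f \<in> carrier (rees_ring R I) \<longleftrightarrow> f \<in> carrier (UP R) \<and> (\<forall>n. up_ring.coeff (UP R) f n \<in> I n)"
  by (simp add: rees_ring_def)

lemma rees_eq: "rees_ring R I = (UP R)\<lparr>carrier := carrier (rees_ring R I)\<rparr>"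
  by (simp add: rees_ring_def)

lemma rees_subring: "subring (carrier (rees_ring R I)) (UP R)"
proof -
  interpret U: UP_cring R "UP R" by (unfold_locales; simp)
  have "carrier (rees_ring R I) \<subseteq> carrier (UP R)" using rees_carrier by blast
  moreover have "cring ((UP R)\<lparr>carrier := carrier (rees_ring R I)\<rparr>)"
    using rees_ring_cring[OF ring_filtration_axioms] rees_eq by simp
  ultimately show ?thesis using U.P.subcring_iff subcring.axioms(1) by blast
qed

lemma rees_monom:
  assumes "a \<in> I n"
  shows "up_ring.monom (UP R) a n \<in> carrier (rees_ring R I)"
proof -
  interpret U: UP_cring R "UP R" by (unfold_locales; simp)
  have "a \<in> carrier R" using assms ideal_closed(2)[OF filt_ideal] by blast
  then show ?thesis
    using assms ideal_closed(1)[OF filt_ideal] by (auto simp: rees_carrier)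
qed

lemma rees_const: "a \<in> carrier R \<Longrightarrow> up_ring.monom (UP R) a 0 \<in> carrier (rees_ring R I)"
  using rees_monom[of a 0] filt_0 by simp

lemma rees_const_hom: "ring_hom_cring R (rees_ring R I) (\<lambda>a. up_ring.monom (UP R) a 0)"
proof -
  interpret U: UP_cring R "UP R" by (unfold_locales; simp)
  have "(\<lambda>a. up_ring.monom (UP R) a 0) \<in> ring_hom R ((UP R)\<lparr>carrier := carrier (rees_ring R I)\<rparr>)"
    using U.const_ring_hom rees_const by (auto simp: ring_hom_def)
  then show ?thesis
    using ring_hom_cringI[OF cring_axioms rees_ring_cring[OF ring_filtration_axioms]] rees_eq by simp
qed

end

locale filtered_local_ring = local_ring R m + ring_filtration R I for R (structure) and m I
begin

lemma rees_prime_contracts: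
  assumes q: "primeideal q (rees_ring R I)" and mq: "\<And>a. a \<in> m \<Longrightarrow> up_ring.monom (UP R) a 0 \<in> q"
  shows "{a \<in> carrier R. up_ring.monom (UP R) a 0 \<in> q} = m"
proof (rule prime_over_maximal)
  interpret c: ring_hom_cring R "rees_ring R I" "\<lambda>a. up_ring.monom (UP R) a 0" by (rule rees_const_hom)
  show "primeideal {a \<in> carrier R. up_ring.monom (UP R) a 0 \<in> q} R"
    by (rule c.ring.primeideal_vimage[OF cring_axioms q])
  show "m \<subseteq> {a \<in> carrier R. up_ring.monom (UP R) a 0 \<in> q}"
    using mq ideal_closed(2)[OF primeideal_closed(1)[OF maximal_prime]] by blast
qed

text \<open>Since \<open>I 1\<close> is proper, \<open>I n \<subseteq> m\<close> for \<open>n \<ge> 1\<close>, and \<open>m\<close> consists of nilpotent elements. Hence every prime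
  contains all terms of positive degree, and a prime containing \<open>m\<close> is determined by its constants.\<close>

lemma rees_chain_dim_0:
  assumes dim: "krull_dim R = 0" and I1: "I 1 \<noteq> carrier R"
    and q: "primeideal q (rees_ring R I)" "\<And>a. a \<in> m \<Longrightarrow> up_ring.monom (UP R) a 0 \<in> q"
    and q': "primeideal q' (rees_ring R I)" "q \<subseteq> q'"
  shows "q' \<subseteq> q"
proof
  interpret U: UP_cring R "UP R" by (unfold_locales; simp)
  let ?S = "carrier (rees_ring R I)"
  note S = rees_subring
  have q1: "primeideal q ((UP R)\<lparr>carrier := ?S\<rparr>)" and q1': "primeideal q' ((UP R)\<lparr>carrier := ?S\<rparr>)"
    using q(1) q'(1) rees_eq by simp_all
  have qi: "ideal q ((UP R)\<lparr>carrier := ?S\<rparr>)" and qi': "ideal q' ((UP R)\<lparr>carrier := ?S\<rparr>)"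
    using U.P.subring_prime_closed(1)[OF S] q1 q1' by blast+
  note qc = U.P.subring_ideal_closed[OF S qi] and qc' = U.P.subring_ideal_closed[OF S qi']
  have "\<one> \<notin> I 1" using I1 ideal.one_imp_carrier[OF filt_ideal] by blast
  then have "I 1 \<subseteq> m" by (rule proper_ideal_le[OF filt_ideal])
  then have Im: "I n \<subseteq> m" if "n \<ge> 1" for n using filt_antimono[OF that] by blast
  fix f assume f: "f \<in> q'"
  then have fS: "f \<in> ?S" using qc'(2) by blast
  then have fc: "f \<in> carrier (UP R)" and fI: "up_ring.coeff (UP R) f n \<in> I n" for n
    by (auto simp: rees_carrier)
  have mon: "up_ring.monom (UP R) b n \<in> q" if n: "n \<ge> 1" and b: "b \<in> I n" for n b
  proof -
    have bm: "b \<in> m" using Im n b by blast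
    have bc: "b \<in> carrier R" using b ideal_closed(2)[OF filt_ideal] by blast
    obtain k :: nat where "b [^] k = \<zero>" using nilpotent_if_dim_0[OF dim bm] by blast
    then have "up_ring.monom (UP R) b n [^]\<^bsub>UP R\<^esub> k = \<zero>\<^bsub>UP R\<^esub>" using U.monom_pow[OF bc] by simp
    then have z: "up_ring.monom (UP R) b n [^]\<^bsub>UP R\<^esub> k \<in> q" using qc(1) by simp
    have mS: "up_ring.monom (UP R) b n \<in> ?S" by (rule rees_monom[OF b])
    have pS: "up_ring.monom (UP R) b n [^]\<^bsub>UP R\<^esub> j \<in> ?S" for j :: nat
      by (induction j) (use mS subringE(3,6)[OF S] in auto)
    show ?thesis using z
    proof (induction k)
      case 0
      then show ?case using U.P.subring_prime_closed(2)[OF S q1] by simp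
    next
      case (Suc k)
      then show ?case using U.P.subring_prime_closed(3)[OF S q1 pS mS] by auto
    qed
  qed
  obtain g where g: "g \<in> carrier (UP R)" "f = up_ring.monom (UP R) (up_ring.coeff (UP R) f 0) 0 \<oplus>\<^bsub>UP R\<^esub> up_ring.monom (UP R) \<one> 1 \<otimes>\<^bsub>UP R\<^esub> g"
    "\<And>n. up_ring.coeff (UP R) g n = up_ring.coeff (UP R) f (Suc n)"
    using U.const_plus_X_mult[OF fc] by blast
  (* h is the part of f without constant term. *)
  define h where "h = up_ring.monom (UP R) \<one> 1 \<otimes>\<^bsub>UP R\<^esub> g"
  have hc: "h \<in> carrier (UP R)" unfolding h_def using g(1) by simp
  let ?r = "up_ring.coeff (UP R) f 0"
  have rc: "?r \<in> carrier R" using fc by simp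
  have feq: "f = up_ring.monom (UP R) ?r 0 \<oplus>\<^bsub>UP R\<^esub> h" using g(2) unfolding h_def .
  have "up_ring.monom (UP R) (up_ring.coeff (UP R) h n) n \<in> q" for n
  proof (cases n)
    case 0
    then show ?thesis using U.coeff_X_mult_0[OF g(1)] qc(1) unfolding h_def by (simp del: U.coeff_mult)
  next
    case (Suc k)
    have "up_ring.coeff (UP R) h n = up_ring.coeff (UP R) f n"
      unfolding h_def Suc U.coeff_X_mult_Suc[OF g(1)] by (rule g(3))
    then show ?thesis using mon[of n] fI Suc by simp
  qed
  then have "(\<Oplus>\<^bsub>UP R\<^esub>i\<in>{..deg R h}. up_ring.monom (UP R) (up_ring.coeff (UP R) h i) i) \<in> q"
    by (intro U.P.subring_ideal_finsum[OF S qi]) simp_all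
  then have hq: "h \<in> q" unfolding U.up_repr[OF hc] .
  have "up_ring.monom (UP R) ?r 0 \<oplus>\<^bsub>UP R\<^esub> h \<in> q'" using f feq by simp
  then have "up_ring.monom (UP R) ?r 0 \<in> q'" using qc'(5)[OF rees_const[OF rc]] hq q'(2) by blast
  then have "?r \<in> {a \<in> carrier R. up_ring.monom (UP R) a 0 \<in> q'}" using rc by blast
  also have "\<dots> = m" by (rule rees_prime_contracts[OF q'(1)]) (use q(2) q'(2) in blast)
  finally have "up_ring.monom (UP R) ?r 0 \<in> q" by (rule q(2))
  then show "f \<in> q" using qc(3) hq feq by metis
qed

text \<open>This reduces the bound to the case of a domain: \<open>q\<close> contains the kernel \<open>p R[t] \<inter> S\<close> of the map
  from the Rees ring \<open>S\<close> to \<open>(R/p)[t]\<close>. The set \<open>S - q\<close> is multiplicative and misses \<open>0\<close>, so some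
  prime of \<open>R[t]\<close> misses it, and its trace \<open>p\<close> on \<open>R\<close> has the required property. If \<open>p = m\<close>,
  then any smaller prime serves as well; the strict inclusion keeps the maximal ideal of \<open>R/p\<close>
  nonzero.\<close>

lemma rees_prime_contains_extension:
  assumes dim: "krull_dim R \<noteq> 0"
    and q: "primeideal q (rees_ring R I)" "\<And>a. a \<in> m \<Longrightarrow> up_ring.monom (UP R) a 0 \<in> q"
  shows "\<exists>p. primeideal p R \<and> p \<subset> m \<and>
    (\<forall>f\<in>carrier (rees_ring R I). (\<forall>n. up_ring.coeff (UP R) f n \<in> p) \<longrightarrow> f \<in> q)"
proof -
  interpret U: UP_cring R "UP R" by (unfold_locales; simp)
  interpret UN: noetherian_cring "UP R" by (rule UP_noetherian)
  interpret c: ring_hom_cring R "UP R" "\<lambda>a. up_ring.monom (UP R) a 0"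
    by (rule ring_hom_cringI[OF cring_axioms U.UP_cring U.const_ring_hom])
  let ?S = "carrier (rees_ring R I)"
  note S = rees_subring
  have q1: "primeideal q ((UP R)\<lparr>carrier := ?S\<rparr>)" using q(1) rees_eq by simp
  note qc = U.P.subring_ideal_closed[OF S U.P.subring_prime_closed(1)[OF S q1]]
  have "\<exists>n. primeideal n (UP R) \<and> {\<zero>\<^bsub>UP R\<^esub>} \<subseteq> n \<and> (?S - q) \<inter> n = {}"
  proof (rule UN.prime_disjoint_from_monoid[OF U.P.zeroideal])
    show "?S - q \<subseteq> carrier (UP R)" using subringE(1)[OF S] by blast
    show "\<one>\<^bsub>UP R\<^esub> \<in> ?S - q" using subringE(3)[OF S] U.P.subring_prime_closed(2)[OF S q1] by blast
    show "a \<otimes>\<^bsub>UP R\<^esub> b \<in> ?S - q" if "a \<in> ?S - q" "b \<in> ?S - q" for a b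
      using that subringE(6)[OF S] U.P.subring_prime_closed(3)[OF S q1] by blast
    show "(?S - q) \<inter> {\<zero>\<^bsub>UP R\<^esub>} = {}" using qc(1) by blast
  qed
  then obtain n where n: "primeideal n (UP R)" "(?S - q) \<inter> n = {}" by blast
  define p where "p = {a \<in> carrier R. up_ring.monom (UP R) a 0 \<in> n}"
  have p: "primeideal p R" unfolding p_def by (rule c.ring.primeideal_vimage[OF cring_axioms n(1)])
  have ext: "f \<in> q" if "f \<in> ?S" "\<And>k. up_ring.coeff (UP R) f k \<in> p" for f
  proof -
    have "f \<in> n"
      by (rule U.mem_ideal_of_coeffs[OF U.P.primeideal_closed(1)[OF n(1)]])
        (use that in \<open>auto simp: p_def rees_carrier\<close>)
    then show ?thesis using n(2) that(1) by blast
  qed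
  have pm: "p \<subseteq> m" by (rule proper_ideal_le[OF primeideal_closed(1,2)[OF p]])
  show ?thesis
  proof (cases "p = m")
    case False
    then show ?thesis using p pm ext by blast
  next
    case True
    obtain p' where p': "primeideal p' R" "p' \<subset> m" using prime_below_maximal[OF dim] by blast
    then show ?thesis using ext True by (intro exI[of _ p']) blast
  qed
qed

text \<open>For \<open>d > 0\<close> the chain is mapped to the image \<open>T\<close> of the Rees ring in \<open>D[t]\<close>, where \<open>D = R/p\<close>. Its members
  contain the kernel, so it stays strict there.\<close>

theorem rees_chain_length:
  assumes dim: "krull_dim R = enat d" and I1: "d = 0 \<Longrightarrow> I 1 \<noteq> carrier R"
    and q: "\<And>i. i \<le> n \<Longrightarrow> primeideal (q i) (rees_ring R I)" "\<And>i. i < n \<Longrightarrow> q i \<subset> q (Suc i)"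
    and mq: "\<And>a. a \<in> m \<Longrightarrow> up_ring.monom (UP R) a 0 \<in> q 0"
  shows "n \<le> d"
proof (cases "d = 0")
  case True
  have "n = 0"
  proof (rule ccontr)
    assume "n \<noteq> 0"
    then have "primeideal (q 0) (rees_ring R I)" "primeideal (q (Suc 0)) (rees_ring R I)" "q 0 \<subset> q (Suc 0)"
      using q by auto
    moreover have "krull_dim R = 0" using dim True by (simp add: zero_enat_def)
    ultimately show False using rees_chain_dim_0[OF _ I1[OF True] _ mq] by blast
  qed
  then show ?thesis by simp
next
  case False
  have dim0: "krull_dim R \<noteq> 0" using dim False by (simp add: zero_enat_def)
  let ?S = "carrier (rees_ring R I)"
  note S = rees_subring
  interpret U: UP_cring R "UP R" by (unfold_locales; simp)
  have q_mono: "q 0 \<subseteq> q i" if "i \<le> n" for i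
    using that
  proof (induction i)
    case (Suc i)
    then show ?case using q(2)[of i] by auto
  qed simp
  obtain p where p: "primeideal p R" "p \<subset> m"
    and ext: "\<And>f. f \<in> ?S \<Longrightarrow> (\<And>k. up_ring.coeff (UP R) f k \<in> p) \<Longrightarrow> f \<in> q 0"
    using rees_prime_contains_extension[OF dim0 q(1)[OF le0] mq] by blast
  note pid = primeideal_closed(1)[OF p(1)]
  define D where "D = R Quot p"
  define \<rho> where "\<rho> = (+>) p"
  have domD: "domain D" unfolding D_def by (rule primeideal.quotient_is_domain[OF p(1)])
  interpret \<rho>: ring_hom_cring R D \<rho>
    unfolding D_def \<rho>_def by (rule primeideal.rcos_ring_hom_cring[OF p(1)])
  have \<rho>_zero: "\<rho> a = \<zero>\<^bsub>D\<^esub> \<longleftrightarrow> a \<in> p" if "a \<in> carrier R" for a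
    unfolding \<rho>_def D_def by (rule ideal.rcos_zero_iff[OF pid that])
  have \<rho>_surj: "\<rho> ` carrier R = carrier D"
    unfolding \<rho>_def D_def FactRing_def A_RCOSETS_def' by auto
  have noD: "noetherian_cring D" by (rule \<rho>.noetherian_image[OF noetherian_cring_axioms \<rho>_surj])
  interpret D: "domain" D by (rule domD)
  interpret V: UP_domain D "UP D" by (unfold_locales; simp)
  define \<pi> where "\<pi> = map_coeffs R D \<rho>"
  interpret \<pi>: ring_hom_cring "UP R" "UP D" \<pi> unfolding \<pi>_def by (rule \<rho>.map_coeffs_hom)
  have \<pi>c: "up_ring.coeff (UP D) (\<pi> f) k = \<rho> (up_ring.coeff (UP R) f k)" if "f \<in> carrier (UP R)" for f k
    unfolding \<pi>_def by (rule \<rho>.map_coeffs_closed(2)[OF that])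
  define T where "T = \<pi> ` ?S"
  have T: "subring T (UP D)" unfolding T_def by (rule \<pi>.ring.img_is_subring[OF S])
  have Tc: "cring ((UP D)\<lparr>carrier := T\<rparr>)" by (rule V.P.subring_cring[OF T])
  have "\<pi> \<in> ring_hom ((UP R)\<lparr>carrier := ?S\<rparr>) ((UP D)\<lparr>carrier := T\<rparr>)"
    using subringE(1)[OF S] by (auto simp: ring_hom_def T_def subset_iff)
  then interpret \<tau>: ring_hom_cring "rees_ring R I" "(UP D)\<lparr>carrier := T\<rparr>" \<pi>
    using ring_hom_cringI[OF rees_ring_cring[OF ring_filtration_axioms] Tc] rees_eq by simp
  have \<tau>_surj: "\<pi> ` ?S = carrier ((UP D)\<lparr>carrier := T\<rparr>)" by (simp add: T_def)
  have ker: "f \<in> q i" if "i \<le> n" "f \<in> ?S" "\<pi> f = \<zero>\<^bsub>(UP D)\<lparr>carrier := T\<rparr>\<^esub>" for f i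
  proof -
    have fc: "f \<in> carrier (UP R)" using that(2) rees_carrier by blast
    have "up_ring.coeff (UP R) f k \<in> p" for k
    proof -
      have "\<rho> (up_ring.coeff (UP R) f k) = up_ring.coeff (UP D) (\<pi> f) k" by (rule \<pi>c[OF fc, symmetric])
      also have "\<dots> = \<zero>\<^bsub>D\<^esub>" using that(3) by simp
      finally show ?thesis using \<rho>_zero[OF U.coeff_closed[OF fc]] by blast
    qed
    then have "f \<in> q 0" by (rule ext[OF that(2)])
    then show ?thesis using q_mono[OF that(1)] by blast
  qed
  have img1: "\<pi> f \<in> \<pi> ` q i \<longleftrightarrow> f \<in> q i" if "i \<le> n" "f \<in> ?S" for f i
    by (rule \<tau>.image_of_prime(1)[OF \<tau>_surj q(1)[OF that(1)] ker[OF that(1)] that(2)])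
  have img2: "primeideal (\<pi> ` q i) ((UP D)\<lparr>carrier := T\<rparr>)" if "i \<le> n" for i
    by (rule \<tau>.image_of_prime(2)[OF \<tau>_surj q(1)[OF that] ker[OF that]])
  have const: "\<pi> (up_ring.monom (UP R) a 0) = up_ring.monom (UP D) (\<rho> a) 0" if "a \<in> carrier R" for a
    by (rule V.up_eqI) (use that \<pi>c in auto)
  have mem_const: "up_ring.monom (UP D) (\<rho> a) 0 \<in> \<pi> ` q i \<longleftrightarrow> a \<in> m" if "i \<le> n" "a \<in> carrier R" for a i
  proof -
    have "up_ring.monom (UP D) (\<rho> a) 0 \<in> \<pi> ` q i \<longleftrightarrow> up_ring.monom (UP R) a 0 \<in> q i"
      unfolding const[OF that(2), symmetric] by (rule img1[OF that(1) rees_const[OF that(2)]])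
    also have "\<dots> \<longleftrightarrow> a \<in> {a \<in> carrier R. up_ring.monom (UP R) a 0 \<in> q i}" using that(2) by blast
    also have "\<dots> \<longleftrightarrow> a \<in> m"
      using rees_prime_contracts[OF q(1)[OF that(1)]] mq q_mono[OF that(1)] by blast
    finally show ?thesis .
  qed
  show ?thesis
  proof (rule V.chain_length_bound[OF noD T])
    show "(\<lambda>a. up_ring.monom (UP D) a 0) ` carrier D \<subseteq> T"
    proof (rule image_subsetI)
      fix b assume "b \<in> carrier D"
      then obtain a where a: "a \<in> carrier R" "b = \<rho> a" using \<rho>_surj by blast
      then show "up_ring.monom (UP D) b 0 \<in> T"
        using const[OF a(1)] rees_const[OF a(1)] unfolding T_def by (metis imageI)
    qed
    show "primeideal (\<pi> ` q i) ((UP D)\<lparr>carrier := T\<rparr>)" if "i \<le> n" for i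
      by (rule img2[OF that])
    show "\<pi> ` q i \<subset> \<pi> ` q (Suc i)" if i: "i < n" for i
    proof -
      obtain f where f: "f \<in> q (Suc i)" "f \<notin> q i" using q(2)[OF i] by blast
      have "f \<in> ?S" using f(1) \<tau>.R.ideal_closed(2)[OF \<tau>.R.primeideal_closed(1)[OF q(1)]] i
        by (meson Suc_leI subsetD)
      then have "\<pi> f \<notin> \<pi> ` q i" using img1[of i f] f(2) i by simp
      then show ?thesis using f(1) q(2)[OF i] by blast
    qed
    show "up_ring.monom (UP D) b 0 \<in> \<pi> ` q 0"
      if b: "b \<in> carrier D" "up_ring.monom (UP D) b 0 \<in> \<pi> ` q n" for b
    proof -
      obtain a where a: "a \<in> carrier R" "b = \<rho> a" using \<rho>_surj b(1) by blast
      then show ?thesis using b(2) mem_const[OF le_refl a(1)] mem_const[OF le0 a(1)] by simp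
    qed
    show "\<exists>b\<in>carrier D. b \<noteq> \<zero>\<^bsub>D\<^esub> \<and> up_ring.monom (UP D) b 0 \<in> \<pi> ` q 0"
    proof -
      obtain a where a: "a \<in> m" "a \<notin> p" using p(2) by blast
      have ac: "a \<in> carrier R" using a(1) ideal_closed(2)[OF primeideal_closed(1)[OF maximal_prime]] by blast
      have "\<rho> a \<noteq> \<zero>\<^bsub>D\<^esub>" using \<rho>_zero[OF ac] a(2) by simp
      moreover have "up_ring.monom (UP D) (\<rho> a) 0 \<in> \<pi> ` q 0" using mem_const[OF le0 ac] a(1) by simp
      ultimately show ?thesis using ac by blast
    qed
    fix l assume l: "prime_chain D {} {b \<in> carrier D. up_ring.monom (UP D) b 0 \<in> \<pi> ` q 0} l"
    have "prime_chain R {r \<in> carrier R. \<rho> r \<in> {}}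
        {r \<in> carrier R. \<rho> r \<in> {b \<in> carrier D. up_ring.monom (UP D) b 0 \<in> \<pi> ` q 0}} l"
      by (rule \<rho>.prime_chain_vimage[OF \<rho>_surj l])
    from prime_chain_le_krull_dim[OF this] show "l \<le> d" using dim by simp
  qed
qed

theorem analytic_spread_le:
  assumes I1: "krull_dim R = 0 \<Longrightarrow> I 1 \<noteq> carrier R"
  shows "analytic_spread R m I \<le> krull_dim R"
proof (cases "krull_dim R")
  case (enat d)
  let ?T = "rees_ring R I"
  let ?c = "\<lambda>a. up_ring.monom (UP R) a 0"
  interpret T: cring ?T by (rule rees_ring_cring[OF ring_filtration_axioms])
  define J where "J = Idl\<^bsub>?T\<^esub> (?c ` m)"
  have mc: "m \<subseteq> carrier R" using ideal_closed(2)[OF primeideal_closed(1)[OF maximal_prime]] .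
  have mT: "?c ` m \<subseteq> carrier ?T" using mc rees_const by blast
  have J: "ideal J ?T" unfolding J_def by (rule T.genideal_ideal[OF mT])
  have mJ: "?c ` m \<subseteq> J" unfolding J_def by (rule T.genideal_self[OF mT])
  interpret J: ideal J ?T by (rule J)
  interpret k: ring_hom_cring ?T "?T Quot J" "(+>\<^bsub>?T\<^esub>) J" by (rule J.rcos_ring_hom_cring[OF T.cring_axioms])
  have surj: "((+>\<^bsub>?T\<^esub>) J) ` carrier ?T = carrier (?T Quot J)"
    unfolding FactRing_def A_RCOSETS_def' by auto
  have "krull_dim (?T Quot J) \<le> enat d"
    unfolding krull_dim_def
  proof (rule Sup_least)
    fix x assume "x \<in> {enat n | n. \<exists>p :: nat \<Rightarrow> (nat \<Rightarrow> 'a) set set.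
     (\<forall>i\<le>n. primeideal (p i) (?T Quot J)) \<and> (\<forall>i<n. p i \<subset> p (Suc i))}"
    then obtain n and p :: "nat \<Rightarrow> (nat \<Rightarrow> 'a) set set" where x: "x = enat n"
      and p: "\<forall>i\<le>n. primeideal (p i) (?T Quot J)" "\<forall>i<n. p i \<subset> p (Suc i)" by blast
    define q where "q i = {f \<in> carrier ?T. J +>\<^bsub>?T\<^esub> f \<in> p i}" for i
    have "n \<le> d"
    proof (rule rees_chain_length[OF enat])
      show "I 1 \<noteq> carrier R" if "d = 0" using I1 enat that by (simp add: zero_enat_def)
      show "primeideal (q i) ?T" if "i \<le> n" for i
        unfolding q_def by (rule k.ring.primeideal_vimage[OF T.cring_axioms]) (use p(1) that in blast)
      show "q i \<subset> q (Suc i)" if i: "i < n" for i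
      proof -
        obtain y where y: "y \<in> p (Suc i)" "y \<notin> p i" using p(2) i by blast
        have "primeideal (p (Suc i)) (?T Quot J)" using p(1) i by simp
        then have "y \<in> carrier (?T Quot J)"
          using y(1) k.S.ideal_closed(2)[OF k.S.primeideal_closed(1)] by blast
        then obtain f where f: "f \<in> carrier ?T" "y = J +>\<^bsub>?T\<^esub> f" using surj by blast
        then have "f \<in> q (Suc i)" "f \<notin> q i" using y by (auto simp: q_def)
        moreover have "q i \<subseteq> q (Suc i)" using p(2) i by (auto simp: q_def)
        ultimately show ?thesis by blast
      qed
      show "?c a \<in> q 0" if "a \<in> m" for a
      proof -
        have aJ: "?c a \<in> J" and aT: "?c a \<in> carrier ?T" using that mJ mT by blast+
        have "J +>\<^bsub>?T\<^esub> ?c a = \<zero>\<^bsub>?T Quot J\<^esub>" using J.rcos_zero_iff[OF aT] aJ by simp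
        moreover have "primeideal (p 0) (?T Quot J)" using p(1) by simp
        then have "\<zero>\<^bsub>?T Quot J\<^esub> \<in> p 0" using k.S.ideal_closed(1)[OF k.S.primeideal_closed(1)] by blast
        ultimately show ?thesis unfolding q_def using aT by simp
      qed
    qed
    then show "x \<le> enat d" using x by simp
  qed
  then show ?thesis unfolding analytic_spread_def J_def enat .
qed simp

end

theorem lemma3p6:
  fixes R :: "('a, 'b) ring_scheme" and m :: "'a set" and I :: "nat \<Rightarrow> 'a set"
  assumes "local_ring R m"
    and "ring_filtration R I"
    and "krull_dim R = 0 \<Longrightarrow> I 1 \<noteq> carrier R"
  shows "analytic_spread R m I \<le> krull_dim R \<and>
    (\<forall>J. ideal J R \<longrightarrow> (krull_dim R = 0 \<longrightarrow> J \<noteq> carrier R) \<longrightarrow>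
       ideal_analytic_spread R m J \<le> krull_dim R)"
proof (intro conjI allI impI)
  interpret L: local_ring R m by fact
  show "analytic_spread R m I \<le> krull_dim R"
    by (rule filtered_local_ring.analytic_spread_le[OF filtered_local_ring.intro[OF assms(1,2)] assms(3)])
  fix J assume J: "ideal J R" and J1: "krull_dim R = 0 \<longrightarrow> J \<noteq> carrier R"
  have "ideal_power R J 1 = carrier R \<cdot>\<^bsub>R\<^esub> J" by simp
  also have "\<dots> = J"
    using L.ideal_prod_one(1)[OF J] L.ideal_prod_commute[OF J L.oneideal] by simp
  finally have "ideal_power R J 1 = J" .
  then show "ideal_analytic_spread R m J \<le> krull_dim R"
    unfolding ideal_analytic_spread_def
    using J1 filtered_local_ring.analytic_spread_le[OF filtered_local_ring.intro[OF assms(1) L.ideal_power_filtration[OF J]]]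
    by simp
qed

end
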